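(* Let $c\colon\mathbf{R}^n\to\mathbf{R}^m$ be a $C^1$-smooth mapping, $h\colon\mathbf{R}^m\to\mathbf{R}\cup\{\pm\infty\}$ a closed function, and $\varphi(x):=h(c(x))$. Suppose $c$ is transverse to $h$ at some point $\bar x$ with $0\in\partial\varphi(\bar x)$. Suppose that $\nabla c$ is Lipschitz continuous around $\bar x$ and that $h$ is prox-regular at $c(\bar x)$ for every subgradient $w\in\partial h(c(\bar x))$ satisfying $0=\nabla c(\bar x)^*w$. For $t>0$ consider the following two conditions: (i) there exists a $\varphi$-attentive localization of $\partial\varphi$ around $(\bar x,0)$ that is metrically subregular at $(\bar x,0)$; (ii) there exists a $\varphi(\cdot,\cdot)$-attentive localization of $\mathcal{G}_t$ around $(\bar x,0)$ that is metrically subregular at $(\bar x,0)$. Then the implication (i)$\Rightarrow$(ii) always holds. Conversely, there exists a number $\bar t>0$ so that for all $t\in(0,\bar t)$ the implication (ii)$\Rightarrow$(i) holds. When $h$ is convex, the localizations are not needed: the following two conditions are equivalent for any $t>0$: (i') the subdifferential $\partial\varphi$ is metrically subregular at $(\bar x,0)$; (ii') the prox-gradient mapping $\mathcal{G}_t$ is metrically subregular at $(\bar x,0)$.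
   Context: A function $f\colon\mathbf{R}^n\to\mathbf{R}\cup\{\pm\infty\}$ is closed if it is lower semicontinuous. Subdifferentials of a closed $f$ at $\bar x$ with $f(\bar x)$ finite: the proximal subdifferential $\partial_pf(\bar x)$ is the set of $v$ for which there exist a neighborhood $\mathcal{X}$ of $\bar x$ and $r>0$ with $f(x)\ge f(\bar x)+\langle v,x-\bar x\rangle-\frac r2\|x-\bar x\|^2$ on $\mathcal{X}$; the limiting subdifferential $\partial f(\bar x)$ is the set of $v$ for which there exist $x_i$ and $v_i\in\partial_pf(x_i)$ with $(x_i,f(x_i),v_i)\to(\bar x,f(\bar x),v)$; the horizon subdifferential $\partial^\infty f(\bar x)$ is the set of $v$ for which there exist $x_i$, $v_i\in\partial f(x_i)$ and reals $t_i\searrow0$ with $(x_i,f(x_i),t_iv_i)\to(\bar x,f(\bar x),v)$. A point $x$ is stationary for $f$ if $0\in\partial f(x)$. $c$ is transverse to $h$ at $\bar x$ (with $h(c(\bar x))$ finite) if $\partial^\infty h(c(\bar x))\cap\mathrm{Null}(\nabla c(\bar x)^* )=\{0\}$. A closed function $f$ is prox-regular at $\bar x$ for $\bar v\in\partial f(\bar x)$ if there exist neighborhoods $\mathcal{X}$ of $\bar x$, $\mathcal{V}$ of $\bar v$ and constants $\epsilon,r>0$ so that $f(y)\ge f(x)+\langle v,y-x\rangle-\frac r2\|y-x\|^2$ for all $x,y\in\mathcal{X}$ with $|f(x)-f(\bar x)|<\epsilon$ and every $v\in\mathcal{V}\cap\partial f(x)$. Linearizations: $\varphi(x;y)=\varphi(x,y):=h\big(c(x)+\nabla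 c(x)(y-x)\big)$ and $\varphi_t(x;y):=\varphi(x;y)+\frac1{2t}\|x-y\|^2$. Set-valued maps: $\mathcal{S}_t(x)=\{z: z\text{ is a stationary point of }\varphi_t(x;\cdot)\}$ and $\mathcal{G}_t(x)=t^{-1}(x-\mathcal{S}_t(x))$. Localizations: a map $W\colon\mathbf{R}^n\rightrightarrows\mathbf{R}^n$ is a $\varphi$-attentive localization of $\partial\varphi$ around $(\bar x,0)$ if there exist neighborhoods $\mathcal{X}$ of $\bar x$, $\mathcal{V}$ of $0$ and $\epsilon>0$ so that for all $x\in\mathcal{X}$, $v\in\mathcal{V}$ with $|\varphi(x)-\varphi(\bar x)|<\epsilon$ one has $v\in\partial\varphi(x)\Leftrightarrow v\in W(x)$. A map $W$ is a $\varphi(\cdot,\cdot)$-attentive localization of $\mathcal{S}_t$ around $(\bar x,\bar x)$ if there exist neighborhoods $\mathcal{X}$ and $\mathcal{Y}$ of $\bar x$ and $\epsilon>0$ so that for all $x\in\mathcal{X}$, $y\in\mathcal{Y}$ with $|\varphi(x;y)-\varphi(\bar x)|<\epsilon$ one has $y\in\mathcal{S}_t(x)\Leftrightarrow y\in W(x)$. A map $W$ is a $\varphi(\cdot,\cdot)$-attentive localization of $\mathcal{G}_t$ around $(\bar x,0)$ if $W=t^{-1}(I-\widehat W)$ with $\widehat W$ a $\varphi(\cdot,\cdot)$-attentive localization of $\mathcal{S}_t$ around $(\bar x,\bar x)$. A set-valued map $F$ is metrically subregular at $(\bar x,\bar y)\in\mathrm{gph}\,F$ if there exist $l>0$ and a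 neighborhood $\mathcal{X}$ of $\bar x$ with $\mathrm{dist}(x;F^{-1}(\bar y))\le l\,\mathrm{dist}(\bar y;F(x))$ for all $x\in\mathcal{X}$ (distance to the empty set is $+\infty$). *)

theory Defs
  imports "HOL-Analysis.Analysis"
begin

definition closed_fun :: "('a::euclidean_space \<Rightarrow> ereal) \<Rightarrow> bool" where
  "closed_fun f \<longleftrightarrow> (\<forall>x. f x \<le> Liminf (at x) f)"

text \<open>The library's \<open>convex_on\<close> only covers real-valued functions.\<close>
definition convex_fun :: "('a::euclidean_space \<Rightarrow> ereal) \<Rightarrow> bool" where
  "convex_fun f \<longleftrightarrow> convex {(x, r::real). f x \<le> ereal r}"

text \<open>All three subdifferentials are empty at points where \<open>f\<close> is not finite.\<close>
definition proximal_subdiff :: "('a::euclidean_space \<Rightarrow> ereal) \<Rightarrow> 'a \<Rightarrow> 'a set" where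
  "proximal_subdiff f xbar =
    {v. \<bar>f xbar\<bar> \<noteq> \<infinity> \<and>
        (\<exists>X r. open X \<and> xbar \<in> X \<and> r > 0 \<and>
          (\<forall>x\<in>X. f x \<ge> f xbar + ereal (v \<bullet> (x - xbar) - r / 2 * (norm (x - xbar))\<^sup>2)))}"

definition limiting_subdiff :: "('a::euclidean_space \<Rightarrow> ereal) \<Rightarrow> 'a \<Rightarrow> 'a set" where
  "limiting_subdiff f xbar =
    {v. \<bar>f xbar\<bar> \<noteq> \<infinity> \<and>
        (\<exists>x w. (\<forall>i::nat. w i \<in> proximal_subdiff f (x i)) \<and>
          x \<longlonglongrightarrow> xbar \<and> (\<lambda>i. f (x i)) \<longlonglongrightarrow> f xbar \<and> w \<longlonglongrightarrow> v)}"

definition horizon_subdiff :: "('a::euclidean_space \<Rightarrow> ereal) \<Rightarrow> 'a \<Rightarrow> 'a set" where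
  "horizon_subdiff f xbar =
    {v. \<bar>f xbar\<bar> \<noteq> \<infinity> \<and>
        (\<exists>x w t. (\<forall>i::nat. w i \<in> limiting_subdiff f (x i)) \<and>
          filterlim t (at_right (0::real)) sequentially \<and>
          x \<longlonglongrightarrow> xbar \<and> (\<lambda>i. f (x i)) \<longlonglongrightarrow> f xbar \<and> (\<lambda>i. t i *\<^sub>R w i) \<longlonglongrightarrow> v)}"

definition stationary :: "('a::euclidean_space \<Rightarrow> ereal) \<Rightarrow> 'a \<Rightarrow> bool" where
  "stationary f x \<longleftrightarrow> 0 \<in> limiting_subdiff f x"

definition prox_regular :: "('a::euclidean_space \<Rightarrow> ereal) \<Rightarrow> 'a \<Rightarrow> 'a \<Rightarrow> bool" where
  "prox_regular f xbar vbar \<longleftrightarrow>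
    closed_fun f \<and> vbar \<in> limiting_subdiff f xbar \<and>
    (\<exists>X V \<epsilon> r. open X \<and> xbar \<in> X \<and> open V \<and> vbar \<in> V \<and> \<epsilon> > 0 \<and> r > 0 \<and>
      (\<forall>x\<in>X. \<forall>y\<in>X. \<forall>v \<in> V \<inter> limiting_subdiff f x.
        \<bar>f x - f xbar\<bar> < ereal \<epsilon> \<longrightarrow>
        f y \<ge> f x + ereal (v \<bullet> (y - x) - r / 2 * (norm (y - x))\<^sup>2)))"

text \<open>In the following, \<open>Dc x\<close> plays the role of the derivative of \<open>c\<close> at \<open>x\<close>.\<close>

definition transverse ::
  "('a::euclidean_space \<Rightarrow> 'b::euclidean_space) \<Rightarrow> ('a \<Rightarrow> 'a \<Rightarrow>\<^sub>L 'b) \<Rightarrow> ('b \<Rightarrow> ereal) \<Rightarrow> 'a \<Rightarrow> bool" where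
  "transverse c Dc h xbar \<longleftrightarrow>
    \<bar>h (c xbar)\<bar> \<noteq> \<infinity> \<and>
    horizon_subdiff h (c xbar) \<inter> {w. adjoint (blinfun_apply (Dc xbar)) w = 0} = {0}"

definition linearization ::
  "('a::euclidean_space \<Rightarrow> 'b::euclidean_space) \<Rightarrow> ('a \<Rightarrow> 'a \<Rightarrow>\<^sub>L 'b) \<Rightarrow> ('b \<Rightarrow> ereal) \<Rightarrow> 'a \<Rightarrow> 'a \<Rightarrow> ereal" where
  "linearization c Dc h x y = h (c x + blinfun_apply (Dc x) (y - x))"

definition prox_linearization ::
  "('a::euclidean_space \<Rightarrow> 'b::euclidean_space) \<Rightarrow> ('a \<Rightarrow> 'a \<Rightarrow>\<^sub>L 'b) \<Rightarrow> ('b \<Rightarrow> ereal) \<Rightarrow> real \<Rightarrow>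
    'a \<Rightarrow> 'a \<Rightarrow> ereal" where
  "prox_linearization c Dc h t x y =
    linearization c Dc h x y + ereal (1 / (2 * t) * (norm (x - y))\<^sup>2)"

definition prox_map ::
  "('a::euclidean_space \<Rightarrow> 'b::euclidean_space) \<Rightarrow> ('a \<Rightarrow> 'a \<Rightarrow>\<^sub>L 'b) \<Rightarrow> ('b \<Rightarrow> ereal) \<Rightarrow> real \<Rightarrow>
    'a \<Rightarrow> 'a set" where
  "prox_map c Dc h t x = {z. stationary (prox_linearization c Dc h t x) z}"

text \<open>The set-valued map \<open>t\<^sup>-\<^sup>1(I - S)\<close>.\<close>
definition scaled_residual :: "real \<Rightarrow> ('a::euclidean_space \<Rightarrow> 'a set) \<Rightarrow> 'a \<Rightarrow> 'a set" where
  "scaled_residual t S x = (\<lambda>z. inverse t *\<^sub>R (x - z)) ` S x"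

definition prox_gradient_map ::
  "('a::euclidean_space \<Rightarrow> 'b::euclidean_space) \<Rightarrow> ('a \<Rightarrow> 'a \<Rightarrow>\<^sub>L 'b) \<Rightarrow> ('b \<Rightarrow> ereal) \<Rightarrow> real \<Rightarrow>
    'a \<Rightarrow> 'a set" where
  "prox_gradient_map c Dc h t = scaled_residual t (prox_map c Dc h t)"

definition subdiff_localization ::
  "('a::euclidean_space \<Rightarrow> ereal) \<Rightarrow> 'a \<Rightarrow> ('a \<Rightarrow> 'a set) \<Rightarrow> bool" where
  "subdiff_localization \<phi> xbar W \<longleftrightarrow>
    (\<exists>X V \<epsilon>. open X \<and> xbar \<in> X \<and> open V \<and> 0 \<in> V \<and> \<epsilon> > 0 \<and>
      (\<forall>x\<in>X. \<forall>v\<in>V. \<bar>\<phi> x - \<phi> xbar\<bar> < ereal \<epsilon> \<longrightarrow>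
        (v \<in> limiting_subdiff \<phi> x \<longleftrightarrow> v \<in> W x)))"

definition prox_map_localization ::
  "('a::euclidean_space \<Rightarrow> 'b::euclidean_space) \<Rightarrow> ('a \<Rightarrow> 'a \<Rightarrow>\<^sub>L 'b) \<Rightarrow> ('b \<Rightarrow> ereal) \<Rightarrow> real \<Rightarrow>
    'a \<Rightarrow> ('a \<Rightarrow> 'a set) \<Rightarrow> bool" where
  "prox_map_localization c Dc h t xbar W \<longleftrightarrow>
    (\<exists>X Y \<epsilon>. open X \<and> xbar \<in> X \<and> open Y \<and> xbar \<in> Y \<and> \<epsilon> > 0 \<and>
      (\<forall>x\<in>X. \<forall>y\<in>Y. \<bar>linearization c Dc h x y - h (c xbar)\<bar> < ereal \<epsilon> \<longrightarrow>
        (y \<in> prox_map c Dc h t x \<longleftrightarrow> y \<in> W x)))"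

definition prox_gradient_localization ::
  "('a::euclidean_space \<Rightarrow> 'b::euclidean_space) \<Rightarrow> ('a \<Rightarrow> 'a \<Rightarrow>\<^sub>L 'b) \<Rightarrow> ('b \<Rightarrow> ereal) \<Rightarrow> real \<Rightarrow>
    'a \<Rightarrow> ('a \<Rightarrow> 'a set) \<Rightarrow> bool" where
  "prox_gradient_localization c Dc h t xbar W \<longleftrightarrow>
    (\<exists>W'. prox_map_localization c Dc h t xbar W' \<and> W = scaled_residual t W')"

text \<open>Distance to a set, equal to \<open>\<infinity>\<close> for the empty set (the library's \<open>infdist\<close> is \<open>0\<close> there).\<close>
definition set_edist :: "'a::metric_space \<Rightarrow> 'a set \<Rightarrow> ereal" where
  "set_edist x S = (INF s\<in>S. ereal (dist x s))"

definition metrically_subregular ::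
  "('a::metric_space \<Rightarrow> 'b::metric_space set) \<Rightarrow> 'a \<Rightarrow> 'b \<Rightarrow> bool" where
  "metrically_subregular F xbar ybar \<longleftrightarrow>
    ybar \<in> F xbar \<and>
    (\<exists>l X. l > 0 \<and> open X \<and> xbar \<in> X \<and>
      (\<forall>x\<in>X. set_edist x {z. ybar \<in> F z} \<le> ereal l * set_edist ybar (F x)))"

end

theory Submission
  imports Defs
begin

text \<open>
  Transversality and prox-regularity (or convexity) give, by compactness, one uniform estimate: near
  \<open>c xbar\<close>, a subgradient \<open>w\<close> of \<open>h\<close> that almost annihilates the range of the derivative is bounded and
  satisfies a proximal inequality with a fixed constant \<open>r\<close> (with \<open>r = 0\<close> and no attentiveness when \<open>h\<close>
  is convex).

  For a prox-gradient step \<open>y\<close> of \<open>x\<close> with multiplier \<open>w\<close> at \<open>z0 = c x + Dc x (y - x)\<close>, minimise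
  \<open>h z - w \<bullet> z + \<rho> |z - z0|\<^sup>2 + |u - y|\<^sup>2 + K |z - c u|\<close> over \<open>(u, z)\<close>. For large \<open>K\<close> the penalty is
  exact, for otherwise the multiplier at the minimiser would violate the bound. So \<open>z = c u\<close>, and \<open>u\<close>
  carries a subgradient of \<open>h \<circ> c\<close> of norm \<open>O(|x - y|)\<close> with \<open>|u - x| = O(|x - y|)\<close>.
  Conversely, for a small subgradient \<open>v\<close> of \<open>h \<circ> c\<close> at \<open>x\<close> and \<open>1 / t\<close> larger than \<open>r |Dc|\<^sup>2\<close>, minimising the
  prox-linearization over a ball yields a prox-gradient step of length \<open>O(|v|)\<close>. Since the
  stationary points of \<open>h \<circ> c\<close> and the fixed points of the prox map agree near \<open>xbar\<close>, error bounds
  transfer in both directions.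
\<close>

subsection \<open>Lower semicontinuity and limiting subgradients\<close>

text \<open>The obstacle is that the multiplier of a prox-gradient step lives at \<open>z0\<close>,
  in general not a value of \<open>c\<close>, while \<open>h\<close> may be infinite at
  \<open>c y\<close>; no point of the domain of \<open>h \<circ> c\<close> is at hand to start from.
  Making \<open>z\<close> a variable of its own gives the feasible competitor
  \<open>(y, z0)\<close>. Its penalty is \<open>O(|x - y|\<^sup>2)\<close> because \<open>Dc\<close>
  is Lipschitz, and the quadratic terms turn this into distances \<open>O(|x - y|)\<close>. The
  bound on \<open>t\<close> arises since the proximal inequality, pulled back along the
  linearization, loses curvature \<open>r |Dc|\<^sup>2\<close>, which the prox term must outweigh. A
  localization may be arbitrary at points whose value is not close to that at \<open>xbar\<close>.
  The error bounds therefore measure the distance to the solution set enlarged by such points. Each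
  transfer costs half of the tolerance on values; with tolerance \<infinity> nothing is lost and the
  enlargement is empty.\<close>

lemma closed_fun_eventually_gt:
  assumes "closed_fun h" "a < h z"
  shows "eventually (\<lambda>z'. a < h z') (nhds z)"
proof -
  have "h z \<le> Liminf (at z) h" using assms by (simp add: closed_fun_def)
  then have "eventually (\<lambda>z'. a < h z') (at z)"
    using assms(2) le_Liminf_iff by blast
  then have "eventually (\<lambda>z'. z' \<noteq> z \<longrightarrow> z' \<in> UNIV \<longrightarrow> a < h z') (nhds z)"
    unfolding eventually_at_filter .
  then show ?thesis by eventually_elim (use assms(2) in auto)
qed

text \<open>If every \<open>x\<close> in \<open>S\<close> were beaten by some \<open>g x\<close>,
  the open sets on which \<open>f\<close> exceeds \<open>f (g x)\<close> would cover
  \<open>S\<close>. Take the least value \<open>f (g d)\<close> over a finite subcover: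
  \<open>g d\<close> lies in some \<open>U x\<close>, so \<open>f (g x) < f (g d)\<close>, a
  contradiction.\<close>

lemma compact_attains_min_lsc:
  fixes f :: "'a::topological_space \<Rightarrow> ereal"
  assumes "compact S" "S \<noteq> {}"
    and lsc: "\<And>x a. x \<in> S \<Longrightarrow> a < f x \<Longrightarrow> eventually (\<lambda>x'. a < f x') (nhds x)"
  obtains x where "x \<in> S" "\<And>y. y \<in> S \<Longrightarrow> f x \<le> f y"
proof (rule ccontr)
  assume "\<not> thesis"
  then have "\<forall>x\<in>S. \<exists>y\<in>S. f y < f x" using that by (meson not_le)
  then obtain g where g: "\<And>x. x \<in> S \<Longrightarrow> g x \<in> S \<and> f (g x) < f x" by metis
  have "\<forall>x\<in>S. \<exists>U. open U \<and> x \<in> U \<and> (\<forall>x'\<in>U. f (g x) < f x')"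
    using lsc g unfolding eventually_nhds by blast
  then obtain U where U: "\<And>x. x \<in> S \<Longrightarrow> open (U x) \<and> x \<in> U x \<and> (\<forall>x'\<in>U x. f (g x) < f x')"
    by metis
  obtain D where D: "D \<subseteq> S" "finite D" "S \<subseteq> (\<Union>x\<in>D. U x)"
    using compactE_image[OF \<open>compact S\<close>, of S U] U by blast
  have "D \<noteq> {}" using D assms(2) by auto
  then obtain d where d: "d \<in> D" "\<And>x. x \<in> D \<Longrightarrow> f (g d) \<le> f (g x)"
    using ex_min_if_finite[of "(\<lambda>x. f (g x)) ` D"] D(2) by (auto simp: not_less)
  have "g d \<in> S" using d D g by auto
  then obtain x where "x \<in> D" "g d \<in> U x" using D by auto
  then have "f (g x) < f (g d)" using U D by auto
  then show False using d(2)[OF \<open>x \<in> D\<close>] by simp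
qed

lemma eventually_gt_add_continuous:
  assumes h: "\<And>b. b < h z \<Longrightarrow> eventually (\<lambda>z'. b < h z') F"
    and q: "(q \<longlongrightarrow> q z) F"
    and a: "a < h z + ereal (q z)"
  shows "eventually (\<lambda>z'. a < h z' + ereal (q z')) F"
proof -
  have "a - ereal (q z) < h z" using a by (simp add: ereal_minus_less)
  \<comment> \<open>A real number \<open>b\<close> below \<open>h z\<close> keeps infinite values of
    \<open>h\<close> out of the arithmetic.\<close>
  then obtain b where b: "a - ereal (q z) < ereal b" "ereal b < h z" using ereal_dense2 by blast
  then have "a < ereal (b + q z)" by (simp add: ereal_minus_less)
  then obtain a' where a': "a < ereal a'" "ereal a' < ereal (b + q z)" using ereal_dense2 by blast
  have "eventually (\<lambda>z'. a' - b < q z') F" using q a'(2) by (intro order_tendstoD) auto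
  with h[OF b(2)] show ?thesis
  proof eventually_elim
    case (elim z')
    have "a < ereal (a' )" by fact
    also have "\<dots> < ereal b + ereal (q z')" using elim by simp
    also have "\<dots> \<le> h z' + ereal (q z')" using elim by (intro add_right_mono) simp
    finally show ?case .
  qed
qed

text \<open>The compact set is arbitrary because two shapes occur: boxes for the penalty problems,
  and the graph of an affine map over a ball in \<open>prox_step_exists\<close>.\<close>

lemma penalized_min_exists:
  fixes h :: "'b::euclidean_space \<Rightarrow> ereal" and q :: "'a::euclidean_space \<times> 'b \<Rightarrow> real"
  assumes "closed_fun h" "continuous_on UNIV q" "compact S" "S \<noteq> {}"
  obtains u z where "(u, z) \<in> S"
    "\<And>u' z'. (u', z') \<in> S \<Longrightarrow> h z + ereal (q (u, z)) \<le> h z' + ereal (q (u', z'))"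
proof -
  have *: "eventually (\<lambda>x'. a < h (snd x') + ereal (q x')) (nhds x)"
    if "a < h (snd x) + ereal (q x)" for a x
  proof (rule eventually_gt_add_continuous[of "\<lambda>x. h (snd x)"])
    show "eventually (\<lambda>z'. b < h (snd z')) (nhds x)" if "b < h (snd x)" for b
    proof -
      have "filterlim snd (nhds (snd x)) (nhds x)" by (intro tendsto_snd filterlim_ident)
      then show ?thesis
        using closed_fun_eventually_gt[OF assms(1) that] by (rule eventually_compose_filterlim[rotated])
    qed
    have "isCont q x" using assms(2) continuous_on_eq_continuous_at[OF open_UNIV] by blast
    then show "(q \<longlongrightarrow> q x) (nhds x)" using isCont_def tendsto_at_iff_tendsto_nhds by blast
  qed (use that in auto)
  obtain x where "x \<in> S" "\<And>y. y \<in> S \<Longrightarrow> h (snd x) + ereal (q x) \<le> h (snd y) + ereal (q y)"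
    using compact_attains_min_lsc[of S "\<lambda>x. h (snd x) + ereal (q x)"] assms(3,4) * by blast
  then show ?thesis using that[of "fst x" "snd x"] by force
qed

lemma abs_ereal_diff_less_iff:
  assumes "\<bar>b\<bar> \<noteq> \<infinity>"
  shows "\<bar>a - b\<bar> < ereal e \<longleftrightarrow> \<bar>a\<bar> \<noteq> \<infinity> \<and> \<bar>real_of_ereal a - real_of_ereal b\<bar> < e"
  using assms by (cases a; cases b) auto

lemma tendsto_ereal_iff_abs_diff:
  fixes f :: "'i \<Rightarrow> ereal"
  assumes "\<bar>l\<bar> \<noteq> \<infinity>"
  shows "(f \<longlongrightarrow> l) F \<longleftrightarrow> (\<forall>e>0. eventually (\<lambda>i. \<bar>f i - l\<bar> < ereal e) F)"
proof -
  obtain lr where lr: "l = ereal lr" using assms by auto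
  show ?thesis
  proof
    assume L: "(f \<longlongrightarrow> l) F"
    show "\<forall>e>0. eventually (\<lambda>i. \<bar>f i - l\<bar> < ereal e) F"
    proof (intro allI impI)
      fix e :: real assume "e > 0"
      have "eventually (\<lambda>i. f i > ereal (lr - e)) F"
        "eventually (\<lambda>i. f i < ereal (lr + e)) F"
        using order_tendstoD[OF L] \<open>e > 0\<close> lr by auto
      then show "eventually (\<lambda>i. \<bar>f i - l\<bar> < ereal e) F"
      proof eventually_elim
        case (elim i)
        then show ?case using lr by (cases "f i") auto
      qed
    qed
  next
    assume L: "\<forall>e>0. eventually (\<lambda>i. \<bar>f i - l\<bar> < ereal e) F"
    show "(f \<longlongrightarrow> l) F"
    proof (rule order_tendstoI)
      fix a assume "a < l"
      then obtain b where b: "a < ereal b" "ereal b < l" using ereal_dense2 by blast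
      then have "lr - b > 0" using lr by auto
      then have "eventually (\<lambda>i. \<bar>f i - l\<bar> < ereal (lr - b)) F" using L by blast
      then show "eventually (\<lambda>i. a < f i) F"
      proof eventually_elim
        case (elim i)
        then have "ereal b < f i" using lr by (cases "f i") auto
        then show ?case using b by simp
      qed
    next
      fix a assume "l < a"
      then obtain b where b: "l < ereal b" "ereal b < a" using ereal_dense2 by blast
      then have "b - lr > 0" using lr by auto
      then have "eventually (\<lambda>i. \<bar>f i - l\<bar> < ereal (b - lr)) F" using L by blast
      then show "eventually (\<lambda>i. f i < a) F"
      proof eventually_elim
        case (elim i)
        then have "f i < ereal b" using lr by (cases "f i") auto
        then show ?case using b by simp
      qed
    qed
  qed
qed

text \<open>In this form diagonal arguments become triangle inequalities. For the converse the
  tolerances \<open>1 / (i + 1)\<close> rebuild the sequences.\<close>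

lemma limiting_subdiff_iff:
  "v \<in> limiting_subdiff f x \<longleftrightarrow> \<bar>f x\<bar> \<noteq> \<infinity> \<and>
     (\<forall>e>0. \<exists>y w. w \<in> proximal_subdiff f y \<and> dist y x < e \<and> \<bar>f y - f x\<bar> < ereal e \<and> dist w v < e)"
  (is "_ \<longleftrightarrow> _ \<and> ?R")
proof (cases "\<bar>f x\<bar> \<noteq> \<infinity>")
  case False
  then show ?thesis by (auto simp: limiting_subdiff_def)
next
  case fin: True
  note conv = tendsto_ereal_iff_abs_diff[OF fin]
  show ?thesis
  proof
    assume "v \<in> limiting_subdiff f x"
    then obtain y w where yw: "\<And>i. w i \<in> proximal_subdiff f (y i)" "y \<longlonglongrightarrow> x"
      "(\<lambda>i. f (y i)) \<longlonglongrightarrow> f x" "w \<longlonglongrightarrow> v" by (auto simp: limiting_subdiff_def)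
    show "\<bar>f x\<bar> \<noteq> \<infinity> \<and> ?R"
    proof (intro conjI fin allI impI)
      fix e :: real assume "e > 0"
      have "eventually (\<lambda>i. dist (y i) x < e \<and> \<bar>f (y i) - f x\<bar> < ereal e \<and> dist (w i) v < e) sequentially"
        using tendstoD[OF yw(2) \<open>e > 0\<close>] tendstoD[OF yw(4) \<open>e > 0\<close>] conv[THEN iffD1, OF yw(3)] \<open>e > 0\<close>
        by (intro eventually_conj) auto
      then obtain i where "dist (y i) x < e \<and> \<bar>f (y i) - f x\<bar> < ereal e \<and> dist (w i) v < e"
        using eventually_sequentially by auto
      then show "\<exists>y w. w \<in> proximal_subdiff f y \<and> dist y x < e \<and> \<bar>f y - f x\<bar> < ereal e \<and> dist w v < e"
        using yw(1) by blast
    qed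
  next
    assume R: "\<bar>f x\<bar> \<noteq> \<infinity> \<and> ?R"
    have "\<forall>i::nat. \<exists>y w. w \<in> proximal_subdiff f y \<and> dist y x < inverse (Suc i) \<and>
        \<bar>f y - f x\<bar> < ereal (inverse (Suc i)) \<and> dist w v < inverse (Suc i)" using R by simp
    then obtain y w where yw: "\<And>i::nat. w i \<in> proximal_subdiff f (y i)"
        "\<And>i. dist (y i) x < inverse (Suc i)"
        "\<And>i. \<bar>f (y i) - f x\<bar> < ereal (inverse (Suc i))" "\<And>i. dist (w i) v < inverse (Suc i)"
      by metis
    have ev: "eventually (\<lambda>i. inverse (real (Suc i)) < e) sequentially" if "e > 0" for e
      using LIMSEQ_inverse_real_of_nat that by (rule order_tendstoD)
    have "y \<longlonglongrightarrow> x" 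
  proof (rule tendstoI)
    fix e :: real assume "e > 0"
    show "eventually (\<lambda>i. dist (y i) x < e) sequentially"
      using ev[OF \<open>e > 0\<close>] by eventually_elim (use yw(2) less_trans in blast)
  qed
    moreover have "w \<longlonglongrightarrow> v" 
  proof (rule tendstoI)
    fix e :: real assume "e > 0"
    show "eventually (\<lambda>i. dist (w i) v < e) sequentially"
      using ev[OF \<open>e > 0\<close>] by eventually_elim (use yw(4) less_trans in blast)
  qed
    moreover have "(\<lambda>i. f (y i)) \<longlonglongrightarrow> f x"
      unfolding conv
    proof (intro allI impI)
      fix e :: real assume "e > 0"
      show "eventually (\<lambda>i. \<bar>f (y i) - f x\<bar> < ereal e) sequentially"
        using ev[OF \<open>e > 0\<close>] by eventually_elim (use yw(3) less_ereal.simps(1) less_trans in blast)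
    qed
    ultimately show "v \<in> limiting_subdiff f x" using yw(1) fin by (auto simp: limiting_subdiff_def)
  qed
qed

lemma proximal_subset_limiting: "proximal_subdiff f x \<subseteq> limiting_subdiff f x"
proof
  fix v assume v: "v \<in> proximal_subdiff f x"
  then have "\<bar>f x\<bar> \<noteq> \<infinity>" by (simp add: proximal_subdiff_def)
  then show "v \<in> limiting_subdiff f x" unfolding limiting_subdiff_iff using v
    by (intro conjI allI impI exI[of _ x] exI[of _ v]) auto
qed

lemma limiting_subdiff_closed:
  assumes fin: "\<bar>f x\<bar> \<noteq> \<infinity>"
    and ap: "\<And>e. e > 0 \<Longrightarrow> \<exists>y w. w \<in> limiting_subdiff f y \<and> dist y x < e \<and> \<bar>f y - f x\<bar> < ereal e \<and> dist w v < e"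
  shows "v \<in> limiting_subdiff f x"
  unfolding limiting_subdiff_iff
proof (intro conjI fin allI impI)
  fix e :: real assume "e > 0"
  then obtain y w where yw: "w \<in> limiting_subdiff f y" "dist y x < e/2" "\<bar>f y - f x\<bar> < ereal (e/2)" "dist w v < e/2"
    using ap[of "e/2"] by auto
  have fy: "\<bar>f y\<bar> \<noteq> \<infinity>" using yw(1) by (simp add: limiting_subdiff_def)
  obtain y' w' where yw': "w' \<in> proximal_subdiff f y'" "dist y' y < e/2" "\<bar>f y' - f y\<bar> < ereal (e/2)" "dist w' w < e/2"
    using yw(1) \<open>e > 0\<close> unfolding limiting_subdiff_iff by (meson half_gt_zero)
  have "\<bar>f y' - f x\<bar> < ereal e"
    using yw(3) yw'(3) unfolding abs_ereal_diff_less_iff[OF fin] abs_ereal_diff_less_iff[OF fy] by linarith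
  moreover have "dist y' x < e" "dist w' v < e"
    using yw yw' dist_triangle_half_l by (metis dist_commute)+
  ultimately show "\<exists>y w. w \<in> proximal_subdiff f y \<and> dist y x < e \<and> \<bar>f y - f x\<bar> < ereal e \<and> dist w v < e"
    using yw'(1) by blast
qed

subsection \<open>Adjoints and optimality conditions for penalized problems\<close>

lemma adjoint_inner: "blinfun_apply A u \<bullet> w = u \<bullet> adjoint (blinfun_apply A) w"
  for A :: "'a::euclidean_space \<Rightarrow>\<^sub>L 'b::euclidean_space"
  by (rule adjoint_works[symmetric]) (simp add: blinfun.bounded_linear_right bounded_linear.linear)

lemma inner_adjoint: "adjoint (blinfun_apply A) w \<bullet> u = w \<bullet> blinfun_apply A u"
  for A :: "'a::euclidean_space \<Rightarrow>\<^sub>L 'b::euclidean_space"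
  by (metis adjoint_inner inner_commute)

lemma adjoint_unique_inner:
  fixes A :: "'a::euclidean_space \<Rightarrow>\<^sub>L 'b::euclidean_space"
  assumes "\<And>u. blinfun_apply A u \<bullet> w = u \<bullet> v"
  shows "adjoint (blinfun_apply A) w = v"
  using assms by (metis adjoint_inner vector_eq_ldot)

lemma linear_adjoint_blinfun: "linear (adjoint (blinfun_apply A))"
  for A :: "'a::euclidean_space \<Rightarrow>\<^sub>L 'b::euclidean_space"
  by (simp add: adjoint_linear blinfun.bounded_linear_right bounded_linear.linear)

text \<open>With \<open>d\<close> the vector on the left, \<open>d \<bullet> d = (A - B) d \<bullet>
  w \<le> norm (A - B) * norm d * norm w\<close>; one factor \<open>norm d\<close> cancels.\<close>

lemma adjoint_diff_norm_le:
  fixes A B :: "'a::euclidean_space \<Rightarrow>\<^sub>L 'b::euclidean_space"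
  shows "norm (adjoint A w - adjoint B w) \<le> norm (A - B) * norm w"
proof -
  let ?d = "adjoint A w - adjoint B w"
  have "?d \<bullet> ?d = blinfun_apply (A - B) ?d \<bullet> w"
    by (simp add: blinfun.diff_left inner_diff_left inner_diff_right adjoint_inner)
  also have "\<dots> \<le> norm (blinfun_apply (A - B) ?d) * norm w" by (rule norm_cauchy_schwarz)
  also have "\<dots> \<le> norm (A - B) * norm ?d * norm w"
    by (intro mult_right_mono norm_blinfun) auto
  finally have "norm ?d * norm ?d \<le> norm ?d * (norm (A - B) * norm w)"
    by (simp add: power2_eq_square mult_ac flip: power2_norm_eq_inner)
  then show ?thesis by (cases "norm ?d = 0") (auto simp: mult_le_cancel_left)
qed

lemma adjoint_norm_le:
  fixes A :: "'a::euclidean_space \<Rightarrow>\<^sub>L 'b::euclidean_space"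
  shows "norm (adjoint A w) \<le> norm A * norm w"
proof -
  have "adjoint (blinfun_apply (0::'a \<Rightarrow>\<^sub>L 'b)) w = 0" by (rule adjoint_unique_inner) simp
  then show ?thesis using adjoint_diff_norm_le[of A w 0] by simp
qed

lemma tendsto_adjoint:
  fixes A :: "'i \<Rightarrow> 'a::euclidean_space \<Rightarrow>\<^sub>L 'b::euclidean_space"
  assumes "(A \<longlongrightarrow> B) F" "(w \<longlongrightarrow> v) F"
  shows "((\<lambda>i. adjoint (A i) (w i)) \<longlongrightarrow> adjoint B v) F"
proof (rule Lim_null_comparison[THEN LIM_zero_cancel])
  show "eventually (\<lambda>i. norm (adjoint (A i) (w i) - adjoint B v) \<le>
      norm (A i - B) * norm (w i) + norm B * norm (w i - v)) F"
  proof (intro always_eventually allI)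
    fix i
    have "adjoint (A i) (w i) - adjoint B v = (adjoint (A i) (w i) - adjoint B (w i)) + adjoint B (w i - v)"
      by (simp add: linear_diff[OF linear_adjoint_blinfun])
    also have "norm \<dots> \<le> norm (A i - B) * norm (w i) + norm B * norm (w i - v)"
      by (intro norm_triangle_le add_mono adjoint_diff_norm_le adjoint_norm_le)
    finally show "norm (adjoint (A i) (w i) - adjoint B v) \<le> \<dots>" .
  qed
  have "((\<lambda>i. norm (A i - B) * norm (w i) + norm B * norm (w i - v)) \<longlongrightarrow>
      norm (B - B) * norm v + norm B * norm (v - v)) F"
    by (intro tendsto_intros assms)
  then show "((\<lambda>i. norm (A i - B) * norm (w i) + norm B * norm (w i - v)) \<longlongrightarrow> 0) F" by simp
qed

lemma norm_diff_sq_expand: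
  "(norm (x - b))\<^sup>2 = (norm (y - b))\<^sup>2 + 2 * ((y - b) \<bullet> (x - y)) + (norm (x - y))\<^sup>2"
  for x y b :: "'a::real_inner"
  unfolding power2_norm_eq_inner by (simp add: inner_diff_left inner_diff_right inner_commute)

lemma ereal_add_real_le_iff:
  assumes "h0 + ereal q0 \<le> h1 + ereal q1"
  shows "h0 + ereal (q0 - q1) \<le> h1"
  using assms by (cases h0; cases h1) auto

text \<open>Apart from \<open>h\<close> the objective is smooth, so partial minimality suffices.
  With \<open>u = u0\<close> fixed, expanding the squares leaves a proximal inequality in
  \<open>z\<close>; with \<open>z = z0\<close> fixed, the derivative in \<open>u\<close> vanishes.
  The penalty multiplier \<open>(2 * K) *\<^sub>R (z0 - F u0)\<close> appears in both conclusions
  and links them. The parameters cover both uses: the fuzzy chain rule (\<rho> and \<open>a\<close>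
  zero) and the exact penalty (\<open>v\<close> zero, \<sigma> one).\<close>

lemma penalty_optimality:
  fixes h :: "'b::euclidean_space \<Rightarrow> ereal" and F :: "'a::euclidean_space \<Rightarrow> 'b"
  assumes fin: "\<bar>h z0\<bar> \<noteq> \<infinity>"
    and F: "(F has_derivative blinfun_apply A) (at u0)"
    and U: "open U" "u0 \<in> U" and Z: "open Z" "z0 \<in> Z"
    and opt: "\<And>u z. u \<in> U \<Longrightarrow> z \<in> Z \<Longrightarrow>
      h z0 + ereal (\<rho> * (norm (z0 - b))\<^sup>2 - a \<bullet> z0 + \<sigma> * (norm (u0 - y))\<^sup>2 - v \<bullet> u0 + K * (norm (z0 - F u0))\<^sup>2) \<le>
      h z + ereal (\<rho> * (norm (z - b))\<^sup>2 - a \<bullet> z + \<sigma> * (norm (u - y))\<^sup>2 - v \<bullet> u + K * (norm (z - F u))\<^sup>2)"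
    and pos: "\<rho> \<ge> 0" "K \<ge> 0"
    and w: "w = a - (2 * \<rho>) *\<^sub>R (z0 - b) - (2 * K) *\<^sub>R (z0 - F u0)"
  shows "w \<in> proximal_subdiff h z0"
    and "adjoint A ((2 * K) *\<^sub>R (z0 - F u0)) = (2 * \<sigma>) *\<^sub>R (u0 - y) - v"
proof -
  show "w \<in> proximal_subdiff h z0"
    unfolding proximal_subdiff_def
  \<comment> \<open>\<open>proximal_subdiff\<close> carries a factor 1/2 and demands a positive
    constant: hence the doubling and the \<open>+ 1\<close>.\<close>
  proof (intro CollectI conjI exI[of _ Z] exI[of _ "2 * (\<rho> + K) + 1"] ballI)
    fix z assume "z \<in> Z"
    have "h z0 + ereal ((\<rho> * (norm (z0 - b))\<^sup>2 - a \<bullet> z0 + \<sigma> * (norm (u0 - y))\<^sup>2 - v \<bullet> u0 + K * (norm (z0 - F u0))\<^sup>2)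
       - (\<rho> * (norm (z - b))\<^sup>2 - a \<bullet> z + \<sigma> * (norm (u0 - y))\<^sup>2 - v \<bullet> u0 + K * (norm (z - F u0))\<^sup>2)) \<le> h z"
      using opt[OF U(2) \<open>z \<in> Z\<close>] by (rule ereal_add_real_le_iff)
    moreover have "(\<rho> * (norm (z0 - b))\<^sup>2 - a \<bullet> z0 + \<sigma> * (norm (u0 - y))\<^sup>2 - v \<bullet> u0 + K * (norm (z0 - F u0))\<^sup>2)
       - (\<rho> * (norm (z - b))\<^sup>2 - a \<bullet> z + \<sigma> * (norm (u0 - y))\<^sup>2 - v \<bullet> u0 + K * (norm (z - F u0))\<^sup>2)
       = w \<bullet> (z - z0) - (\<rho> + K) * (norm (z - z0))\<^sup>2"
      unfolding w norm_diff_sq_expand[of z b z0] norm_diff_sq_expand[of z "F u0" z0]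
      by (simp add: inner_diff_left algebra_simps)
    moreover have "\<dots> \<ge> w \<bullet> (z - z0) - (2 * (\<rho> + K) + 1) / 2 * (norm (z - z0))\<^sup>2"
      by (simp add: algebra_simps)
    ultimately show "h z0 + ereal (w \<bullet> (z - z0) - (2 * (\<rho> + K) + 1) / 2 * (norm (z - z0))\<^sup>2) \<le> h z"
      by (smt (verit, best) add_left_mono ereal_less_eq(3) order_trans)
  qed (use fin Z pos in auto)
  \<comment> \<open>With \<open>z = z0\<close> fixed, the finite number \<open>h z0\<close> cancels
    and a smooth function of \<open>u\<close> is left.\<close>
  define g where "g u = \<sigma> * ((u - y) \<bullet> (u - y)) - v \<bullet> u + K * ((z0 - F u) \<bullet> (z0 - F u))" for u
  have min: "g u0 \<le> g u" if "u \<in> U" for u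
  proof -
    show ?thesis using opt[OF that Z(2)] fin
      unfolding g_def power2_norm_eq_inner[symmetric] by (cases "h z0") auto
  qed
  define D where "D e = \<sigma> * (2 * ((u0 - y) \<bullet> e)) - v \<bullet> e - K * (2 * ((z0 - F u0) \<bullet> blinfun_apply A e))" for e
  have "(g has_derivative D) (at u0)"
    unfolding g_def D_def
    by (rule derivative_eq_intros F refl | simp add: inner_commute algebra_simps)+
  then have "D = (\<lambda>e. 0)"
    by (rule differential_zero_maxmin[OF U(2,1)]) (use min in auto)
  then have D0: "D e = 0" for e by simp
  show "adjoint A ((2 * K) *\<^sub>R (z0 - F u0)) = (2 * \<sigma>) *\<^sub>R (u0 - y) - v"
  proof (rule adjoint_unique_inner)
    fix e show "blinfun_apply A e \<bullet> (2 * K) *\<^sub>R (z0 - F u0) = e \<bullet> ((2 * \<sigma>) *\<^sub>R (u0 - y) - v)"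
      using D0[of e] unfolding D_def
      by (simp add: inner_diff_right inner_commute algebra_simps)
  qed
qed

subsection \<open>Chain rules\<close>

lemma ereal_between_real:
  assumes "\<not> a \<le> ereal b"
  obtains r where "ereal r < a" "b < r"
  using assms ereal_dense2[of "ereal b" a] by (metis less_ereal.simps(1) not_le)

text \<open>Decoupling \<open>z\<close> from \<open>F u\<close> at the price of
  \<open>n |z - F u|\<^sup>2\<close> makes the first-order conditions explicit. As \<open>n\<close>
  grows, the minimisers approach \<open>(y, F y)\<close>. The resulting \<open>w\<close> may be
  arbitrarily large; bounds on it enter in \<open>bounded_chain_rule\<close>.\<close>

lemma fuzzy_chain_rule_proximal:
  fixes h :: "'b::euclidean_space \<Rightarrow> ereal" and F :: "'a::euclidean_space \<Rightarrow> 'b"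
  assumes lsc: "closed_fun h"
    and F: "\<And>u. (F has_derivative blinfun_apply (DF u)) (at u)"
    and v: "v \<in> proximal_subdiff (h \<circ> F) y" and e: "e > 0"
  shows "\<exists>u z w. dist u y < e \<and> dist z (F y) < e \<and> \<bar>h z - h (F y)\<bar> < ereal e \<and>
    w \<in> proximal_subdiff h z \<and> norm (adjoint (DF u) w - v) < e"
proof -
  have contF: "continuous_on UNIV F"
    by (intro continuous_at_imp_continuous_on ballI has_derivative_continuous[OF F])
  obtain X r where X: "open X" "y \<in> X" "r > 0"
    and prox: "\<And>u. u \<in> X \<Longrightarrow> h (F u) \<ge> h (F y) + ereal (v \<bullet> (u - y) - r / 2 * (norm (u - y))\<^sup>2)"
    and fin: "\<bar>h (F y)\<bar> \<noteq> \<infinity>"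
    using v by (auto simp: proximal_subdiff_def)
  obtain hy where hy: "h (F y) = ereal hy" using fin by auto
  obtain \<rho> where \<rho>: "\<rho> > 0" "cball y \<rho> \<subseteq> X" using X open_contains_cball by blast
  have "eventually (\<lambda>z. ereal (hy - e) < h z) (nhds (F y))"
    by (rule closed_fun_eventually_gt[OF lsc]) (use hy e in auto)
  then obtain d where d: "d > 0" "\<And>z. dist z (F y) < d \<Longrightarrow> ereal (hy - e) < h z"
    unfolding eventually_nhds_metric by blast
  \<comment> \<open>The halves keep the closed ball inside the open balls of radius \<open>d\<close>
    and \<open>e\<close>.\<close>
  define d2 where "d2 = min (d/2) (e/2)"
  have d2: "d2 > 0" "d2 < e" "\<And>z. z \<in> cball (F y) d2 \<Longrightarrow> ereal (hy - e) < h z"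
    using d e by (auto simp: d2_def dist_commute)
  \<comment> \<open>The coefficient \<open>r\<close> in place of \<open>r / 2\<close> turns the
    proximal inequality into strict growth around \<open>y\<close>. The zero terms reproduce the
    shape of \<open>penalty_optimality\<close>.\<close>
  define q where "q n p = 0 * (norm (snd p - 0))\<^sup>2 - 0 \<bullet> snd p + r * (norm (fst p - y))\<^sup>2 - v \<bullet> fst p
      + real n * (norm (snd p - F (fst p)))\<^sup>2" for n :: nat and p :: "'a \<times> 'b"
  let ?S = "cball y \<rho> \<times> cball (F y) d2"
  have q_cont: "continuous_on UNIV (q n)" for n
    unfolding q_def
    by (intro continuous_intros continuous_on_compose2[OF contF]) auto
  have S: "compact ?S" "(y, F y) \<in> ?S" using \<rho>(1) d2(1) by (auto intro: compact_Times)
  have "\<forall>n. \<exists>u z. (u, z) \<in> ?S \<and>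
    (\<forall>u' z'. (u', z') \<in> ?S \<longrightarrow> h z + ereal (q n (u, z)) \<le> h z' + ereal (q n (u', z')))"
  proof
    fix n
    have "?S \<noteq> {}" using S(2) by blast
    from penalized_min_exists[OF lsc q_cont S(1) this, of n]
    show "\<exists>u z. (u, z) \<in> ?S \<and>
      (\<forall>u' z'. (u', z') \<in> ?S \<longrightarrow> h z + ereal (q n (u, z)) \<le> h z' + ereal (q n (u', z')))" by metis
  qed
  then obtain u z where uz: "\<And>n. (u n, z n) \<in> ?S"
    and mn: "\<And>n u' z'. (u', z') \<in> ?S \<Longrightarrow> h (z n) + ereal (q n (u n, z n)) \<le> h z' + ereal (q n (u', z'))"
    by metis
  define s where "s n = real_of_ereal (h (z n))" for n
  have hz_lt: "ereal (hy - e) < h (z n)" for n using uz[of n] d2(3) by auto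
  have le: "h (z n) + ereal (q n (u n, z n)) \<le> ereal (hy - v \<bullet> y)" for n
    using mn[OF S(2), of n] hy by (simp add: q_def)
  have hz: "h (z n) = ereal (s n)" for n
    using hz_lt[of n] le[of n] unfolding s_def by (cases "h (z n)") auto
  have s_gt: "hy - e < s n" for n using hz_lt[of n] hz by simp
  have s_le: "s n + r * (norm (u n - y))\<^sup>2 + real n * (norm (z n - F (u n)))\<^sup>2 \<le> hy + v \<bullet> (u n - y)" for n
    using le[of n] hz[of n] by (simp add: q_def inner_diff_right algebra_simps)
  have vu: "v \<bullet> (u n - y) \<le> norm v * \<rho>" for n
  proof -
    have "v \<bullet> (u n - y) \<le> norm v * norm (u n - y)" by (rule norm_cauchy_schwarz)
    also have "\<dots> \<le> norm v * \<rho>" using uz[of n]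
      by (intro mult_left_mono) (auto simp: dist_norm norm_minus_commute)
    finally show ?thesis .
  qed
  \<comment> \<open>Since \<open>h\<close> is bounded below on the small ball, \<open>C\<close>
    bounds the whole penalty term, so the gap \<open>z n - F (u n)\<close> tends to 0.\<close>
  define C where "C = e + norm v * \<rho>"
  have pen: "(norm (z n - F (u n)))\<^sup>2 \<le> C * inverse (real n)" if "n > 0" for n
  proof -
    have "r * (norm (u n - y))\<^sup>2 \<ge> 0" using X by simp
    then have "real n * (norm (z n - F (u n)))\<^sup>2 \<le> C"
      using s_le[of n] s_gt[of n] vu[of n] unfolding C_def by linarith
    then show ?thesis using that by (simp add: field_simps)
  qed
  have "(\<lambda>n. C * inverse (real n)) \<longlonglongrightarrow> C * 0"
    by (intro tendsto_intros lim_inverse_n)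
  then have C0: "(\<lambda>n. C * inverse (real n)) \<longlonglongrightarrow> 0" by simp
  have "(\<lambda>n. (norm (z n - F (u n)))\<^sup>2) \<longlonglongrightarrow> 0"
  proof (rule Lim_null_comparison[OF _ C0])
    show "eventually (\<lambda>n. norm ((norm (z n - F (u n)))\<^sup>2) \<le> C * inverse (real n)) sequentially"
      using eventually_gt_at_top[of 0] by eventually_elim (use pen in simp)
  qed
  then have gap: "(\<lambda>n. z n - F (u n)) \<longlonglongrightarrow> 0"
    using tendsto_real_sqrt[of "\<lambda>n. (norm (z n - F (u n)))\<^sup>2" 0] by (simp add: tendsto_norm_zero_cancel)
  obtain p k where p: "p \<in> ?S" and k: "strict_mono k" "((\<lambda>n. (u n, z n)) \<circ> k) \<longlonglongrightarrow> p"
    using seq_compactE[OF S(1)[unfolded compact_eq_seq_compact_metric], of "\<lambda>n. (u n, z n)"] uz by blast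
  have uk: "(\<lambda>n. u (k n)) \<longlonglongrightarrow> fst p" using tendsto_fst[OF k(2)] by (simp add: o_def)
  have zk: "(\<lambda>n. z (k n)) \<longlonglongrightarrow> snd p" using tendsto_snd[OF k(2)] by (simp add: o_def)
  have "isCont F (fst p)" by (rule has_derivative_continuous[OF F])
  then have Fk: "(\<lambda>n. F (u (k n))) \<longlonglongrightarrow> F (fst p)" using uk by (rule isCont_tendsto_compose)
  have "(\<lambda>n. z (k n) - F (u (k n))) \<longlonglongrightarrow> 0"
    using LIMSEQ_subseq_LIMSEQ[OF gap k(1)] by (simp add: o_def)
  then have zp: "snd p = F (fst p)"
    using tendsto_diff[OF zk Fk] LIMSEQ_unique by fastforce
  \<comment> \<open>Semicontinuity carries \<open>s_le\<close> to the limit point. Compared with the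
    proximal inequality there, it leaves \<open>r / 2 * |fst p - y|\<^sup>2 \<le> 0\<close>, so the
    limit is \<open>y\<close> itself.\<close>
  have "h (snd p) \<le> ereal (hy + v \<bullet> (fst p - y) - r * (norm (fst p - y))\<^sup>2)"
  proof (rule ccontr)
    assume "\<not> ?thesis"
    then obtain b where b: "ereal b < h (snd p)" "hy + v \<bullet> (fst p - y) - r * (norm (fst p - y))\<^sup>2 < b"
      by (rule ereal_between_real)
    have 1: "eventually (\<lambda>n. ereal b < h (z (k n))) sequentially"
      using closed_fun_eventually_gt[OF lsc b(1)] zk by (rule eventually_compose_filterlim)
    have "(\<lambda>n. hy + v \<bullet> (u (k n) - y) - r * (norm (u (k n) - y))\<^sup>2) \<longlonglongrightarrow>
        hy + v \<bullet> (fst p - y) - r * (norm (fst p - y))\<^sup>2"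
      by (intro tendsto_intros uk)
    then have 2: "eventually (\<lambda>n. hy + v \<bullet> (u (k n) - y) - r * (norm (u (k n) - y))\<^sup>2 < b) sequentially"
      using b(2) by (rule order_tendstoD)
    obtain n where n: "ereal b < h (z (k n))" "hy + v \<bullet> (u (k n) - y) - r * (norm (u (k n) - y))\<^sup>2 < b"
      using eventually_conj[OF 1 2] eventually_sequentially by auto
    have "real (k n) * (norm (z (k n) - F (u (k n))))\<^sup>2 \<ge> 0" by simp
    moreover have "b < s (k n)" using n(1) hz[of "k n"] by simp
    ultimately show False using n(2) s_le[of "k n"] by linarith
  qed
  moreover have "h (F (fst p)) \<ge> h (F y) + ereal (v \<bullet> (fst p - y) - r / 2 * (norm (fst p - y))\<^sup>2)"
    using prox p \<rho>(2) by (cases p) auto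
  ultimately have "ereal (hy + (v \<bullet> (fst p - y) - r / 2 * (norm (fst p - y))\<^sup>2)) \<le>
      ereal (hy + v \<bullet> (fst p - y) - r * (norm (fst p - y))\<^sup>2)"
    unfolding zp hy plus_ereal.simps by (rule order_trans[rotated])
  then have "r * (norm (fst p - y))\<^sup>2 \<le> 0" by simp
  then have py: "fst p = y" using X(3) by (simp add: mult_le_0_iff)
  \<comment> \<open>The entries serve, in turn, interiority, the distance to \<open>y\<close>, the
    residual \<open>2 * r * |u - y|\<close> of the adjoint equation, and the upper bound on
    \<open>h (z n)\<close>. The added ones make the last two estimates strict.\<close>
  define \<eta> where "\<eta> = min \<rho> (min (e / 2) (min (e / (2 * r + 1)) (e / (norm v + 1))))"
  have \<eta>: "\<eta> > 0" "\<eta> \<le> \<rho>" "\<eta> < e" "2 * r * \<eta> < e" "norm v * \<eta> < e"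
  proof -
    have n1: "norm v + 1 > 0" using norm_ge_zero[of v] by linarith
    show pos: "\<eta> > 0" using \<rho>(1) e X(3) n1 by (simp add: \<eta>_def)
    show "\<eta> \<le> \<rho>" "\<eta> < e" using e by (auto simp: \<eta>_def)
    have "\<eta> \<le> e / (2 * r + 1)" by (simp add: \<eta>_def)
    then have "(2 * r + 1) * \<eta> \<le> e" using X(3) by (simp add: field_simps)
    then show "2 * r * \<eta> < e" using pos by (simp add: algebra_simps)
    have "\<eta> \<le> e / (norm v + 1)" by (simp add: \<eta>_def)
    then have "(norm v + 1) * \<eta> \<le> e" using n1 by (simp add: field_simps)
    then show "norm v * \<eta> < e" using pos by (simp add: algebra_simps)
  qed
  have "eventually (\<lambda>n. dist (u (k n)) y < \<eta> \<and> dist (z (k n)) (F y) < d2) sequentially"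
    using tendstoD[OF uk \<eta>(1)] tendstoD[OF zk d2(1)] unfolding zp py by (rule eventually_conj)
  then obtain m where m: "dist (u (k m)) y < \<eta>" "dist (z (k m)) (F y) < d2"
    using eventually_sequentially by auto
  define n where "n = k m"
  note m = m[folded n_def]
  define w where "w = 0 - (2 * 0) *\<^sub>R (z n - 0) - (2 * real n) *\<^sub>R (z n - F (u n))"
  have mem: "u n \<in> ball y \<rho>" "z n \<in> ball (F y) d2" using m \<eta>(2) by (auto simp: dist_commute)
  have opt: "h (z n) + ereal (0 * (norm (z n - 0))\<^sup>2 - 0 \<bullet> z n + r * (norm (u n - y))\<^sup>2 - v \<bullet> u n + real n * (norm (z n - F (u n)))\<^sup>2) \<le>
      h z' + ereal (0 * (norm (z' - 0))\<^sup>2 - 0 \<bullet> z' + r * (norm (u' - y))\<^sup>2 - v \<bullet> u' + real n * (norm (z' - F u'))\<^sup>2)"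
    if "u' \<in> ball y \<rho>" "z' \<in> ball (F y) d2" for u' z'
  proof -
    have "(u', z') \<in> ?S" using that by auto
    from mn[OF this, of n] show ?thesis unfolding q_def fst_conv snd_conv .
  qed
  have hzfin: "\<bar>h (z n)\<bar> \<noteq> \<infinity>" using hz by simp
  have "w \<in> proximal_subdiff h (z n)"
    by (rule penalty_optimality(1)[OF hzfin F open_ball mem(1) open_ball mem(2) opt _ _ w_def]) auto
  moreover have adj: "adjoint (DF (u n)) ((2 * real n) *\<^sub>R (z n - F (u n))) = (2 * r) *\<^sub>R (u n - y) - v"
    by (rule penalty_optimality(2)[OF hzfin F open_ball mem(1) open_ball mem(2) opt _ _ w_def]) auto
  have "adjoint (DF (u n)) w = - adjoint (DF (u n)) ((2 * real n) *\<^sub>R (z n - F (u n)))"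
    unfolding w_def by (simp add: linear_neg[OF linear_adjoint_blinfun, symmetric])
  then have "adjoint (DF (u n)) w - v = - ((2 * r) *\<^sub>R (u n - y))" unfolding adj by simp
  then have "norm (adjoint (DF (u n)) w - v) = 2 * r * dist (u n) y"
    using X(3) by (simp add: dist_norm)
  moreover have "\<dots> \<le> 2 * r * \<eta>" using m X(3) by simp
  moreover have "\<bar>h (z n) - h (F y)\<bar> < ereal e"
  proof -
    have "v \<bullet> (u n - y) \<le> norm v * norm (u n - y)" by (rule norm_cauchy_schwarz)
    also have "\<dots> \<le> norm v * \<eta>" using m(1) by (intro mult_left_mono) (auto simp: dist_norm)
    finally have "v \<bullet> (u n - y) < e" using \<eta>(5) by simp
    moreover have "r * (norm (u n - y))\<^sup>2 \<ge> 0" "real n * (norm (z n - F (u n)))\<^sup>2 \<ge> 0" using X by auto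
    ultimately have "s n < hy + e" using s_le[of n] by linarith
    then show ?thesis using s_gt[of n] hz[of n] hy by (simp add: abs_less_iff)
  qed
  ultimately show ?thesis using m \<eta>(3,4) d2(2)
    by (intro exI[of _ "u n"] exI[of _ "z n"] exI[of _ w] conjI; linarith?)
qed

lemma fuzzy_chain_rule_limiting:
  fixes h :: "'b::euclidean_space \<Rightarrow> ereal" and F :: "'a::euclidean_space \<Rightarrow> 'b"
  assumes lsc: "closed_fun h"
    and F: "\<And>u. (F has_derivative blinfun_apply (DF u)) (at u)"
    and v: "v \<in> limiting_subdiff (h \<circ> F) y" and e: "e > 0"
  shows "\<exists>u z w. dist u y < e \<and> dist z (F y) < e \<and> \<bar>h z - h (F y)\<bar> < ereal e \<and>
    w \<in> limiting_subdiff h z \<and> norm (adjoint (DF u) w - v) < e"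
proof -
  have fin: "\<bar>h (F y)\<bar> \<noteq> \<infinity>" using v by (simp add: limiting_subdiff_def)
  have "isCont F y" by (rule has_derivative_continuous[OF F])
  then obtain d where d: "d > 0" "\<And>u. dist u y < d \<Longrightarrow> dist (F u) (F y) < e / 2"
    using e unfolding continuous_at_eps_delta by (meson half_gt_zero)
  define e' where "e' = min d (e / 2)"
  have "e' > 0" using d e by (simp add: e'_def)
  then obtain y' v' where y': "v' \<in> proximal_subdiff (h \<circ> F) y'" "dist y' y < e'"
      "\<bar>h (F y') - h (F y)\<bar> < ereal e'" "dist v' v < e'"
    using v unfolding limiting_subdiff_iff by auto
  have fin': "\<bar>h (F y')\<bar> \<noteq> \<infinity>" using y'(1) by (simp add: proximal_subdiff_def)
  obtain u z w where *: "dist u y' < e / 2" "dist z (F y') < e / 2" "\<bar>h z - h (F y')\<bar> < ereal (e / 2)"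
      "w \<in> proximal_subdiff h z" "norm (adjoint (DF u) w - v') < e / 2"
    using fuzzy_chain_rule_proximal[OF lsc F y'(1), of "e / 2"] e by auto
  have "dist u y < e" using *(1) y'(2) dist_triangle[of u y y'] by (simp add: e'_def)
  moreover have "dist z (F y) < e"
    using *(2) d(2)[of y'] y'(2) dist_triangle[of z "F y" "F y'"] by (simp add: e'_def)
  moreover have "\<bar>h z - h (F y)\<bar> < ereal e"
    using *(3) y'(3) unfolding abs_ereal_diff_less_iff[OF fin] abs_ereal_diff_less_iff[OF fin'] e'_def
    by linarith
  moreover have "norm (adjoint (DF u) w - v) < e"
    using *(5) y'(4) dist_triangle[of "adjoint (DF u) w" v v'] by (simp add: e'_def dist_norm)
  ultimately show ?thesis using *(4) proximal_subset_limiting by blast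
qed

text \<open>The qualification condition enters as the a priori bound \<open>bdd\<close>: it makes
  the fuzzy multipliers precompact, and their limit satisfies the chain rule exactly at
  \<open>y\<close>.\<close>

lemma bounded_chain_rule:
  fixes h :: "'b::euclidean_space \<Rightarrow> ereal" and F :: "'a::euclidean_space \<Rightarrow> 'b"
  assumes lsc: "closed_fun h"
    and F: "\<And>u. (F has_derivative blinfun_apply (DF u)) (at u)"
    and cont: "isCont DF y"
    and v: "v \<in> limiting_subdiff (h \<circ> F) y"
    and d: "d > 0"
    and bdd: "\<And>u z w. dist u y < d \<Longrightarrow> dist z (F y) < d \<Longrightarrow> \<bar>h z - h (F y)\<bar> < ereal d \<Longrightarrow>
      w \<in> limiting_subdiff h z \<Longrightarrow> norm (adjoint (DF u) w - v) < d \<Longrightarrow> norm w \<le> M"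
  shows "\<exists>w \<in> limiting_subdiff h (F y). adjoint (DF y) w = v"
proof -
  have fin: "\<bar>h (F y)\<bar> \<noteq> \<infinity>" using v by (simp add: limiting_subdiff_def)
  \<comment> \<open>The cap \<open>d\<close> makes \<open>bdd\<close> applicable to every index, not
    just eventually.\<close>
  define \<epsilon> where "\<epsilon> n = min d (inverse (real (Suc n)))" for n
  have \<epsilon>: "\<epsilon> n > 0" "\<epsilon> n \<le> d" for n using d by (auto simp: \<epsilon>_def)
  have "(\<lambda>n. min d (inverse (real (Suc n)))) \<longlonglongrightarrow> min d 0"
    by (intro tendsto_min tendsto_const LIMSEQ_inverse_real_of_nat)
  then have \<epsilon>0: "\<epsilon> \<longlonglongrightarrow> 0" using d by (simp add: \<epsilon>_def[abs_def])
  obtain u z w where *: "\<And>n. dist (u n) y < \<epsilon> n" "\<And>n. dist (z n) (F y) < \<epsilon> n"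
      "\<And>n. \<bar>h (z n) - h (F y)\<bar> < ereal (\<epsilon> n)"
      "\<And>n. w n \<in> limiting_subdiff h (z n)" "\<And>n. norm (adjoint (DF (u n)) (w n) - v) < \<epsilon> n"
    using fuzzy_chain_rule_limiting[OF lsc F v \<epsilon>(1)] by metis
  have "norm (w n) \<le> M" for n
  proof (rule bdd[of "u n" "z n"])
    show "\<bar>h (z n) - h (F y)\<bar> < ereal d" using *(3)[of n] \<epsilon>(2)[of n]
      by (metis ereal_less_eq(3) order_less_le_trans)
  qed (use * \<epsilon>(2) order_less_le_trans in blast)+
  then have "bounded (range w)" by (auto simp: bounded_iff)
  then obtain w0 k where k: "strict_mono k" "(w \<circ> k) \<longlonglongrightarrow> w0"
    using bounded_imp_convergent_subsequence by blast
  have \<epsilon>k: "(\<lambda>n. \<epsilon> (k n)) \<longlonglongrightarrow> 0" using LIMSEQ_subseq_LIMSEQ[OF \<epsilon>0 k(1)] by (simp add: o_def)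
  have "w0 \<in> limiting_subdiff h (F y)"
  proof (rule limiting_subdiff_closed[where f = h, OF fin])
    fix e :: real assume "e > 0"
    have "eventually (\<lambda>n. \<epsilon> (k n) < e \<and> dist (w (k n)) w0 < e) sequentially"
      using order_tendstoD(2)[OF \<epsilon>k \<open>e > 0\<close>] tendstoD[OF k(2) \<open>e > 0\<close>] unfolding o_def
      by (rule eventually_conj)
    then obtain n where n: "\<epsilon> (k n) < e" "dist (w (k n)) w0 < e" using eventually_sequentially by auto
    have "\<bar>h (z (k n)) - h (F y)\<bar> < ereal e" using *(3)[of "k n"] n(1)
      by (metis less_ereal.simps(1) less_trans)
    then show "\<exists>y' w. w \<in> limiting_subdiff h y' \<and> dist y' (F y) < e \<and> \<bar>h y' - h (F y)\<bar> < ereal e \<and> dist w w0 < e"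
      using *(4) *(2)[of "k n"] n by (intro exI[of _ "z (k n)"] exI[of _ "w (k n)"]) auto
  qed
  moreover have "adjoint (DF y) w0 = v"
  proof -
    have "(\<lambda>n. u (k n)) \<longlonglongrightarrow> y"
      by (rule metric_tendsto_imp_tendsto[OF \<epsilon>k]) (use less_imp_le[OF *(1)] \<epsilon>(1) in \<open>simp add: abs_of_pos\<close>)
    then have "(\<lambda>n. DF (u (k n))) \<longlonglongrightarrow> DF y" by (rule isCont_tendsto_compose[OF cont])
    then have "(\<lambda>n. adjoint (DF (u (k n))) (w (k n))) \<longlonglongrightarrow> adjoint (DF y) w0"
      using k(2) unfolding o_def by (rule tendsto_adjoint)
    moreover have "(\<lambda>n. adjoint (DF (u (k n))) (w (k n))) \<longlonglongrightarrow> v"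
      by (rule metric_tendsto_imp_tendsto[OF \<epsilon>k])
        (use less_imp_le[OF *(5)] \<epsilon>(1) in \<open>simp add: abs_of_pos dist_norm\<close>)
    ultimately show ?thesis using LIMSEQ_unique by blast
  qed
  ultimately show ?thesis by blast
qed

subsection \<open>Uniform control of subgradients\<close>

text \<open>The tolerance \<epsilon> is extended real so that \<infinity> can express a condition on
  all finite values, as in the convex case. The operator varies near \<open>Ab\<close> because the
  derivative is evaluated at points other than the reference point.\<close>

definition subgradient_control ::
  "('b::euclidean_space \<Rightarrow> ereal) \<Rightarrow> 'b \<Rightarrow> ('a::euclidean_space \<Rightarrow>\<^sub>L 'b) \<Rightarrow> real \<Rightarrow> ereal \<Rightarrow> real \<Rightarrow> real \<Rightarrow> bool" where
  "subgradient_control h zb Ab \<delta> \<epsilon> M r \<longleftrightarrow>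
    (\<forall>z w A. dist z zb < \<delta> \<longrightarrow> \<bar>h z - h zb\<bar> < \<epsilon> \<longrightarrow> w \<in> limiting_subdiff h z \<longrightarrow>
       norm (A - Ab) < \<delta> \<longrightarrow> norm (adjoint (blinfun_apply A) w) < \<delta> \<longrightarrow>
       norm w \<le> M \<and>
       (\<forall>z'. dist z' zb < \<delta> \<longrightarrow> h z' \<ge> h z + ereal (w \<bullet> (z' - z) - r / 2 * (norm (z' - z))\<^sup>2)))"

lemma subgradient_control_mono:
  assumes "subgradient_control h zb Ab \<delta> \<epsilon> M r" "\<delta>' \<le> \<delta>" "\<epsilon>' \<le> \<epsilon>"
  shows "subgradient_control h zb Ab \<delta>' \<epsilon>' M r"
  using assms unfolding subgradient_control_def by (meson order_less_le_trans)

lemma eventually_inverse_Suc_less: "e > 0 \<Longrightarrow> eventually (\<lambda>n. inverse (real (Suc n)) < e) sequentially"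
  using LIMSEQ_inverse_real_of_nat by (rule order_tendstoD)

lemma tendsto_dist_less_inverse_Suc:
  fixes x :: "nat \<Rightarrow> 'a::metric_space"
  assumes "\<And>n. dist (x n) l < inverse (real (Suc n))"
  shows "x \<longlonglongrightarrow> l"
  by (rule metric_tendsto_imp_tendsto[OF LIMSEQ_inverse_real_of_nat]) (use less_imp_le[OF assms] in simp)

text \<open>Normalising an unbounded sequence of multipliers gives a limit on the unit sphere, and
  dividing a vanishing image by a growing norm puts this limit in the null space. Both boundedness
  proofs start from this direction.\<close>

lemma unbounded_normal_direction:
  fixes A :: "nat \<Rightarrow> 'a::euclidean_space \<Rightarrow>\<^sub>L 'b::euclidean_space"
  assumes w: "\<And>n. real (Suc n) < norm (w n)"
    and A: "A \<longlonglongrightarrow> Ab" and Aw: "(\<lambda>n. adjoint (A n) (w n)) \<longlonglongrightarrow> 0"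
  obtains k e where "strict_mono k" "norm e = 1" "adjoint (blinfun_apply Ab) e = 0"
    "(\<lambda>n. inverse (norm (w (k n))) *\<^sub>R w (k n)) \<longlonglongrightarrow> e"
    "(\<lambda>n. inverse (norm (w (k n)))) \<longlonglongrightarrow> 0"
proof -
  have w0: "norm (w n) > 0" for n using w[of n] by (smt (verit) of_nat_0_le_iff)
  have inv: "(\<lambda>n. inverse (norm (w n))) \<longlonglongrightarrow> 0"
  proof (rule tendsto_dist_less_inverse_Suc)
    fix n show "dist (inverse (norm (w n))) 0 < inverse (real (Suc n))"
      using less_imp_inverse_less[OF w[of n]] by simp
  qed
  have "\<forall>n. inverse (norm (w n)) *\<^sub>R w n \<in> sphere 0 1" using w0 by simp
  then obtain e k where k: "e \<in> sphere 0 1" "strict_mono k" "((\<lambda>n. inverse (norm (w n)) *\<^sub>R w n) \<circ> k) \<longlonglongrightarrow> e"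
    using seq_compactE[OF compact_sphere[of "0::'b" 1, unfolded compact_eq_seq_compact_metric],
        of "\<lambda>n. inverse (norm (w n)) *\<^sub>R w n"] by blast
  note invk = LIMSEQ_subseq_LIMSEQ[OF inv k(2), unfolded o_def]
  note Ak = LIMSEQ_subseq_LIMSEQ[OF A k(2), unfolded o_def]
  note Awk = LIMSEQ_subseq_LIMSEQ[OF Aw k(2), unfolded o_def]
  have "(\<lambda>n. inverse (norm (w (k n))) *\<^sub>R adjoint (A (k n)) (w (k n))) \<longlonglongrightarrow> 0 *\<^sub>R 0"
    by (intro tendsto_scaleR invk Awk)
  moreover have "(\<lambda>n. adjoint (A (k n)) (inverse (norm (w (k n))) *\<^sub>R w (k n))) \<longlonglongrightarrow> adjoint Ab e"
    using Ak k(3)[unfolded o_def] by (rule tendsto_adjoint)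
  ultimately have "adjoint Ab e = 0"
    using LIMSEQ_unique by (simp add: linear_scale[OF linear_adjoint_blinfun]) blast
  then show thesis using that[of k e] k invk by (simp add: o_def)
qed

text \<open>Unbounded multipliers, scaled to unit length, would converge to a horizon subgradient in
  the null space of the adjoint; transversality makes it 0, although its norm is 1.\<close>

lemma transverse_bounded_subgradients:
  fixes h :: "'b::euclidean_space \<Rightarrow> ereal" and Ab :: "'a::euclidean_space \<Rightarrow>\<^sub>L 'b"
  assumes fin: "\<bar>h zb\<bar> \<noteq> \<infinity>"
    and tr: "\<And>w. w \<in> horizon_subdiff h zb \<Longrightarrow> adjoint (blinfun_apply Ab) w = 0 \<Longrightarrow> w = 0"
  shows "\<exists>d>0. \<exists>M. \<forall>z w A. dist z zb < d \<longrightarrow> \<bar>h z - h zb\<bar> < ereal d \<longrightarrow> w \<in> limiting_subdiff h z \<longrightarrow>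
       norm (A - Ab) < d \<longrightarrow> norm (adjoint (blinfun_apply A) w) < d \<longrightarrow> norm w \<le> M"
proof (rule ccontr)
  assume neg: "\<not> ?thesis"
  \<comment> \<open>A single index \<open>n\<close> sets both the radius \<open>1 / (n + 1)\<close>
    and the bound \<open>n + 1\<close> of the negated statement.\<close>
  have "\<exists>z w A. dist z zb < inverse (real (Suc n)) \<and> \<bar>h z - h zb\<bar> < ereal (inverse (real (Suc n))) \<and>
      w \<in> limiting_subdiff h z \<and> norm (A - Ab) < inverse (real (Suc n)) \<and>
      norm (adjoint (blinfun_apply A) w) < inverse (real (Suc n)) \<and> real (Suc n) < norm w" for n :: nat
  proof -
    have "inverse (real (Suc n)) > 0" by simp
    with neg show ?thesis by (metis not_le)
  qed
  then obtain z w A where *: "\<And>n. dist (z n) zb < inverse (real (Suc n))"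
      "\<And>n. \<bar>h (z n) - h zb\<bar> < ereal (inverse (real (Suc n)))"
      "\<And>n. w n \<in> limiting_subdiff h (z n)" "\<And>n. norm (A n - Ab) < inverse (real (Suc n))"
      "\<And>n. norm (adjoint (blinfun_apply (A n)) (w n)) < inverse (real (Suc n))" "\<And>n. real (Suc n) < norm (w n)"
    by metis
  have z: "z \<longlonglongrightarrow> zb" using *(1) by (rule tendsto_dist_less_inverse_Suc)
  have hz: "(\<lambda>n. h (z n)) \<longlonglongrightarrow> h zb"
    unfolding tendsto_ereal_iff_abs_diff[OF fin]
  proof (intro allI impI)
    fix e :: real assume "e > 0"
    show "eventually (\<lambda>n. \<bar>h (z n) - h zb\<bar> < ereal e) sequentially"
      by (rule eventually_mono[OF eventually_inverse_Suc_less[OF \<open>e > 0\<close>]]) (use *(2) less_ereal.simps(1) less_trans in blast)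
  qed
  have A: "A \<longlonglongrightarrow> Ab" using *(4) by (intro tendsto_dist_less_inverse_Suc) (simp add: dist_norm)
  have Aw: "(\<lambda>n. adjoint (A n) (w n)) \<longlonglongrightarrow> 0"
    using *(5) by (intro tendsto_dist_less_inverse_Suc) (simp add: dist_norm)
  obtain k e where k: "strict_mono k" "norm e = 1" "adjoint (blinfun_apply Ab) e = 0"
    "(\<lambda>n. inverse (norm (w (k n))) *\<^sub>R w (k n)) \<longlonglongrightarrow> e"
    "(\<lambda>n. inverse (norm (w (k n)))) \<longlonglongrightarrow> 0"
    using unbounded_normal_direction[OF *(6) A Aw] by blast
  have pos: "inverse (norm (w (k n))) > 0" for n
    using *(6)[of "k n"] by (smt (verit) of_nat_0_le_iff positive_imp_inverse_positive)
  have "filterlim (\<lambda>n. inverse (norm (w (k n)))) (at_right 0) sequentially"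
    using k(5) pos by (intro tendsto_imp_filterlim_at_right) auto
  then have "e \<in> horizon_subdiff h zb"
    unfolding horizon_subdiff_def
    using fin *(3) LIMSEQ_subseq_LIMSEQ[OF z k(1)] LIMSEQ_subseq_LIMSEQ[OF hz k(1)] k(4)
    by (intro CollectI conjI exI[of _ "\<lambda>n. z (k n)"] exI[of _ "\<lambda>n. w (k n)"]
        exI[of _ "\<lambda>n. inverse (norm (w (k n)))"]) (auto simp: o_def)
  then have "e = 0" using tr k(3) by blast
  then show False using k(2) by simp
qed

text \<open>Prox-regularity gives constants that depend on the multiplier; compactness makes them
  uniform. A sequence violating the inequality with constant \<open>n + 1\<close> has bounded
  multipliers, which cluster at some \<open>w0\<close> in the subdifferential at \<open>zb\<close>
  with vanishing adjoint image. Prox-regularity for \<open>w0\<close> then contradicts the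
  violations far along the sequence.\<close>

lemma prox_regular_subgradient_control:
  fixes h :: "'b::euclidean_space \<Rightarrow> ereal" and Ab :: "'a::euclidean_space \<Rightarrow>\<^sub>L 'b"
  assumes fin: "\<bar>h zb\<bar> \<noteq> \<infinity>"
    and tr: "\<And>w. w \<in> horizon_subdiff h zb \<Longrightarrow> adjoint (blinfun_apply Ab) w = 0 \<Longrightarrow> w = 0"
    and pr: "\<And>w. w \<in> limiting_subdiff h zb \<Longrightarrow> adjoint (blinfun_apply Ab) w = 0 \<Longrightarrow> prox_regular h zb w"
  shows "\<exists>\<delta>>0. \<exists>\<epsilon>>0. \<exists>M. \<exists>r>0. subgradient_control h zb Ab \<delta> (ereal \<epsilon>) M r"
proof -
  obtain d M where d: "d > 0" and M: "\<And>z w A. dist z zb < d \<Longrightarrow> \<bar>h z - h zb\<bar> < ereal d \<Longrightarrow>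
      w \<in> limiting_subdiff h z \<Longrightarrow> norm (A - Ab) < d \<Longrightarrow> norm (adjoint (blinfun_apply A) w) < d \<Longrightarrow> norm w \<le> M"
    using transverse_bounded_subgradients[where h = h and zb = zb, OF fin tr] by metis
  define \<delta> where "\<delta> n = min d (inverse (real (Suc n)))" for n :: nat
  have \<delta>: "\<delta> n > 0" "\<delta> n \<le> d" "\<delta> n \<le> inverse (real (Suc n))" for n using d by (auto simp: \<delta>_def)
  have "\<exists>n. subgradient_control h zb Ab (\<delta> n) (ereal (\<delta> n)) M (real (Suc n))"
  proof (rule ccontr)
    assume neg: "\<not> ?thesis"
    have "\<exists>z w A z'. dist z zb < \<delta> n \<and> \<bar>h z - h zb\<bar> < ereal (\<delta> n) \<and> w \<in> limiting_subdiff h z \<and>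
       norm (A - Ab) < \<delta> n \<and> norm (adjoint (blinfun_apply A) w) < \<delta> n \<and> dist z' zb < \<delta> n \<and>
       \<not> h z' \<ge> h z + ereal (w \<bullet> (z' - z) - real (Suc n) / 2 * (norm (z' - z))\<^sup>2)" for n
    proof -
      obtain z w A where zwA: "dist z zb < \<delta> n" "\<bar>h z - h zb\<bar> < ereal (\<delta> n)" "w \<in> limiting_subdiff h z"
         "norm (A - Ab) < \<delta> n" "norm (adjoint (blinfun_apply A) w) < \<delta> n"
         "\<not> (norm w \<le> M \<and> (\<forall>z'. dist z' zb < \<delta> n \<longrightarrow>
            h z' \<ge> h z + ereal (w \<bullet> (z' - z) - real (Suc n) / 2 * (norm (z' - z))\<^sup>2)))"
        using neg unfolding subgradient_control_def by blast
      have "norm w \<le> M"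
      proof (rule M[OF _ _ zwA(3)])
        show "\<bar>h z - h zb\<bar> < ereal d" using zwA(2) \<delta>(2)[of n] by (metis ereal_less_eq(3) order_less_le_trans)
      qed (use zwA \<delta>(2) order_less_le_trans in blast)+
      then show ?thesis using zwA by blast
    qed
    then obtain z w A z' where *: "\<And>n. dist (z n) zb < \<delta> n"
      "\<And>n. \<bar>h (z n) - h zb\<bar> < ereal (\<delta> n)"
      "\<And>n. w n \<in> limiting_subdiff h (z n)" "\<And>n. norm (A n - Ab) < \<delta> n"
      "\<And>n. norm (adjoint (blinfun_apply (A n)) (w n)) < \<delta> n" "\<And>n. dist (z' n) zb < \<delta> n"
      "\<And>n. \<not> h (z' n) \<ge> h (z n) + ereal (w n \<bullet> (z' n - z n) - real (Suc n) / 2 * (norm (z' n - z n))\<^sup>2)"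
      by metis
    have \<delta>le: "x < \<delta> n \<Longrightarrow> x < inverse (real (Suc n))" for x n using \<delta>(3)[of n] by linarith
    have "norm (w n) \<le> M" for n
    proof (rule M[OF _ _ *(3)])
      show "\<bar>h (z n) - h zb\<bar> < ereal d" using *(2)[of n] \<delta>(2)[of n] by (metis ereal_less_eq(3) order_less_le_trans)
    qed (use * \<delta>(2) order_less_le_trans in blast)+
    then have "bounded (range w)" by (auto simp: bounded_iff)
    then obtain w0 k where k: "strict_mono k" "(w \<circ> k) \<longlonglongrightarrow> w0"
      using bounded_imp_convergent_subsequence by blast
    have lim: "z \<longlonglongrightarrow> zb" "z' \<longlonglongrightarrow> zb" "A \<longlonglongrightarrow> Ab" "(\<lambda>n. adjoint (A n) (w n)) \<longlonglongrightarrow> 0"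
      using *(1,4,5,6)[THEN \<delta>le] by (auto intro!: tendsto_dist_less_inverse_Suc simp: dist_norm)
    note lk = lim[THEN LIMSEQ_subseq_LIMSEQ[OF _ k(1)], unfolded o_def]
    note wk = k(2)[unfolded o_def]
    have "eventually (\<lambda>n. \<bar>h (z n) - h zb\<bar> < ereal e) sequentially" if "e > 0" for e
      using eventually_inverse_Suc_less[OF that]
    proof eventually_elim
      case (elim n)
      then have "ereal (\<delta> n) < ereal e" using \<delta>(3)[of n] by simp
      then show ?case using *(2)[of n] less_trans by blast
    qed
    then have hk: "eventually (\<lambda>n. \<bar>h (z (k n)) - h zb\<bar> < ereal e) sequentially" if "e > 0" for e
      using that eventually_compose_filterlim[OF _ filterlim_subseq[OF k(1)]] by blast
    have "w0 \<in> limiting_subdiff h zb"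
    proof (rule limiting_subdiff_closed[where f = h, OF fin])
      fix e :: real assume e: "e > 0"
      have "eventually (\<lambda>n. (dist (z (k n)) zb < e \<and> \<bar>h (z (k n)) - h zb\<bar> < ereal e) \<and> dist (w (k n)) w0 < e) sequentially"
        using tendstoD[OF lk(1) e] hk[OF e] tendstoD[OF wk e] by (intro eventually_conj)
      then obtain n where "(dist (z (k n)) zb < e \<and> \<bar>h (z (k n)) - h zb\<bar> < ereal e) \<and> dist (w (k n)) w0 < e"
        using eventually_sequentially by auto
      then show "\<exists>y w. w \<in> limiting_subdiff h y \<and> dist y zb < e \<and> \<bar>h y - h zb\<bar> < ereal e \<and> dist w w0 < e"
        using *(3) by blast
    qed
    moreover have "adjoint Ab w0 = 0"
      using tendsto_adjoint[OF lk(3) wk] lk(4) LIMSEQ_unique by blast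
    ultimately have "prox_regular h zb w0" by (rule pr)
    then obtain X V e r where X: "open X" "zb \<in> X" "open V" "w0 \<in> V" "e > 0"
      and P: "\<And>x y v. x \<in> X \<Longrightarrow> y \<in> X \<Longrightarrow> v \<in> V \<inter> limiting_subdiff h x \<Longrightarrow> \<bar>h x - h zb\<bar> < ereal e \<Longrightarrow>
        h y \<ge> h x + ereal (v \<bullet> (y - x) - r / 2 * (norm (y - x))\<^sup>2)"
      unfolding prox_regular_def by blast
    \<comment> \<open>From here on the violated constant \<open>Suc (k n)\<close> exceeds the fixed
      \<open>r\<close> belonging to \<open>w0\<close>.\<close>
    have "eventually (\<lambda>n. r \<le> real (k n)) sequentially"
      using filterlim_compose[OF filterlim_real_sequentially filterlim_subseq[OF k(1)]]
      unfolding filterlim_at_top by blast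
    then have "eventually (\<lambda>n. z (k n) \<in> X \<and> z' (k n) \<in> X \<and> w (k n) \<in> V \<and> \<bar>h (z (k n)) - h zb\<bar> < ereal e \<and> r \<le> real (k n)) sequentially"
      using topological_tendstoD[OF lk(1) X(1,2)] topological_tendstoD[OF lk(2) X(1,2)]
        topological_tendstoD[OF wk X(3,4)] hk[OF X(5)] by (intro eventually_conj)
    then obtain n where n: "z (k n) \<in> X" "z' (k n) \<in> X" "w (k n) \<in> V" "\<bar>h (z (k n)) - h zb\<bar> < ereal e" "r \<le> real (k n)"
      using eventually_sequentially by auto
    have "h (z' (k n)) \<ge> h (z (k n)) + ereal (w (k n) \<bullet> (z' (k n) - z (k n)) - r / 2 * (norm (z' (k n) - z (k n)))\<^sup>2)"
      using P[OF n(1,2) _ n(4)] n(3) *(3) by blast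
    moreover have "r / 2 * (norm (z' (k n) - z (k n)))\<^sup>2 \<le> real (Suc (k n)) / 2 * (norm (z' (k n) - z (k n)))\<^sup>2"
      using n(5) by (intro mult_right_mono) auto
    then have "h (z (k n)) + ereal (w (k n) \<bullet> (z' (k n) - z (k n)) - real (Suc (k n)) / 2 * (norm (z' (k n) - z (k n)))\<^sup>2) \<le>
       h (z (k n)) + ereal (w (k n) \<bullet> (z' (k n) - z (k n)) - r / 2 * (norm (z' (k n) - z (k n)))\<^sup>2)"
      by (intro add_left_mono) (simp del: of_nat_Suc)
    ultimately show False using *(7)[of "k n"] order_trans by blast
  qed
  then show ?thesis using \<delta>(1) by (metis of_nat_0_less_iff zero_less_Suc)
qed

section \<open>Convex outer functions: global subgradient inequality and uniform bounds\<close>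

lemma convex_subgradient_inequality:
  fixes h :: "'b::euclidean_space \<Rightarrow> ereal"
  assumes conv: "convex_fun h" and w: "w \<in> limiting_subdiff h z"
  shows "h z' \<ge> h z + ereal (w \<bullet> (z' - z))"
proof -
  have prox: "h y + ereal (v \<bullet> (z' - y)) \<le> h z'" if v: "v \<in> proximal_subdiff h y" for v y
  \<comment> \<open>Testing with real upper bounds \<open>s\<close> of \<open>h z'\<close> makes an
    infinite value vacuous and gives a point of the epigraph. Convexity along the segment from
    \<open>y\<close>, divided by its parameter \<open>t\<close>, leaves an error of order
    \<open>t\<close>, which vanishes in the limit.\<close>
  proof (rule ereal_le_real)
      fix s assume s: "h z' \<le> ereal s"
      obtain hy where hy: "h y = ereal hy" using v by (auto simp: proximal_subdiff_def)
      obtain X r where X: "open X" "y \<in> X"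
        and P: "\<And>x. x \<in> X \<Longrightarrow> h x \<ge> h y + ereal (v \<bullet> (x - y) - r / 2 * (norm (x - y))\<^sup>2)"
        using v by (auto simp: proximal_subdiff_def)
      have lim: "((\<lambda>t. y + t *\<^sub>R (z' - y)) \<longlongrightarrow> y + 0 *\<^sub>R (z' - y)) (at_right 0)"
        by (intro tendsto_intros)
      have "eventually (\<lambda>t. y + t *\<^sub>R (z' - y) \<in> X) (at_right (0::real))"
        using topological_tendstoD[OF lim X(1)] X(2) by simp
      moreover have "eventually (\<lambda>t. t \<in> {0<..<1}) (at_right (0::real))"
        by (rule eventually_at_right_real) simp
      ultimately have "eventually (\<lambda>t. hy + v \<bullet> (z' - y) - r / 2 * t * (norm (z' - y))\<^sup>2 \<le> s) (at_right 0)"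
      proof eventually_elim
        case (elim t)
        have "(1 - t) *\<^sub>R (y, hy) + t *\<^sub>R (z', s) \<in> {(x, r::real). h x \<le> ereal r}"
          using conv s hy elim(2) unfolding convex_fun_def
          by (intro convexD_alt) auto
        moreover have "(1 - t) *\<^sub>R (y, hy) + t *\<^sub>R (z', s) = (y + t *\<^sub>R (z' - y), hy + t * (s - hy))"
          by (simp add: algebra_simps)
        ultimately have "h (y + t *\<^sub>R (z' - y)) \<le> ereal (hy + t * (s - hy))" by simp
        with P[OF elim(1)] have "t * (v \<bullet> (z' - y)) - r / 2 * (t\<^sup>2 * (norm (z' - y))\<^sup>2) \<le> t * (s - hy)"
          unfolding hy by (auto simp: power_mult_distrib dest: order_trans)
        then have "t * (hy + v \<bullet> (z' - y) - r / 2 * t * (norm (z' - y))\<^sup>2) \<le> t * s"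
          by (simp add: algebra_simps power2_eq_square)
        then show ?case using elim(2) by (simp add: mult_le_cancel_left)
      qed
      moreover have "((\<lambda>t. hy + v \<bullet> (z' - y) - r / 2 * t * (norm (z' - y))\<^sup>2) \<longlongrightarrow>
          hy + v \<bullet> (z' - y) - r / 2 * 0 * (norm (z' - y))\<^sup>2) (at_right 0)"
        by (intro tendsto_intros)
      ultimately have "hy + v \<bullet> (z' - y) \<le> s"
        using tendsto_upperbound[of _ "hy + v \<bullet> (z' - y)" "at_right (0::real)"] by simp
      then show "h y + ereal (v \<bullet> (z' - y)) \<le> ereal s" using hy by simp
  qed
  obtain x v where xv: "\<And>i. v i \<in> proximal_subdiff h (x i)" "x \<longlonglongrightarrow> z" "(\<lambda>i. h (x i)) \<longlonglongrightarrow> h z" "v \<longlonglongrightarrow> w"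
    and fin: "\<bar>h z\<bar> \<noteq> \<infinity>"
    using w by (auto simp: limiting_subdiff_def)
  have "(\<lambda>i. h (x i) + ereal (v i \<bullet> (z' - x i))) \<longlonglongrightarrow> h z + ereal (w \<bullet> (z' - z))"
    using fin by (intro tendsto_add_ereal tendsto_intros xv) auto
  then show ?thesis by (rule Lim_bounded) (use prox[OF xv(1)] in blast)
qed

text \<open>The inequality is global for convex \<open>h\<close>, so only the bound on
  \<open>w\<close> is at stake. Values along the blow-up sequence need not approach
  \<open>h zb\<close>, so its limit direction \<open>e\<close> is not directly a horizon
  subgradient. It is, however, normal to the domain of \<open>h\<close> at \<open>zb\<close>, and
  adding multiples of \<open>e\<close> to \<open>wb\<close> produces subgradients at
  \<open>zb\<close> itself, which exhibit \<open>e\<close> as a horizon subgradient.\<close>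

lemma convex_subgradient_control:
  fixes h :: "'b::euclidean_space \<Rightarrow> ereal" and Ab :: "'a::euclidean_space \<Rightarrow>\<^sub>L 'b"
  assumes lsc: "closed_fun h" and conv: "convex_fun h"
    and wb: "wb \<in> limiting_subdiff h zb"
    and tr: "\<And>w. w \<in> horizon_subdiff h zb \<Longrightarrow> adjoint (blinfun_apply Ab) w = 0 \<Longrightarrow> w = 0"
  shows "\<exists>\<delta>>0. \<exists>M. subgradient_control h zb Ab \<delta> \<infinity> M 0"
proof (rule ccontr)
  assume neg: "\<not> ?thesis"
  have fin: "\<bar>h zb\<bar> \<noteq> \<infinity>" using wb by (simp add: limiting_subdiff_def)
  then obtain hb where hb: "h zb = ereal hb" by auto
  have "\<exists>z w A. dist z zb < inverse (real (Suc n)) \<and> w \<in> limiting_subdiff h z \<and>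
      norm (A - Ab) < inverse (real (Suc n)) \<and>
      norm (adjoint (blinfun_apply A) w) < inverse (real (Suc n)) \<and> real (Suc n) < norm w" for n :: nat
  proof -
    have "\<not> subgradient_control h zb Ab (inverse (real (Suc n))) \<infinity> (real (Suc n)) 0" using neg by simp
    then show ?thesis
      using convex_subgradient_inequality[OF conv] unfolding subgradient_control_def by (simp add: not_le) blast
  qed
  then obtain z w A where *: "\<And>n. dist (z n) zb < inverse (real (Suc n))"
      "\<And>n. w n \<in> limiting_subdiff h (z n)" "\<And>n. norm (A n - Ab) < inverse (real (Suc n))"
      "\<And>n. norm (adjoint (blinfun_apply (A n)) (w n)) < inverse (real (Suc n))" "\<And>n. real (Suc n) < norm (w n)"
    by metis
  have z: "z \<longlonglongrightarrow> zb" using *(1) by (rule tendsto_dist_less_inverse_Suc)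
  have A: "A \<longlonglongrightarrow> Ab" using *(3) by (intro tendsto_dist_less_inverse_Suc) (simp add: dist_norm)
  have Aw: "(\<lambda>n. adjoint (A n) (w n)) \<longlonglongrightarrow> 0"
    using *(4) by (intro tendsto_dist_less_inverse_Suc) (simp add: dist_norm)
  obtain k e where k: "strict_mono k" "norm e = 1" "adjoint (blinfun_apply Ab) e = 0"
    "(\<lambda>n. inverse (norm (w (k n))) *\<^sub>R w (k n)) \<longlonglongrightarrow> e"
    "(\<lambda>n. inverse (norm (w (k n)))) \<longlonglongrightarrow> 0"
    using unbounded_normal_direction[OF *(5) A Aw] by blast
  note zk = LIMSEQ_subseq_LIMSEQ[OF z k(1), unfolded o_def]
  have pos: "inverse (norm (w (k n))) > 0" for n
    using *(5)[of "k n"] by (smt (verit) of_nat_0_le_iff positive_imp_inverse_positive)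
  \<comment> \<open>Divide the subgradient inequality by the norm of the multiplier: semicontinuity
    bounds the values from below by \<open>hb - 1\<close>, so the right-hand side tends to
    0.\<close>
  have normal: "e \<bullet> (z' - zb) \<le> 0" if z': "h z' \<le> ereal s" for z' s
  proof -
    have "eventually (\<lambda>x. ereal (hb - 1) < h x) (nhds zb)"
      by (rule closed_fun_eventually_gt[OF lsc]) (use hb in simp)
    then have "eventually (\<lambda>n. ereal (hb - 1) < h (z (k n))) sequentially"
      using zk by (rule eventually_compose_filterlim)
    then have "eventually (\<lambda>n. (inverse (norm (w (k n))) *\<^sub>R w (k n)) \<bullet> (z' - z (k n)) \<le> inverse (norm (w (k n))) * (s - (hb - 1))) sequentially"
    proof eventually_elim
      case (elim n)
      have "h (z (k n)) + ereal (w (k n) \<bullet> (z' - z (k n))) \<le> ereal s"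
        using convex_subgradient_inequality[OF conv *(2)] z' order_trans by blast
      then have "w (k n) \<bullet> (z' - z (k n)) \<le> s - (hb - 1)"
        using elim by (cases "h (z (k n))") auto
      then show ?case using pos[of n] by simp
    qed
    moreover have "(\<lambda>n. (inverse (norm (w (k n))) *\<^sub>R w (k n)) \<bullet> (z' - z (k n))) \<longlonglongrightarrow> e \<bullet> (z' - zb)"
      by (intro tendsto_intros k(4) zk)
    moreover have "(\<lambda>n. inverse (norm (w (k n))) * (s - (hb - 1))) \<longlonglongrightarrow> 0 * (s - (hb - 1))"
      by (intro tendsto_intros k(5))
    ultimately show ?thesis using tendsto_le[OF sequentially_bot] by fastforce
  qed
  have sub: "wb + real (Suc n) *\<^sub>R e \<in> limiting_subdiff h zb" for n
  proof -
    have "wb + real (Suc n) *\<^sub>R e \<in> proximal_subdiff h zb"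
      unfolding proximal_subdiff_def
    proof (intro CollectI conjI fin exI[of _ UNIV] exI[of _ 1] ballI)
      fix x
      show "h zb + ereal ((wb + real (Suc n) *\<^sub>R e) \<bullet> (x - zb) - 1 / 2 * (norm (x - zb))\<^sup>2) \<le> h x"
      proof (rule ereal_le_real)
        fix s assume s: "h x \<le> ereal s"
        have "h zb + ereal (wb \<bullet> (x - zb)) \<le> ereal s"
          using convex_subgradient_inequality[OF conv wb] s order_trans by blast
        moreover have "real (Suc n) * (e \<bullet> (x - zb)) \<le> 0" using normal[OF s]
          by (simp add: mult_nonneg_nonpos del: of_nat_Suc)
        moreover have "(norm (x - zb))\<^sup>2 \<ge> 0" by simp
        ultimately have "hb + ((wb \<bullet> (x - zb) + real (Suc n) * (e \<bullet> (x - zb))) - 1 / 2 * (norm (x - zb))\<^sup>2) \<le> s"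
          unfolding hb plus_ereal.simps ereal_less_eq by linarith
        then show "h zb + ereal ((wb + real (Suc n) *\<^sub>R e) \<bullet> (x - zb) - 1 / 2 * (norm (x - zb))\<^sup>2) \<le> ereal s"
          unfolding hb by (simp add: inner_add_left del: of_nat_Suc)
      qed
    qed auto
    then show ?thesis using proximal_subset_limiting by blast
  qed
  have "filterlim (\<lambda>n. inverse (real (Suc n))) (at_right 0) sequentially"
    by (rule tendsto_imp_filterlim_at_right[OF LIMSEQ_inverse_real_of_nat]) simp
  \<comment> \<open>The scaled \<open>wb\<close> disappears and exactly \<open>e\<close> remains;
    the base point is constantly \<open>zb\<close>, so convergence of values is immediate.\<close>
  moreover have "(\<lambda>n. inverse (real (Suc n)) *\<^sub>R (wb + real (Suc n) *\<^sub>R e)) \<longlonglongrightarrow> e"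
  proof -
    have "(\<lambda>n. inverse (real (Suc n)) *\<^sub>R wb + e) \<longlonglongrightarrow> 0 *\<^sub>R wb + e"
      by (intro tendsto_intros LIMSEQ_inverse_real_of_nat)
    then show ?thesis by (simp add: scaleR_add_right del: of_nat_Suc)
  qed
  ultimately have "e \<in> horizon_subdiff h zb"
    unfolding horizon_subdiff_def using fin sub
    by (intro CollectI conjI exI[of _ "\<lambda>n. zb"] exI[of _ "\<lambda>n. wb + real (Suc n) *\<^sub>R e"]
        exI[of _ "\<lambda>n. inverse (real (Suc n))"]) auto
  then have "e = 0" using tr k(3) by blast
  then show False using k(2) by simp
qed

section \<open>Pullback of proximal inequalities, quadratic perturbations and attentiveness\<close>

lemma ereal_add_le_shift:
  assumes "h0 + ereal q0 \<le> h1 + ereal q1" "q0' + q1 \<le> q0 + q1'"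
  shows "h0 + ereal q0' \<le> h1 + ereal q1'"
  using assms by (cases h0; cases h1) auto

text \<open>Replacing \<open>F u - F u0\<close> by its linear part costs \<open>norm w * L\<close>,
  and the quadratic in \<open>F u - F u0\<close> costs \<open>s * B\<^sup>2\<close>; all errors are
  quadratic in \<open>u - u0\<close> and add up to \<open>R\<close>. The inequality is assumed only
  along the values of \<open>F\<close>, since in the exact penalty argument it is known only there.
  The extra slope \<open>a\<close> and curvature \<open>s'\<close> come from the proximity term of
  that argument.\<close>

lemma proximal_subdiff_pullback:
  fixes h :: "'b::euclidean_space \<Rightarrow> ereal" and F :: "'a::euclidean_space \<Rightarrow> 'b" and A :: "'a \<Rightarrow>\<^sub>L 'b"
  assumes fin: "\<bar>h (F u0)\<bar> \<noteq> \<infinity>" and X: "open X" "u0 \<in> X"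
    and lin: "\<And>u. u \<in> X \<Longrightarrow> norm (F u - F u0 - blinfun_apply A (u - u0)) \<le> L * (norm (u - u0))\<^sup>2"
    and lip: "\<And>u. u \<in> X \<Longrightarrow> norm (F u - F u0) \<le> B * norm (u - u0)"
    and ineq: "\<And>u. u \<in> X \<Longrightarrow> h (F u) \<ge> h (F u0) +
      ereal (w \<bullet> (F u - F u0) + a \<bullet> (u - u0) - s * (norm (F u - F u0))\<^sup>2 - s' * (norm (u - u0))\<^sup>2)"
    and pos: "L \<ge> 0" "B \<ge> 0" "s \<ge> 0" "s' \<ge> 0"
  shows "adjoint A w + a \<in> proximal_subdiff (h \<circ> F) u0"
proof -
  define R where "R = norm w * L + s * B\<^sup>2 + s'"
  have "R \<ge> 0" using pos by (simp add: R_def)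
  show ?thesis
    unfolding proximal_subdiff_def o_def
  proof (intro CollectI conjI exI[of _ X] exI[of _ "2 * R + 1"] ballI fin X)
    fix u assume u: "u \<in> X"
    have "w \<bullet> (F u - F u0) = w \<bullet> blinfun_apply A (u - u0) + w \<bullet> (F u - F u0 - blinfun_apply A (u - u0))"
      by (simp add: inner_diff_right)
    moreover have "- (norm w * (L * (norm (u - u0))\<^sup>2)) \<le> w \<bullet> (F u - F u0 - blinfun_apply A (u - u0))"
    proof -
      have "\<bar>w \<bullet> (F u - F u0 - blinfun_apply A (u - u0))\<bar> \<le> norm w * norm (F u - F u0 - blinfun_apply A (u - u0))"
        by (rule Cauchy_Schwarz_ineq2)
      also have "\<dots> \<le> norm w * (L * (norm (u - u0))\<^sup>2)" by (intro mult_left_mono lin u) auto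
      finally show ?thesis by linarith
    qed
    moreover have "s * (norm (F u - F u0))\<^sup>2 \<le> s * (B * norm (u - u0))\<^sup>2"
      using pos by (intro mult_left_mono power_mono lip u) auto
    moreover have "s * (B * norm (u - u0))\<^sup>2 = s * B\<^sup>2 * (norm (u - u0))\<^sup>2"
      by (simp add: power_mult_distrib)
    moreover have "(adjoint A w + a) \<bullet> (u - u0) = w \<bullet> blinfun_apply A (u - u0) + a \<bullet> (u - u0)"
      by (simp only: inner_add_left inner_adjoint)
    moreover have "(2 * R + 1) / 2 * (norm (u - u0))\<^sup>2 = norm w * (L * (norm (u - u0))\<^sup>2) +
        s * B\<^sup>2 * (norm (u - u0))\<^sup>2 + s' * (norm (u - u0))\<^sup>2 + (norm (u - u0))\<^sup>2 / 2"
      by (simp add: R_def field_simps)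
    moreover have "0 \<le> (norm (u - u0))\<^sup>2" by simp
    ultimately have "(adjoint A w + a) \<bullet> (u - u0) - (2 * R + 1) / 2 * (norm (u - u0))\<^sup>2 \<le>
        w \<bullet> (F u - F u0) + a \<bullet> (u - u0) - s * (norm (F u - F u0))\<^sup>2 - s' * (norm (u - u0))\<^sup>2"
      by linarith
    then show "h (F u0) + ereal ((adjoint A w + a) \<bullet> (u - u0) - (2 * R + 1) / 2 * (norm (u - u0))\<^sup>2) \<le> h (F u)"
      using ineq[OF u] by (meson add_left_mono ereal_less_eq(3) order_trans)
  qed (use \<open>R \<ge> 0\<close> in auto)
qed

text \<open>At proximal level the quadratic expands exactly: its slope moves into the subgradient
  and its curvature \<open>1 / t\<close> into the constant. Continuity of the quadratic then lets
  values and subgradients pass to the limit.\<close>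

lemma limiting_subdiff_remove_quadratic:
  fixes g :: "'a::euclidean_space \<Rightarrow> ereal"
  assumes t: "t > 0"
    and v: "0 \<in> limiting_subdiff (\<lambda>y. g y + ereal (1 / (2 * t) * (norm (x - y))\<^sup>2)) y"
  shows "inverse t *\<^sub>R (x - y) \<in> limiting_subdiff g y"
proof -
  let ?q = "\<lambda>y. 1 / (2 * t) * (norm (x - y))\<^sup>2"
  obtain ys vs where ys: "\<And>i. vs i \<in> proximal_subdiff (\<lambda>y. g y + ereal (?q y)) (ys i)" "ys \<longlonglongrightarrow> y"
      "(\<lambda>i. g (ys i) + ereal (?q (ys i))) \<longlonglongrightarrow> g y + ereal (?q y)" "vs \<longlonglongrightarrow> 0"
    and fin: "\<bar>g y + ereal (?q y)\<bar> \<noteq> \<infinity>"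
    using v by (auto simp: limiting_subdiff_def)
  have "vs i + inverse t *\<^sub>R (x - ys i) \<in> proximal_subdiff g (ys i)" for i
  proof -
    obtain X r where X: "open X" "ys i \<in> X" "r > 0" and fini: "\<bar>g (ys i) + ereal (?q (ys i))\<bar> \<noteq> \<infinity>"
      and P: "\<And>u. u \<in> X \<Longrightarrow> (g (ys i) + ereal (?q (ys i))) + ereal (vs i \<bullet> (u - ys i) - r / 2 * (norm (u - ys i))\<^sup>2)
         \<le> g u + ereal (?q u)"
      using ys(1)[of i] by (auto simp: proximal_subdiff_def)
    show ?thesis unfolding proximal_subdiff_def
    proof (intro CollectI conjI exI[of _ X] exI[of _ "r + 1 / t"] ballI X)
      fix u assume u: "u \<in> X"
      have "?q u = ?q (ys i) - (inverse t *\<^sub>R (x - ys i)) \<bullet> (u - ys i) + 1 / (2 * t) * (norm (u - ys i))\<^sup>2"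
        using norm_diff_sq_expand[of u x "ys i"] t
        by (simp add: norm_minus_commute[of x] inner_diff_left field_simps)
      moreover have "g (ys i) + ereal (?q (ys i) + (vs i \<bullet> (u - ys i) - r / 2 * (norm (u - ys i))\<^sup>2)) \<le> g u + ereal (?q u)"
        using P[OF u] by (simp add: add.assoc)
      ultimately have "g (ys i) + ereal ((vs i + inverse t *\<^sub>R (x - ys i)) \<bullet> (u - ys i) - (r + 1 / t) / 2 * (norm (u - ys i))\<^sup>2) \<le> g u + ereal 0"
        by (elim ereal_add_le_shift) (simp add: inner_add_left algebra_simps add_divide_distrib)
      then show "g (ys i) + ereal ((vs i + inverse t *\<^sub>R (x - ys i)) \<bullet> (u - ys i) - (r + 1 / t) / 2 * (norm (u - ys i))\<^sup>2) \<le> g u"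
        by (simp flip: zero_ereal_def)
    next
      show "\<bar>g (ys i)\<bar> \<noteq> \<infinity>" using fini by (cases "g (ys i)") auto
      show "0 < r + 1 / t" using X(3) t by (simp add: add_pos_pos)
    qed
  qed
  moreover have "(\<lambda>i. vs i + inverse t *\<^sub>R (x - ys i)) \<longlonglongrightarrow> 0 + inverse t *\<^sub>R (x - y)"
    by (intro tendsto_intros ys)
  moreover have "(\<lambda>i. g (ys i)) \<longlonglongrightarrow> g y"
  proof -
    have "(\<lambda>i. (g (ys i) + ereal (?q (ys i))) + ereal (- ?q (ys i))) \<longlonglongrightarrow> (g y + ereal (?q y)) + ereal (- ?q y)"
      using fin by (intro tendsto_add_ereal ys(3) tendsto_intros ys(2)) auto
    then show ?thesis by (simp add: add.assoc flip: zero_ereal_def)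
  qed
  moreover have "\<bar>g y\<bar> \<noteq> \<infinity>" using fin by (cases "g y") auto
  ultimately show ?thesis using ys(2) unfolding limiting_subdiff_def
    by (intro CollectI conjI exI[of _ ys] exI[of _ "\<lambda>i. vs i + inverse t *\<^sub>R (x - ys i)"]) auto
qed

lemma ereal_ball_subset:
  assumes "\<bar>a - b\<bar> < \<epsilon>" "\<bar>b\<bar> \<noteq> \<infinity>"
  obtains d where "d > 0" "\<And>x. \<bar>x - a\<bar> < ereal d \<Longrightarrow> \<bar>x - b\<bar> < (\<epsilon>::ereal)"
proof (cases \<epsilon>)
  case (real e)
  show ?thesis
  proof
    show "e - \<bar>real_of_ereal a - real_of_ereal b\<bar> > 0"
      using assms real by (cases a; cases b) auto
    fix x assume "\<bar>x - a\<bar> < ereal (e - \<bar>real_of_ereal a - real_of_ereal b\<bar>)"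
    then show "\<bar>x - b\<bar> < \<epsilon>" using assms real by (cases a; cases b; cases x) auto
  qed
next
  case PInf
  have a: "\<bar>a\<bar> \<noteq> \<infinity>" using assms by (cases a; cases b) auto
  show ?thesis
  proof
    show "(1::real) > 0" by simp
    fix x assume "\<bar>x - a\<bar> < ereal 1"
    then show "\<bar>x - b\<bar> < \<epsilon>" using assms PInf a by (cases a; cases b; cases x) auto
  qed
next
  case MInf
  then show ?thesis using assms by simp
qed

lemma half_ereal_le: "\<bar>a\<bar> < \<epsilon> / 2 \<Longrightarrow> \<bar>a\<bar> < (\<epsilon>::ereal)"
  by (cases \<epsilon>; cases a) auto

text \<open>Semicontinuity bounds \<open>h z\<close> from below; from above, half of the tolerance
  comes from \<open>z0\<close> and the other half pays for the increase \<open>s\<close>. Working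
  with a real \<open>e \<le> \<epsilon>\<close> covers infinite \<epsilon> as well.\<close>

lemma closed_fun_attentive:
  assumes lsc: "closed_fun h" and fin: "\<bar>h zb\<bar> \<noteq> \<infinity>" and \<epsilon>: "\<epsilon> > 0"
  obtains \<eta> where "\<eta> > 0"
    "\<And>z z0 s. dist z zb < \<eta> \<Longrightarrow> \<bar>h z0 - h zb\<bar> < \<epsilon> / 2 \<Longrightarrow> h z \<le> h z0 + ereal s \<Longrightarrow> s \<le> \<eta> \<Longrightarrow> \<bar>h z - h zb\<bar> < (\<epsilon>::ereal)"
proof -
  obtain hb where hb: "h zb = ereal hb" using fin by auto
  obtain e where e: "e > 0" "ereal e \<le> \<epsilon>" using \<epsilon> by (metis ereal_dense2 ereal_less(2) less_imp_le)
  have "eventually (\<lambda>z. ereal (hb - e / 2) < h z) (nhds zb)"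
    by (rule closed_fun_eventually_gt[OF lsc]) (use hb e in simp)
  then obtain d where d: "d > 0" "\<And>z. dist z zb < d \<Longrightarrow> ereal (hb - e / 2) < h z"
    unfolding eventually_nhds_metric by blast
  show ?thesis
  proof
    show "min d (e / 2) > 0" using d e by simp
    fix z z0 s assume *: "dist z zb < min d (e / 2)" "\<bar>h z0 - h zb\<bar> < \<epsilon> / 2" "h z \<le> h z0 + ereal s" "s \<le> min d (e / 2)"
    have "ereal (hb - e / 2) < h z" using d * by simp
    then show "\<bar>h z - h zb\<bar> < \<epsilon>"
      using e *(2-4) hb by (cases \<epsilon>; cases "h z0"; cases "h z") (auto simp: abs_if split: if_splits)
  qed
qed

text \<open>One radius for many smallness conditions: \<open>b\<close> is taken as a sum dominating
  all their coefficients.\<close>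

lemma small_multiple_exists:
  fixes m b :: real assumes "m > 0" "b \<ge> 0"
  obtains \<eta> where "\<eta> > 0" "\<And>a. a \<le> b \<Longrightarrow> a * \<eta> < m"
proof
  show "m / (b + 1) > 0" using assms by simp
  fix a assume "a \<le> b"
  then have "a * (m / (b + 1)) \<le> b * (m / (b + 1))" using assms by (intro mult_right_mono) auto
  also have "\<dots> < m" using assms by (simp add: field_simps)
  finally show "a * (m / (b + 1)) < m" .
qed

subsection \<open>Composite functions under subgradient control\<close>

locale composite =
  fixes c :: "'a::euclidean_space \<Rightarrow> 'b::euclidean_space"
    and Dc :: "'a \<Rightarrow> 'a \<Rightarrow>\<^sub>L 'b"
    and h :: "'b \<Rightarrow> ereal"
    and xbar :: 'a
  assumes c_deriv: "\<And>x. (c has_derivative blinfun_apply (Dc x)) (at x)"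
    and c_C1: "continuous_on UNIV Dc"
    and h_closed: "closed_fun h"
    and fin: "\<bar>h (c xbar)\<bar> \<noteq> \<infinity>"
    and Dc_lipschitz: "\<exists>L U. open U \<and> xbar \<in> U \<and> L-lipschitz_on U Dc"
begin

lemma isCont_Dc: "isCont Dc x"
  using c_C1 continuous_on_eq_continuous_at[OF open_UNIV] by blast

text \<open>Balls are convex, so segments between nearby points stay where \<open>Dc\<close> is
  controlled, and mean value estimates along them give the last two bounds. The Lipschitz constant
  of \<open>Dc\<close> also serves for the quadratic remainder.\<close>

lemma local_bounds:
  assumes \<eta>: "\<eta> > 0"
  obtains \<rho> L where "\<rho> > 0" "L \<ge> 0"
    "\<And>x. dist x xbar < \<rho> \<Longrightarrow> norm (Dc x - Dc xbar) < \<eta>"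
    "\<And>x. dist x xbar < \<rho> \<Longrightarrow> norm (Dc x) \<le> norm (Dc xbar) + \<eta>"
    "\<And>x u. dist x xbar < \<rho> \<Longrightarrow> dist u xbar < \<rho> \<Longrightarrow> norm (Dc u - Dc x) \<le> L * norm (u - x)"
    "\<And>x u. dist x xbar < \<rho> \<Longrightarrow> dist u xbar < \<rho> \<Longrightarrow>
       norm (c u - c x - blinfun_apply (Dc x) (u - x)) \<le> L * (norm (u - x))\<^sup>2"
    "\<And>x u. dist x xbar < \<rho> \<Longrightarrow> dist u xbar < \<rho> \<Longrightarrow> norm (c u - c x) \<le> (norm (Dc xbar) + \<eta>) * norm (u - x)"
proof -
  obtain L U where U: "open U" "xbar \<in> U" "L-lipschitz_on U Dc" using Dc_lipschitz by blast
  obtain \<rho>1 where \<rho>1: "\<rho>1 > 0" "ball xbar \<rho>1 \<subseteq> U" using U open_contains_ball by blast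
  obtain \<rho>2 where \<rho>2: "\<rho>2 > 0" "\<And>x. dist x xbar < \<rho>2 \<Longrightarrow> dist (Dc x) (Dc xbar) < \<eta>"
    using isCont_Dc[of xbar] \<eta> unfolding continuous_at_eps_delta by blast
  define \<rho> where "\<rho> = min \<rho>1 \<rho>2"
  have L: "L \<ge> 0" using U(3) by (rule lipschitz_on_nonneg)
  have 1: "norm (Dc x - Dc xbar) < \<eta>" if "dist x xbar < \<rho>" for x
    using \<rho>2(2)[of x] that by (simp add: \<rho>_def dist_norm)
  have 2: "norm (Dc x) \<le> norm (Dc xbar) + \<eta>" if "dist x xbar < \<rho>" for x
    using 1[OF that] norm_triangle_sub[of "Dc x" "Dc xbar"] by linarith
  have 3: "norm (Dc u - Dc x) \<le> L * norm (u - x)" if "dist x xbar < \<rho>" "dist u xbar < \<rho>" for x u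
    using lipschitz_onD[OF U(3), of u x] that \<rho>1(2) by (auto simp: \<rho>_def dist_norm norm_minus_commute subset_iff)
  have seg: "dist y xbar < \<rho>" if "dist x xbar < \<rho>" "dist u xbar < \<rho>" "y \<in> closed_segment x u" for x u y
    using that closed_segment_subset[of x "ball xbar \<rho>" u] by (auto simp: dist_commute)
  have mem: "x + t *\<^sub>R (u - x) \<in> closed_segment x u" if "t \<in> {0..1}" for t x and u :: 'a
    using that unfolding closed_segment_def by (auto intro!: exI[of _ t] simp: algebra_simps)
  have der: "(c has_derivative blinfun_apply (Dc y)) (at y within S)" for y S
    using c_deriv by (rule has_derivative_at_withinI)
  have 4: "norm (c u - c x - blinfun_apply (Dc x) (u - x)) \<le> L * (norm (u - x))\<^sup>2"
    if xu: "dist x xbar < \<rho>" "dist u xbar < \<rho>" for x u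
  proof -
    have "norm (c u - c x - blinfun_apply (Dc x) (u - x)) \<le> norm (u - x) * (L * norm (u - x))"
    proof (rule differentiable_bound_linearization[where f' = "\<lambda>y. blinfun_apply (Dc y)", OF mem der])
      fix y assume y: "y \<in> closed_segment x u"
      have "blinfun_apply (Dc y) - blinfun_apply (Dc x) = blinfun_apply (Dc y - Dc x)"
        by (simp add: fun_eq_iff blinfun.diff_left)
      then have "onorm (blinfun_apply (Dc y) - blinfun_apply (Dc x)) = norm (Dc y - Dc x)"
        by (simp add: norm_blinfun.rep_eq)
      also have "\<dots> \<le> L * norm (y - x)" by (rule 3[OF xu(1) seg[OF xu y]])
      also have "\<dots> \<le> L * norm (u - x)" using L segment_bound(1)[OF y] by (rule mult_left_mono[rotated])
      finally show "onorm (blinfun_apply (Dc y) - blinfun_apply (Dc x)) \<le> L * norm (u - x)" .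
    qed auto
    then show ?thesis by (simp add: power2_eq_square mult_ac)
  qed
  have 5: "norm (c u - c x) \<le> (norm (Dc xbar) + \<eta>) * norm (u - x)"
    if xu: "dist x xbar < \<rho>" "dist u xbar < \<rho>" for x u
  proof (rule differentiable_bound[where f' = "\<lambda>y. blinfun_apply (Dc y)", OF _ der])
    show "convex (closed_segment x u)" by simp
    fix y assume "y \<in> closed_segment x u"
    then show "onorm (blinfun_apply (Dc y)) \<le> norm (Dc xbar) + \<eta>"
      using 2[OF seg[OF xu]] by (simp add: norm_blinfun.rep_eq)
  qed auto
  have "\<rho> > 0" using \<rho>1 \<rho>2 by (simp add: \<rho>_def)
  then show thesis by (rule that[OF _ L]) (fact 1 2 3 4 5)+
qed

text \<open>With the affine map as a function of its own, the linearization is again a composition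
  with \<open>h\<close>, and the chain rules apply with constant derivative
  \<open>Dc x\<close>.\<close>

definition lin_map :: "'a \<Rightarrow> 'a \<Rightarrow> 'b" where
  "lin_map x y = c x + blinfun_apply (Dc x) (y - x)"

lemma lin_map_deriv: "(lin_map x has_derivative blinfun_apply (Dc x)) (at u)"
  unfolding lin_map_def[abs_def] by (auto intro!: derivative_eq_intros simp: blinfun.diff_right)

lemma lin_map_self [simp]: "lin_map x x = c x"
  by (simp add: lin_map_def)

lemma linearization_eq: "linearization c Dc h x = h \<circ> lin_map x"
  by (simp add: fun_eq_iff linearization_def lin_map_def)

end

text \<open>Two kinds of instance occur: a finite \<epsilon> with \<open>r > 0\<close> from
  prox-regularity, and \<epsilon> = \<infinity> with \<open>r = 0\<close> for convex
  \<open>h\<close>.\<close>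

locale controlled_composite = composite c Dc h xbar
  for c :: "'a::euclidean_space \<Rightarrow> 'b::euclidean_space" and Dc h xbar +
  fixes \<delta> :: real and \<epsilon> :: ereal and M r :: real
  assumes \<delta>: "\<delta> > 0" and \<epsilon>: "\<epsilon> > 0" and r: "r \<ge> 0"
    and control: "subgradient_control h (c xbar) (Dc xbar) \<delta> \<epsilon> M r"
begin

text \<open>The control hypothesis supplies the bound required by \<open>bounded_chain_rule\<close>.
  The inner map is left general because both \<open>c\<close> and \<open>lin_map x\<close> are
  needed.\<close>

lemma multiplier_exists:
  assumes F: "\<And>u. (F has_derivative blinfun_apply (DF u)) (at u)"
    and cont: "isCont DF y"
    and v: "v \<in> limiting_subdiff (h \<circ> F) y" "norm v < \<delta>"
    and y: "dist (F y) (c xbar) < \<delta>" "\<bar>h (F y) - h (c xbar)\<bar> < \<epsilon>" "norm (DF y - Dc xbar) < \<delta>"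
  obtains w where "w \<in> limiting_subdiff h (F y)" "adjoint (DF y) w = v" "norm w \<le> M"
    "\<And>z'. dist z' (c xbar) < \<delta> \<Longrightarrow>
       h z' \<ge> h (F y) + ereal (w \<bullet> (z' - F y) - r / 2 * (norm (z' - F y))\<^sup>2)"
proof -
  obtain d1 where d1: "d1 > 0" "\<And>x. \<bar>x - h (F y)\<bar> < ereal d1 \<Longrightarrow> \<bar>x - h (c xbar)\<bar> < \<epsilon>"
    using ereal_ball_subset[OF y(2) fin] by blast
  obtain d2 where d2: "d2 > 0" "\<And>u. dist u y < d2 \<Longrightarrow> dist (DF u) (DF y) < \<delta> - norm (DF y - Dc xbar)"
    using cont y(3) unfolding continuous_at_eps_delta by (metis diff_gt_0_iff_gt)
  \<comment> \<open>\<open>d\<close> is the slack left in the strict assumptions at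
    \<open>y\<close>, so that nearby data still fall under the control hypothesis.\<close>
  define d where "d = min (min d1 d2) (min (\<delta> - norm v) (\<delta> - dist (F y) (c xbar)))"
  have "d > 0" using d1 d2 v y by (simp add: d_def)
  have "\<exists>w\<in>limiting_subdiff h (F y). adjoint (blinfun_apply (DF y)) w = v"
  proof (rule bounded_chain_rule[OF h_closed F cont v(1) \<open>d > 0\<close>, of M])
    fix u z w
    assume *: "dist u y < d" "dist z (F y) < d" "\<bar>h z - h (F y)\<bar> < ereal d"
       "w \<in> limiting_subdiff h z" "norm (adjoint (blinfun_apply (DF u)) w - v) < d"
    have "dist z (c xbar) < \<delta>" using *(2) dist_triangle[of z "c xbar" "F y"] by (simp add: d_def)
    moreover have "\<bar>h z - h (c xbar)\<bar> < \<epsilon>"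
    proof (rule d1(2))
      have "d \<le> d1" by (simp add: d_def)
      then have "ereal d \<le> ereal d1" by simp
      then show "\<bar>h z - h (F y)\<bar> < ereal d1" using *(3) order_less_le_trans by blast
    qed
    moreover have "norm (DF u - Dc xbar) < \<delta>"
      using d2(2)[of u] *(1) dist_triangle[of "DF u" "Dc xbar" "DF y"] by (simp add: d_def dist_norm)
    moreover have "norm (adjoint (blinfun_apply (DF u)) w) < \<delta>"
      using *(5) norm_triangle_sub[of "adjoint (blinfun_apply (DF u)) w" v] by (simp add: d_def)
    ultimately show "norm w \<le> M" using control *(4) unfolding subgradient_control_def by blast
  qed
  then obtain w where w: "w \<in> limiting_subdiff h (F y)" "adjoint (blinfun_apply (DF y)) w = v" by blast
  then show ?thesis using that control y v(2) unfolding subgradient_control_def by blast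
qed

lemma prox_map_multiplier:
  assumes t: "t > 0" and y: "y \<in> prox_map c Dc h t x"
    and small: "norm (inverse t *\<^sub>R (x - y)) < \<delta>" "dist (lin_map x y) (c xbar) < \<delta>"
      "\<bar>linearization c Dc h x y - h (c xbar)\<bar> < \<epsilon>" "norm (Dc x - Dc xbar) < \<delta>"
  obtains w where "adjoint (Dc x) w = inverse t *\<^sub>R (x - y)" "norm w \<le> M"
    "\<And>z'. dist z' (c xbar) < \<delta> \<Longrightarrow>
       h z' \<ge> h (lin_map x y) + ereal (w \<bullet> (z' - lin_map x y) - r / 2 * (norm (z' - lin_map x y))\<^sup>2)"
proof -
  have "inverse t *\<^sub>R (x - y) \<in> limiting_subdiff (h \<circ> lin_map x) y"
    using y unfolding prox_map_def stationary_def mem_Collect_eq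
    by (intro limiting_subdiff_remove_quadratic[OF t]) (simp add: prox_linearization_def[abs_def] linearization_eq)
  from multiplier_exists[where DF = "\<lambda>_. Dc x", OF lin_map_deriv _ this small(1)] small that show ?thesis
    by (auto simp: linearization_eq)
qed

text \<open>At \<open>x\<close> the maps \<open>c\<close> and \<open>lin_map x\<close> share value
  and derivative, and the prox term has zero gradient there. So either condition yields a multiplier
  annihilated by the adjoint of \<open>Dc x\<close>, and its proximal inequality can be pulled back
  along the other map.\<close>

lemma stationary_iff_fixed_point:
  assumes t: "t > 0"
  obtains \<eta> where "\<eta> > 0"
    "\<And>x. dist x xbar < \<eta> \<Longrightarrow> \<bar>h (c x) - h (c xbar)\<bar> < \<epsilon> \<Longrightarrow>
      0 \<in> limiting_subdiff (h \<circ> c) x \<longleftrightarrow> x \<in> prox_map c Dc h t x"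
proof -
  obtain \<rho> L where \<rho>: "\<rho> > 0" "L \<ge> 0"
    and b1: "\<And>x. dist x xbar < \<rho> \<Longrightarrow> norm (Dc x - Dc xbar) < \<delta>"
    and b4: "\<And>x u. dist x xbar < \<rho> \<Longrightarrow> dist u xbar < \<rho> \<Longrightarrow>
       norm (c u - c x - blinfun_apply (Dc x) (u - x)) \<le> L * (norm (u - x))\<^sup>2"
    and b5: "\<And>x u. dist x xbar < \<rho> \<Longrightarrow> dist u xbar < \<rho> \<Longrightarrow> norm (c u - c x) \<le> (norm (Dc xbar) + \<delta>) * norm (u - x)"
    using local_bounds[OF \<delta>] by metis
  have contc: "isCont c x" for x using c_deriv by (rule has_derivative_continuous)
  have contc': "continuous_on UNIV c" using contc continuous_at_imp_continuous_on by blast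
  obtain \<eta>1 where \<eta>1: "\<eta>1 > 0" "\<And>x. dist x xbar < \<eta>1 \<Longrightarrow> dist (c x) (c xbar) < \<delta>"
    using contc[of xbar] \<delta> unfolding continuous_at_eps_delta by blast
  show ?thesis
  proof
    show "min \<rho> \<eta>1 > 0" using \<rho> \<eta>1 by simp
    fix x assume x: "dist x xbar < min \<rho> \<eta>1" and att: "\<bar>h (c x) - h (c xbar)\<bar> < \<epsilon>"
    have cx: "dist (c x) (c xbar) < \<delta>" and Dx: "norm (Dc x - Dc xbar) < \<delta>" using x b1 \<eta>1 by auto
    have B: "norm (Dc xbar) + \<delta> \<ge> 0" using \<delta> by (simp add: add_nonneg_nonneg)
    show "0 \<in> limiting_subdiff (h \<circ> c) x \<longleftrightarrow> x \<in> prox_map c Dc h t x"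
    proof
      assume 0: "0 \<in> limiting_subdiff (h \<circ> c) x"
      then have finx: "\<bar>h (c x)\<bar> \<noteq> \<infinity>" by (simp add: limiting_subdiff_def)
      have "norm (0::'a) < \<delta>" using \<delta> by simp
      from multiplier_exists[OF c_deriv isCont_Dc 0 this cx att Dx]
      obtain w where w: "adjoint (blinfun_apply (Dc x)) w = 0"
        "\<And>z'. dist z' (c xbar) < \<delta> \<Longrightarrow>
          h z' \<ge> h (c x) + ereal (w \<bullet> (z' - c x) - r / 2 * (norm (z' - c x))\<^sup>2)" by metis
      have lc: "continuous_on UNIV (lin_map x)"
        using lin_map_deriv has_derivative_continuous continuous_at_imp_continuous_on by metis
      have "adjoint (Dc x) w + 0 \<in> proximal_subdiff (h \<circ> lin_map x) x"
      proof (rule proximal_subdiff_pullback[where L = 0 and B = "norm (Dc x)" and s = "r / 2" and s' = 0])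
        show "open (lin_map x -` ball (c xbar) \<delta>)" using lc by (intro open_vimage) auto
        fix u assume "u \<in> lin_map x -` ball (c xbar) \<delta>"
        then show "h (lin_map x x) + ereal (w \<bullet> (lin_map x u - lin_map x x) + 0 \<bullet> (u - x)
            - r / 2 * (norm (lin_map x u - lin_map x x))\<^sup>2 - 0 * (norm (u - x))\<^sup>2) \<le> h (lin_map x u)"
          using w(2)[of "lin_map x u"] by (simp add: dist_commute)
      qed (use finx cx r norm_blinfun in \<open>auto simp: dist_commute lin_map_def\<close>)
      then have "0 \<in> proximal_subdiff (h \<circ> lin_map x) x" using w(1) by simp
      then obtain X r' where X: "open X" "x \<in> X" "r' > 0"
        "\<And>u. u \<in> X \<Longrightarrow> h (lin_map x u) \<ge> h (c x) + ereal (0 \<bullet> (u - x) - r' / 2 * (norm (u - x))\<^sup>2)"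
        unfolding proximal_subdiff_def by auto
      have "0 \<in> proximal_subdiff (prox_linearization c Dc h t x) x"
        unfolding proximal_subdiff_def
      proof (intro CollectI conjI exI[of _ X] exI[of _ r'] ballI X(1-3))
        show "\<bar>prox_linearization c Dc h t x x\<bar> \<noteq> \<infinity>" using finx
          by (simp add: prox_linearization_def linearization_eq flip: zero_ereal_def)
        fix u assume "u \<in> X"
        have "prox_linearization c Dc h t x x + ereal (0 \<bullet> (u - x) - r' / 2 * (norm (u - x))\<^sup>2) \<le> h (lin_map x u)"
          using X(4)[OF \<open>u \<in> X\<close>] by (simp add: prox_linearization_def linearization_eq flip: zero_ereal_def)
        also have "\<dots> \<le> prox_linearization c Dc h t x u" using t
          by (simp add: prox_linearization_def linearization_eq add_increasing2)
        finally show "prox_linearization c Dc h t x x + ereal (0 \<bullet> (u - x) - r' / 2 * (norm (u - x))\<^sup>2)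
           \<le> prox_linearization c Dc h t x u" .
      qed
      then show "x \<in> prox_map c Dc h t x"
        unfolding prox_map_def stationary_def using proximal_subset_limiting by blast
    next
      assume S: "x \<in> prox_map c Dc h t x"
      then have finx: "\<bar>h (c x)\<bar> \<noteq> \<infinity>"
        by (simp add: prox_map_def stationary_def limiting_subdiff_def prox_linearization_def linearization_eq flip: zero_ereal_def)
      obtain w where w: "adjoint (blinfun_apply (Dc x)) w = inverse t *\<^sub>R (x - x)"
        "\<And>z'. dist z' (c xbar) < \<delta> \<Longrightarrow>
          h z' \<ge> h (c x) + ereal (w \<bullet> (z' - c x) - r / 2 * (norm (z' - c x))\<^sup>2)"
        using prox_map_multiplier[OF t S] cx att Dx \<delta> by (simp add: linearization_eq) metis
      have "adjoint (Dc x) w + 0 \<in> proximal_subdiff (h \<circ> c) x"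
      proof (rule proximal_subdiff_pullback[where L = L and B = "norm (Dc xbar) + \<delta>" and s = "r / 2" and s' = 0])
        show "open (ball xbar (min \<rho> \<eta>1))" by simp
        fix u assume u: "u \<in> ball xbar (min \<rho> \<eta>1)"
        then show "h (c x) + ereal (w \<bullet> (c u - c x) + 0 \<bullet> (u - x)
            - r / 2 * (norm (c u - c x))\<^sup>2 - 0 * (norm (u - x))\<^sup>2) \<le> h (c u)"
          using w(2)[of "c u"] \<eta>1(2)[of u] by (simp add: dist_commute)
        show "norm (c u - c x - blinfun_apply (Dc x) (u - x)) \<le> L * (norm (u - x))\<^sup>2"
          "norm (c u - c x) \<le> (norm (Dc xbar) + \<delta>) * norm (u - x)"
          using b4[of x u] b5[of x u] u x by (auto simp: dist_commute)
      qed (use finx x r B \<rho> in \<open>auto simp: dist_commute\<close>)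
      then show "0 \<in> limiting_subdiff (h \<circ> c) x" using w(1) proximal_subset_limiting by auto
    qed
  qed
qed

text \<open>The multiplier of \<open>v\<close> bounds the linearized model below by a function with
  slope \<open>v\<close> and curvature \<open>- r * B\<^sup>2\<close>. Adding the prox term gives
  net growth, so a minimiser over a ball satisfies
  \<open>\<tau> * norm (x - y) \<le> norm v\<close>. It is therefore interior for small
  \<open>v\<close>, hence stationary.\<close>

lemma prox_step_exists:
  assumes t: "t > 0" "r * (norm (Dc xbar) + \<delta>)\<^sup>2 < 1 / t"
  obtains \<eta> \<kappa> where "\<eta> > 0" "\<kappa> > 0"
    "\<And>x v. dist x xbar < \<eta> \<Longrightarrow> v \<in> limiting_subdiff (h \<circ> c) x \<Longrightarrow> norm v < \<eta> \<Longrightarrow>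
       \<bar>h (c x) - h (c xbar)\<bar> < \<epsilon> / 2 \<Longrightarrow>
       \<exists>y \<in> prox_map c Dc h t x. norm (x - y) \<le> \<kappa> * norm v \<and>
         \<bar>linearization c Dc h x y - h (c xbar)\<bar> < \<epsilon>"
proof -
  define B where "B = norm (Dc xbar) + \<delta>"
  have B: "B > 0" using \<delta> by (simp add: B_def add_nonneg_pos)
  \<comment> \<open>The net growth coefficient: prox term minus the curvature lost to the proximal
    inequality.\<close>
  define \<tau> where "\<tau> = (1 / t - r * B\<^sup>2) / 2"
  have \<tau>: "\<tau> > 0" using t(2) by (simp add: \<tau>_def B_def)
  obtain \<rho>0 L where \<rho>0: "\<rho>0 > 0"
    and b1: "\<And>x. dist x xbar < \<rho>0 \<Longrightarrow> norm (Dc x - Dc xbar) < \<delta>"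
    and b2: "\<And>x. dist x xbar < \<rho>0 \<Longrightarrow> norm (Dc x) \<le> B"
    and b5: "\<And>x u. dist x xbar < \<rho>0 \<Longrightarrow> dist u xbar < \<rho>0 \<Longrightarrow> norm (c u - c x) \<le> B * norm (u - x)"
    by (rule local_bounds[OF \<delta>, folded B_def]) (rule that; blast)
  obtain \<eta>1 where \<eta>1: "\<eta>1 > 0"
    and att: "\<And>z z0 s. dist z (c xbar) < \<eta>1 \<Longrightarrow> \<bar>h z0 - h (c xbar)\<bar> < \<epsilon> / 2 \<Longrightarrow> h z \<le> h z0 + ereal s \<Longrightarrow>
       s \<le> \<eta>1 \<Longrightarrow> \<bar>h z - h (c xbar)\<bar> < \<epsilon>"
    using closed_fun_attentive[OF h_closed fin \<epsilon>] by metis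
  \<comment> \<open>The linear part of a step of length \<rho> uses up less than half of \<delta>
    and of \<eta>1; the other halves cover the distance from \<open>c x\<close> to
    \<open>c xbar\<close>.\<close>
  define \<rho> where "\<rho> = min \<delta> \<eta>1 / (4 * B)"
  have \<rho>: "\<rho> > 0" "B * \<rho> < \<delta> / 2" "B * \<rho> < \<eta>1 / 2" using \<delta> \<eta>1 B by (auto simp: \<rho>_def)
  define m where "m = min (min \<rho>0 \<rho>) (min \<delta> \<eta>1)"
  have m: "m > 0" "m \<le> \<rho>0" "m \<le> \<rho>" "m \<le> \<delta>" "m \<le> \<eta>1"
    using \<rho>0 \<rho>(1) \<delta> \<eta>1 by (auto simp: m_def)
  have "m / 2 > 0" "1 + 1 / \<tau> + B \<ge> 0" using m(1) B \<tau> by auto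
  then obtain \<eta> where \<eta>: "\<eta> > 0" and \<eta>_less: "\<And>a. a \<le> 1 + 1 / \<tau> + B \<Longrightarrow> a * \<eta> < m / 2"
    using small_multiple_exists by metis
  have \<eta>s: "\<eta> < m / 2" "1 / \<tau> * \<eta> < m / 2"
      "B * \<eta> < m / 2"
    using \<eta>_less[of 1] \<eta>_less[of "1 / \<tau>"] \<eta>_less[of B] \<tau> B by auto
  show ?thesis
  proof
    show "\<eta> > 0" by fact
    show "1 / \<tau> > 0" using \<tau> by simp
    fix x v
    assume x: "dist x xbar < \<eta>" and v: "v \<in> limiting_subdiff (h \<circ> c) x" "norm v < \<eta>"
      and attx: "\<bar>h (c x) - h (c xbar)\<bar> < \<epsilon> / 2"
    have x0: "dist x xbar < \<rho>0" and v\<delta>: "norm v < \<delta>" using x v(2) \<eta>s(1) m by linarith+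
    have xx: "dist xbar xbar < \<rho>0" using \<rho>0 by simp
    have "dist (c x) (c xbar) \<le> B * dist x xbar" using b5[OF xx x0] by (simp add: dist_norm)
    also have "\<dots> \<le> B * \<eta>" using x B by (intro mult_left_mono) auto
    finally have cx: "dist (c x) (c xbar) \<le> B * \<eta>" .
    then have cx\<delta>: "dist (c x) (c xbar) < \<delta>" using \<eta>s(3) m by linarith
    obtain w where w: "adjoint (blinfun_apply (Dc x)) w = v"
      and hw: "\<And>z'. dist z' (c xbar) < \<delta> \<Longrightarrow>
       h z' \<ge> h (c x) + ereal (w \<bullet> (z' - c x) - r / 2 * (norm (z' - c x))\<^sup>2)"
      using multiplier_exists[OF c_deriv isCont_Dc v(1) v\<delta> cx\<delta> half_ereal_le[OF attx] b1[OF x0]] by metis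
    obtain hx where hx: "h (c x) = ereal hx" using v(1) by (auto simp: limiting_subdiff_def)
    have lin_dist: "dist (lin_map x u) (c xbar) < \<delta>" "dist (lin_map x u) (c xbar) < \<eta>1"
      if u: "dist u x \<le> \<rho>" for u
    proof -
      have "norm (blinfun_apply (Dc x) (u - x)) \<le> norm (Dc x) * norm (u - x)" by (rule norm_blinfun)
      also have "\<dots> \<le> B * \<rho>" using u B b2[OF x0] by (intro mult_mono) (auto simp: dist_norm)
      finally have "dist (lin_map x u) (c x) \<le> B * \<rho>" by (simp add: lin_map_def dist_norm)
      then show "dist (lin_map x u) (c xbar) < \<delta>" "dist (lin_map x u) (c xbar) < \<eta>1"
        using dist_triangle[of "lin_map x u" "c xbar" "c x"] cx \<eta>s(3) m \<rho>(2,3) by linarith+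
    qed
    have lower: "ereal (hx + (v \<bullet> (u - x) - r / 2 * B\<^sup>2 * (norm (u - x))\<^sup>2)) \<le> h (lin_map x u)"
      if u: "dist u x \<le> \<rho>" for u
    proof -
      have eq: "lin_map x u - c x = blinfun_apply (Dc x) (u - x)" by (simp add: lin_map_def)
      have "norm (blinfun_apply (Dc x) (u - x)) \<le> norm (Dc x) * norm (u - x)" by (rule norm_blinfun)
      also have "\<dots> \<le> B * norm (u - x)" using b2[OF x0] by (intro mult_right_mono) auto
      finally have "(norm (blinfun_apply (Dc x) (u - x)))\<^sup>2 \<le> (B * norm (u - x))\<^sup>2" by (intro power_mono) auto
      then have "r / 2 * (norm (blinfun_apply (Dc x) (u - x)))\<^sup>2 \<le> r / 2 * (B\<^sup>2 * (norm (u - x))\<^sup>2)"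
        using r by (intro mult_left_mono) (auto simp: power_mult_distrib)
      moreover have "w \<bullet> blinfun_apply (Dc x) (u - x) = v \<bullet> (u - x)" using w by (metis inner_adjoint)
      ultimately have "ereal (hx + (v \<bullet> (u - x) - r / 2 * B\<^sup>2 * (norm (u - x))\<^sup>2)) \<le>
          h (c x) + ereal (w \<bullet> (lin_map x u - c x) - r / 2 * (norm (lin_map x u - c x))\<^sup>2)"
        unfolding hx eq by simp
      also have "\<dots> \<le> h (lin_map x u)" by (rule hw[OF lin_dist(1)[OF u]])
      finally show ?thesis .
    qed
    \<comment> \<open>On this graph \<open>z\<close> is tied to \<open>u\<close>, so the joint
      minimisation is the prox subproblem restricted to a ball.\<close>
    let ?S = "(\<lambda>u. (u, lin_map x u)) ` cball x \<rho>"
    have "continuous_on UNIV (lin_map x)"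
      using lin_map_deriv has_derivative_continuous continuous_at_imp_continuous_on by metis
    then have "compact ?S"
      by (intro compact_continuous_image continuous_on_Pair continuous_on_id)
         (auto intro: continuous_on_subset)
    moreover have "?S \<noteq> {}" using \<rho>(1) by auto
    moreover have "continuous_on UNIV (\<lambda>p::'a \<times> 'b. 1 / (2 * t) * (norm (x - fst p))\<^sup>2)"
      by (intro continuous_intros)
    ultimately obtain y z where yz: "(y, z) \<in> ?S"
      and mn: "\<And>u z'. (u, z') \<in> ?S \<Longrightarrow> h z + ereal (1 / (2 * t) * (norm (x - fst (y, z)))\<^sup>2) \<le>
          h z' + ereal (1 / (2 * t) * (norm (x - fst (u, z')))\<^sup>2)"
      using penalized_min_exists[OF h_closed, of "\<lambda>p::'a \<times> 'b. 1 / (2 * t) * (norm (x - fst p))\<^sup>2" ?S] by blast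
    have z: "z = lin_map x y" and y: "dist y x \<le> \<rho>" using yz by (auto simp: dist_commute)
    have mn': "h (lin_map x y) + ereal (1 / (2 * t) * (norm (x - y))\<^sup>2) \<le>
        h (lin_map x u) + ereal (1 / (2 * t) * (norm (x - u))\<^sup>2)" if "dist u x \<le> \<rho>" for u
      using mn[of u "lin_map x u"] that z by (auto simp: dist_commute)
    have le: "h (lin_map x y) + ereal (1 / (2 * t) * (norm (x - y))\<^sup>2) \<le> ereal hx"
      using mn'[of x] \<rho>(1) hx by (simp flip: zero_ereal_def)
    obtain hy where hy: "h (lin_map x y) = ereal hy"
      using le lower[OF y] by (cases "h (lin_map x y)") auto
    have 1: "hy + 1 / (2 * t) * (norm (x - y))\<^sup>2 \<le> hx" using le hy by simp
    have 2: "hx + (v \<bullet> (y - x) - r / 2 * B\<^sup>2 * (norm (x - y))\<^sup>2) \<le> hy"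
      using lower[OF y] hy by (simp add: norm_minus_commute)
    have "- (v \<bullet> (y - x)) \<le> norm v * norm (x - y)"
      using Cauchy_Schwarz_ineq2[of v "y - x"] by (simp add: norm_minus_commute abs_le_iff)
    moreover have "\<tau> * (norm (x - y))\<^sup>2 = 1 / (2 * t) * (norm (x - y))\<^sup>2 - r / 2 * B\<^sup>2 * (norm (x - y))\<^sup>2"
      using t(1) by (simp add: \<tau>_def field_simps)
    ultimately have "\<tau> * (norm (x - y))\<^sup>2 \<le> norm v * norm (x - y)"
      using 1 2 by linarith
    then have "\<tau> * norm (x - y) \<le> norm v"
      by (cases "norm (x - y) = 0") (auto simp: power2_eq_square mult_le_cancel_right)
    then have step: "norm (x - y) \<le> 1 / \<tau> * norm v" using \<tau> by (simp add: field_simps)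
    also have "\<dots> \<le> 1 / \<tau> * \<eta>" using v(2) \<tau> by (intro mult_left_mono) auto
    finally have yx: "dist y x < \<rho>" using \<eta>s(2) m(1,3) unfolding dist_norm norm_minus_commute[of y x] by linarith
    have "0 \<in> proximal_subdiff (prox_linearization c Dc h t x) y"
      unfolding proximal_subdiff_def
    proof (intro CollectI conjI exI[of _ "ball x \<rho>"] exI[of _ 1] ballI)
      show "\<bar>prox_linearization c Dc h t x y\<bar> \<noteq> \<infinity>"
        using hy by (simp add: prox_linearization_def linearization_eq)
      fix u assume "u \<in> ball x \<rho>"
      then have "prox_linearization c Dc h t x y \<le> prox_linearization c Dc h t x u"
        using mn'[of u] by (simp add: prox_linearization_def linearization_eq dist_commute)
      moreover have "prox_linearization c Dc h t x y + ereal (0 \<bullet> (u - y) - 1 / 2 * (norm (u - y))\<^sup>2) \<le>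
          prox_linearization c Dc h t x y"
        using hy by (simp add: prox_linearization_def linearization_eq)
      ultimately show "prox_linearization c Dc h t x y + ereal (0 \<bullet> (u - y) - 1 / 2 * (norm (u - y))\<^sup>2) \<le>
          prox_linearization c Dc h t x u" by (rule order_trans[rotated])
    qed (use yx in \<open>auto simp: dist_commute\<close>)
    then have "y \<in> prox_map c Dc h t x"
      unfolding prox_map_def stationary_def using proximal_subset_limiting by blast
    moreover have "\<bar>linearization c Dc h x y - h (c xbar)\<bar> < \<epsilon>"
      unfolding linearization_eq o_def
    proof (rule att[OF lin_dist(2)[OF y] attx])
      have "1 / (2 * t) * (norm (x - y))\<^sup>2 \<ge> 0" using t(1) by simp
      then show "h (lin_map x y) \<le> h (c x) + ereal 0" using 1 hy hx by simp
    qed (use \<eta>1 in simp)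
    ultimately show "\<exists>y \<in> prox_map c Dc h t x. norm (x - y) \<le> 1 / \<tau> * norm v \<and>
         \<bar>linearization c Dc h x y - h (c xbar)\<bar> < \<epsilon>" using step by blast
  qed
qed

lemma nearby_subgradient_exists:
  assumes t: "t > 0"
  obtains \<eta> \<kappa> where "\<eta> > 0" "\<kappa> > 0"
    "\<And>x y. dist x xbar < \<eta> \<Longrightarrow> dist y xbar < \<eta> \<Longrightarrow> y \<in> prox_map c Dc h t x \<Longrightarrow>
       \<bar>linearization c Dc h x y - h (c xbar)\<bar> < \<epsilon> / 2 \<Longrightarrow>
       \<exists>u. \<exists>v \<in> limiting_subdiff (h \<circ> c) u. norm (x - u) \<le> \<kappa> * norm (x - y) \<and>
         norm v \<le> \<kappa> * norm (x - y) \<and> \<bar>h (c u) - h (c xbar)\<bar> < \<epsilon>"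
proof -
  define B where "B = norm (Dc xbar) + \<delta>"
  have B: "B > 0" using \<delta> by (simp add: B_def add_nonneg_pos)
  obtain \<rho>0 L where \<rho>0: "\<rho>0 > 0" and L: "L \<ge> 0"
    and b1: "\<And>x. dist x xbar < \<rho>0 \<Longrightarrow> norm (Dc x - Dc xbar) < \<delta>"
    and b2: "\<And>x. dist x xbar < \<rho>0 \<Longrightarrow> norm (Dc x) \<le> B"
    and b3: "\<And>x u. dist x xbar < \<rho>0 \<Longrightarrow> dist u xbar < \<rho>0 \<Longrightarrow> norm (Dc u - Dc x) \<le> L * norm (u - x)"
    and b4: "\<And>x u. dist x xbar < \<rho>0 \<Longrightarrow> dist u xbar < \<rho>0 \<Longrightarrow>
       norm (c u - c x - blinfun_apply (Dc x) (u - x)) \<le> L * (norm (u - x))\<^sup>2"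
    and b5: "\<And>x u. dist x xbar < \<rho>0 \<Longrightarrow> dist u xbar < \<rho>0 \<Longrightarrow> norm (c u - c x) \<le> B * norm (u - x)"
    by (rule local_bounds[OF \<delta>, folded B_def]) (rule that; blast)
  obtain \<eta>1 where \<eta>1: "\<eta>1 > 0"
    and att: "\<And>z z0 s. dist z (c xbar) < \<eta>1 \<Longrightarrow> \<bar>h z0 - h (c xbar)\<bar> < \<epsilon> / 2 \<Longrightarrow> h z \<le> h z0 + ereal s \<Longrightarrow>
       s \<le> \<eta>1 \<Longrightarrow> \<bar>h z - h (c xbar)\<bar> < \<epsilon>"
    using closed_fun_attentive[OF h_closed fin \<epsilon>] by metis
  define M' where "M' = \<bar>M\<bar>"
  have M': "M' \<ge> 0" "M \<le> M'" by (auto simp: M'_def)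
  \<comment> \<open>If the penalty were inexact, its multiplier of norm \<open>K\<close> would split
    into \<open>w\<close>, \<open>wh\<close> and a tilt, of norms at most \<open>M'\<close>, at most
    \<open>M'\<close> and less than 1.\<close>
  define K where "K = 2 * M' + 2"
  have K: "K > 0" using M' by (simp add: K_def)
  \<comment> \<open>Distances come out as at most the square root of
    \<open>K * L * d\<^sup>2\<close>. The added 1 gives \<open>C \<le> C\<^sup>2\<close>, so this
    root is at most \<open>C * d\<close>.\<close>
  define C where "C = K * L + 1"
  have C: "C \<ge> 1" "K * L \<le> C\<^sup>2"
  proof -
    show C1: "C \<ge> 1" using K L by (simp add: C_def)
    have "K * L \<le> C" by (simp add: C_def)
    also have "\<dots> \<le> C\<^sup>2" using C1 by (simp add: power2_eq_square)
    finally show "K * L \<le> C\<^sup>2" .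
  qed
  \<comment> \<open>The part \<open>r / 2\<close> offsets the curvature allowed by the proximal
    inequality; the 1 leaves genuine growth around \<open>z0\<close>.\<close>
  define \<rho>1 where "\<rho>1 = r / 2 + 1"
  have \<rho>1: "\<rho>1 \<ge> 1" using r by (simp add: \<rho>1_def)
  \<comment> \<open>The summands bound, in turn, the image of \<open>w\<close> at \<open>x\<close>,
    the change of derivative from \<open>x\<close> to \<open>u\<close>, the tilt by the gradient at
    \<open>z\<close>, and the gradient of the proximity term at \<open>u\<close>.\<close>
  define \<kappa>' where "\<kappa>' = inverse t + L * (C + 1) * M' + 2 * \<rho>1 * B * C + 2 * C"
  have \<kappa>': "inverse t \<le> \<kappa>'" "\<kappa>' > 0"
  proof -
    have "L * (C + 1) * M' \<ge> 0" "2 * \<rho>1 * B * C \<ge> 0" using L C M' \<rho>1 B by auto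
    then show "inverse t \<le> \<kappa>'" "\<kappa>' > 0" using t C(1) positive_imp_inverse_positive[OF t] unfolding \<kappa>'_def by linarith+
  qed
  define \<rho>' where "\<rho>' = min \<delta> \<eta>1 / 2"
  have \<rho>': "\<rho>' > 0" "\<rho>' < \<delta>" "\<rho>' < \<eta>1" using \<delta> \<eta>1 by (auto simp: \<rho>'_def)
  \<comment> \<open>Chosen so that \<open>c\<close> maps the ball of radius \<rho> into that of
    radius \<rho>': the pairs \<open>(u', c u')\<close> must be feasible once the penalty is known
    to be exact.\<close>
  define \<rho> where "\<rho> = min (\<rho>0 / 2) (\<rho>' / (B + 1))"
  have \<rho>: "\<rho> > 0" "\<rho> < \<rho>0" "B * \<rho> \<le> \<rho>'"
  proof -
    show "\<rho> > 0" "\<rho> < \<rho>0" using \<rho>0 \<rho>'(1) B by (auto simp: \<rho>_def)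
    have "B * \<rho> \<le> B * (\<rho>' / (B + 1))" using B by (intro mult_left_mono) (auto simp: \<rho>_def)
    also have "\<dots> \<le> \<rho>'" using B \<rho>' by (simp add: field_simps)
    finally show "B * \<rho> \<le> \<rho>'" .
  qed
  define big where "big = 1 + 3 * B + 2 * C + 2 * \<kappa>' + 4 * \<rho>1 * C + 2 * (M' * C + K * L)"
  have parts: "0 \<le> B" "0 \<le> C" "0 \<le> \<kappa>'" "0 \<le> \<rho>1 * C" "0 \<le> M' * C" "0 \<le> K * L"
    using B C \<kappa>' \<rho>1 M' K L by auto
  \<comment> \<open>The entry 1 yields \<open>d\<^sup>2 \<le> d\<close>, and a tilt
    \<open>(2 * \<rho>1) *\<^sub>R (z - z0)\<close> of norm below 1.\<close>
  define m where "m = min (min \<rho> \<rho>') (min \<delta> (min 1 \<eta>1))"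
  have m: "m > 0" "m \<le> \<rho>" "m \<le> \<rho>'" "m \<le> \<delta>" "m \<le> 1" "m \<le> \<eta>1"
    using \<rho> \<rho>' \<delta> \<eta>1 by (auto simp: m_def)
  have "m / 2 > 0" "big \<ge> 0" using m(1) parts by (auto simp: big_def)
  then obtain \<eta> where \<eta>: "\<eta> > 0" and \<eta>_less: "\<And>a. a \<le> big \<Longrightarrow> a * \<eta> < m / 2"
    using small_multiple_exists by metis
  have \<eta>s: "1 * \<eta> < m / 2" "(1 + 2 * C) * \<eta> < m / 2" "(3 * B + 2 * C) * \<eta> < m / 2" "2 * \<kappa>' * \<eta> < m / 2"
      "4 * \<rho>1 * C * \<eta> < m / 2" "2 * (M' * C + K * L) * \<eta> < m / 2"
    using parts by (intro \<eta>_less; simp add: big_def)+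
  show ?thesis
  proof
    show "\<eta> > 0" by fact
    show "\<kappa>' + C + 1 > 0" using \<kappa>' C by linarith
    fix x y
    assume x: "dist x xbar < \<eta>" and y: "dist y xbar < \<eta>" and S: "y \<in> prox_map c Dc h t x"
      and attxy: "\<bar>linearization c Dc h x y - h (c xbar)\<bar> < \<epsilon> / 2"
    define d where "d = norm (x - y)"
    define z0 where "z0 = lin_map x y"
    have d: "0 \<le> d" "d < 2 * \<eta>" "d \<le> 1"
      using dist_triangle2[of x y xbar] x y \<eta>s(1) m(5) by (auto simp: d_def dist_norm norm_minus_commute)
    have d2: "d\<^sup>2 \<le> d" using d by (simp add: power2_eq_square mult_left_le)
    have scale: "a * d \<le> 2 * a * \<eta>" if "a \<ge> 0" for a
      using mult_left_mono[OF less_imp_le[OF d(2)] that] by simp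
    have x0: "dist x xbar < \<rho>0" and y0: "dist y xbar < \<rho>0" and xx: "dist xbar xbar < \<rho>0"
      using x y \<eta>s(1) m(2) \<rho> \<rho>0 m(1) by auto
    have z0c: "norm (z0 - c y) \<le> L * d\<^sup>2"
      using b4[OF x0 y0] by (simp add: z0_def lin_map_def d_def norm_minus_commute algebra_simps)
    have z0x: "dist z0 (c xbar) \<le> 3 * B * \<eta>"
    proof -
      have "norm (blinfun_apply (Dc x) (y - x)) \<le> norm (Dc x) * norm (y - x)" by (rule norm_blinfun)
      also have "\<dots> \<le> B * d" using b2[OF x0] by (simp add: d_def norm_minus_commute mult_right_mono)
      also have "\<dots> \<le> 2 * B * \<eta>" using B by (intro scale) auto
      finally have "dist z0 (c x) \<le> 2 * B * \<eta>" by (simp add: z0_def lin_map_def dist_norm)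
      moreover have "dist (c x) (c xbar) \<le> B * \<eta>"
      proof -
        have "dist (c x) (c xbar) \<le> B * dist x xbar" using b5[OF xx x0] by (simp add: dist_norm)
        also have "\<dots> \<le> B * \<eta>" using x B by (intro mult_left_mono) auto
        finally show ?thesis .
      qed
      ultimately show ?thesis using dist_triangle[of z0 "c xbar" "c x"] by linarith
    qed
    have z0\<delta>: "dist z0 (c xbar) < \<delta>" "dist z0 (c xbar) \<le> \<rho>'"
    proof -
      have "C * \<eta> \<ge> 0" using parts \<eta> by simp
      then have "3 * B * \<eta> < m / 2" using \<eta>s(3) by (simp add: algebra_simps)
      then show "dist z0 (c xbar) < \<delta>" "dist z0 (c xbar) \<le> \<rho>'" using z0x m(1,3,4) by linarith+
    qed
    have tsmall: "norm (inverse t *\<^sub>R (x - y)) \<le> inverse t * d" "inverse t * d < \<delta>"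
    proof -
      show "norm (inverse t *\<^sub>R (x - y)) \<le> inverse t * d" using t by (simp add: d_def)
      have "inverse t * d \<le> \<kappa>' * d" using \<kappa>' d by (intro mult_right_mono) auto
      also have "\<dots> \<le> 2 * \<kappa>' * \<eta>" using \<kappa>' by (intro scale) auto
      finally show "inverse t * d < \<delta>" using \<eta>s(4) m(1,4) by linarith
    qed
    obtain w where w: "adjoint (blinfun_apply (Dc x)) w = inverse t *\<^sub>R (x - y)" "norm w \<le> M"
      and hw: "\<And>z'. dist z' (c xbar) < \<delta> \<Longrightarrow>
       h z' \<ge> h z0 + ereal (w \<bullet> (z' - z0) - r / 2 * (norm (z' - z0))\<^sup>2)"
      using prox_map_multiplier[OF t S order.strict_trans1[OF tsmall] z0\<delta>(1)[unfolded z0_def] half_ereal_le[OF attxy] b1[OF x0]]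
      unfolding z0_def by metis
    have wM: "norm w \<le> M'" using w(2) M'(2) by linarith
    have att0: "\<bar>h z0 - h (c xbar)\<bar> < \<epsilon> / 2" using attxy by (simp add: linearization_eq z0_def)
    obtain a where a: "h z0 = ereal a"
    proof -
      have "\<bar>h z0\<bar> \<noteq> \<infinity>"
        using S by (cases "h z0") (auto simp: prox_map_def stationary_def limiting_subdiff_def prox_linearization_def linearization_eq z0_def)
      then show ?thesis using that by auto
    qed
    let ?S = "cball xbar \<rho> \<times> cball (c xbar) \<rho>'"
    \<comment> \<open>The penalty norm is not squared, which is what permits exactness at finite
      \<open>K\<close>. The factor 1 and the zero term anticipate
      \<open>penalty_optimality\<close>.\<close>
    define q where "q p = \<rho>1 * (norm (snd p - z0))\<^sup>2 - w \<bullet> snd p + 1 * (norm (fst p - y))\<^sup>2 - 0 \<bullet> fst p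
        + K * norm (snd p - c (fst p))" for p
    have contc: "continuous_on UNIV c"
      by (intro continuous_at_imp_continuous_on ballI has_derivative_continuous[OF c_deriv])
    have "continuous_on UNIV q"
      unfolding q_def by (intro continuous_intros continuous_on_compose2[OF contc]) auto
    moreover have "compact ?S" by (intro compact_Times compact_cball)
    moreover have y\<rho>: "(y, z0) \<in> ?S"
      using y \<eta>s(1) m(1,2) z0\<delta>(2) by (auto simp: dist_commute)
    ultimately obtain u z where uz: "(u, z) \<in> ?S"
      and mn: "\<And>u' z'. (u', z') \<in> ?S \<Longrightarrow> h z + ereal (q (u, z)) \<le> h z' + ereal (q (u', z'))"
      using penalized_min_exists[OF h_closed, of q ?S] by blast
    have z\<rho>: "dist z (c xbar) \<le> \<rho>'" and u\<rho>: "dist u xbar \<le> \<rho>" using uz by (auto simp: dist_commute)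
    have z\<delta>: "dist z (c xbar) < \<delta>" using z\<rho> \<rho>' by linarith
    have u0: "dist u xbar < \<rho>0" using u\<rho> \<rho> by linarith
    have ub: "h z + ereal (q (u, z)) \<le> ereal (a + q (y, z0))" using mn[OF y\<rho>] a by simp
    have lb: "ereal (a + (w \<bullet> (z - z0) - r / 2 * (norm (z - z0))\<^sup>2)) \<le> h z" using hw[OF z\<delta>] a by simp
    obtain b where b: "h z = ereal b" using ub lb by (cases "h z") auto
    \<comment> \<open>Compare the minimiser with \<open>(y, z0)\<close>, whose penalty is at most
      \<open>K * L * d\<^sup>2\<close>; the proximal inequality at \<open>z0\<close> absorbs
      \<open>h z - w \<bullet> z\<close> and the share \<open>r / 2\<close> of the
      quadratic.\<close>
    have gap: "(norm (z - z0))\<^sup>2 + (norm (u - y))\<^sup>2 + K * norm (z - c u) \<le> K * (L * d\<^sup>2)"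
      "b \<le> a + (w \<bullet> (z - z0) + K * (L * d\<^sup>2))"
    proof -
      have "K * norm (z0 - c y) \<le> K * (L * d\<^sup>2)" using z0c K by (intro mult_left_mono) auto
      moreover have "b + (\<rho>1 * (norm (z - z0))\<^sup>2 - w \<bullet> z + (norm (u - y))\<^sup>2 + K * norm (z - c u)) \<le>
          a + (- (w \<bullet> z0) + K * norm (z0 - c y))"
        using ub b by (simp add: q_def)
      moreover have "a + (w \<bullet> z - w \<bullet> z0 - r / 2 * (norm (z - z0))\<^sup>2) \<le> b"
        using lb b by (simp add: inner_diff_right)
      moreover have "\<rho>1 * (norm (z - z0))\<^sup>2 = r / 2 * (norm (z - z0))\<^sup>2 + (norm (z - z0))\<^sup>2"
        by (simp add: \<rho>1_def algebra_simps)
      moreover have "r / 2 * (norm (z - z0))\<^sup>2 \<ge> 0" "(norm (z - z0))\<^sup>2 \<ge> 0" "(norm (u - y))\<^sup>2 \<ge> 0" "K * norm (z - c u) \<ge> 0"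
        using r K by auto
      ultimately show "(norm (z - z0))\<^sup>2 + (norm (u - y))\<^sup>2 + K * norm (z - c u) \<le> K * (L * d\<^sup>2)"
          "b \<le> a + (w \<bullet> (z - z0) + K * (L * d\<^sup>2))" unfolding inner_diff_right by linarith+
    qed
    have close: "norm (z - z0) \<le> C * d" "norm (u - y) \<le> C * d"
    proof -
      have "K * (L * d\<^sup>2) \<le> (C * d)\<^sup>2"
        using mult_right_mono[OF C(2), of "d\<^sup>2"] by (simp add: power_mult_distrib mult_ac)
      moreover have "(norm (z - z0))\<^sup>2 \<ge> 0" "(norm (u - y))\<^sup>2 \<ge> 0" "K * norm (z - c u) \<ge> 0"
        using K by auto
      ultimately have "(norm (z - z0))\<^sup>2 \<le> (C * d)\<^sup>2" "(norm (u - y))\<^sup>2 \<le> (C * d)\<^sup>2" using gap(1) by linarith+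
      then show "norm (z - z0) \<le> C * d" "norm (u - y) \<le> C * d"
        using parts d by (auto intro: power2_le_imp_le)
    qed
    have Cd: "C * d \<le> 2 * C * \<eta>" using parts by (intro scale) auto
    have interior: "dist u xbar < \<rho>" "dist z (c xbar) < \<rho>'"
    proof -
      have "dist u xbar \<le> norm (u - y) + dist y xbar" using dist_triangle[of u xbar y] by (simp add: dist_norm)
      then have "dist u xbar < (1 + 2 * C) * \<eta>" using close Cd y by (simp add: algebra_simps)
      then show "dist u xbar < \<rho>" using \<eta>s(2) m(1,2) by linarith
      have "dist z (c xbar) \<le> norm (z - z0) + dist z0 (c xbar)" using dist_triangle[of z "c xbar" z0] by (simp add: dist_norm)
      then have "dist z (c xbar) \<le> (3 * B + 2 * C) * \<eta>" using close Cd z0x by (simp add: algebra_simps)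
      then show "dist z (c xbar) < \<rho>'" using \<eta>s(3) m(1,3) by linarith
    qed
    \<comment> \<open>By \<open>gap\<close>, the value \<open>h z\<close> exceeds
      \<open>h z0\<close> by an amount linear in \<open>d\<close>, small enough to keep
      attentiveness.\<close>
    have attz: "\<bar>h z - h (c xbar)\<bar> < \<epsilon>"
    proof (rule att[OF _ att0])
      show "dist z (c xbar) < \<eta>1" using z\<rho> \<rho>'(3) by linarith
      show "h z \<le> h z0 + ereal (w \<bullet> (z - z0) + K * (L * d\<^sup>2))" using gap(2) a b by simp
      have "w \<bullet> (z - z0) \<le> norm w * norm (z - z0)" by (rule norm_cauchy_schwarz)
      also have "\<dots> \<le> M' * (C * d)" using wM close M' by (intro mult_mono) auto
      finally have "w \<bullet> (z - z0) \<le> M' * C * d" by simp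
      moreover have "K * (L * d\<^sup>2) \<le> K * L * d" using mult_left_mono[OF d2, of "K * L"] parts by (simp add: mult_ac)
      ultimately have "w \<bullet> (z - z0) + K * (L * d\<^sup>2) \<le> (M' * C + K * L) * d" by (simp add: algebra_simps)
      also have "\<dots> \<le> 2 * (M' * C + K * L) * \<eta>" using parts by (intro scale) auto
      finally show "w \<bullet> (z - z0) + K * (L * d\<^sup>2) \<le> \<eta>1" using \<eta>s(6) m(1,6) by linarith
    qed
    have xu: "norm (x - u) \<le> (C + 1) * d"
      using close(2) norm_triangle_ineq[of "x - y" "y - u"] by (simp add: d_def norm_minus_commute algebra_simps)
    define wt where "wt = w - (2 * \<rho>1) *\<^sub>R (z - z0)"
    have vbound: "norm (adjoint (blinfun_apply (Dc u)) wt - (2 * 1) *\<^sub>R (u - y)) \<le> \<kappa>' * d"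
    proof -
      let ?A = "\<lambda>x. adjoint (blinfun_apply (Dc x))"
      have eq: "?A u wt - (2 * 1) *\<^sub>R (u - y) =
          ?A x w + (?A u w - ?A x w) - (2 * \<rho>1) *\<^sub>R ?A u (z - z0) - (2 * 1) *\<^sub>R (u - y)"
        by (simp add: wt_def linear_diff[OF linear_adjoint_blinfun] linear_scale[OF linear_adjoint_blinfun])
      have "norm (?A u w - ?A x w) \<le> norm (Dc u - Dc x) * norm w" by (rule adjoint_diff_norm_le)
      also have "\<dots> \<le> (L * ((C + 1) * d)) * M'"
      proof (rule mult_mono)
        have "norm (Dc u - Dc x) \<le> L * norm (u - x)" by (rule b3[OF x0 u0])
        also have "\<dots> \<le> L * ((C + 1) * d)" using xu L by (intro mult_left_mono) (auto simp: norm_minus_commute)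
        finally show "norm (Dc u - Dc x) \<le> L * ((C + 1) * d)" .
      qed (use wM L parts d in auto)
      finally have 1: "norm (?A u w - ?A x w) \<le> L * (C + 1) * M' * d" by (simp add: mult_ac)
      have "norm (?A u (z - z0)) \<le> norm (Dc u) * norm (z - z0)" by (rule adjoint_norm_le)
      also have "\<dots> \<le> B * (C * d)" using b2[OF u0] close B by (intro mult_mono) auto
      finally have "norm ((2 * \<rho>1) *\<^sub>R ?A u (z - z0)) \<le> 2 * \<rho>1 * (B * (C * d))"
        using \<rho>1 by simp
      then have 2: "norm ((2 * \<rho>1) *\<^sub>R ?A u (z - z0)) \<le> 2 * \<rho>1 * B * C * d" by (simp add: mult_ac)
      have 3: "norm ((2 * 1) *\<^sub>R (u - y)) \<le> 2 * C * d" using close by simp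
      have 4: "norm (?A x w) \<le> inverse t * d" unfolding w(1) by (rule tsmall(1))
      have "norm (?A x w + (?A u w - ?A x w) - (2 * \<rho>1) *\<^sub>R ?A u (z - z0) - (2 * 1) *\<^sub>R (u - y)) \<le>
          norm (?A x w) + norm (?A u w - ?A x w) + norm ((2 * \<rho>1) *\<^sub>R ?A u (z - z0)) + norm ((2 * 1) *\<^sub>R (u - y))"
        by (intro norm_triangle_le_diff add_mono norm_triangle_ineq order_refl)
      also have "\<dots> \<le> \<kappa>' * d" using 1 2 3 4 unfolding \<kappa>'_def distrib_right by linarith
      finally show ?thesis unfolding eq .
    qed
    have v\<delta>: "norm (adjoint (blinfun_apply (Dc u)) wt - (2 * 1) *\<^sub>R (u - y)) < \<delta>"
    proof -
      have "\<kappa>' * d \<le> 2 * \<kappa>' * \<eta>" using \<kappa>' by (intro scale) auto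
      then show ?thesis using vbound \<eta>s(4) m(1,4) by linarith
    qed
    \<comment> \<open>With a positive gap the penalty becomes differentiable after quadratic
      majorisation, and its multiplier has norm exactly \<open>K\<close>. By
      \<open>v\<delta>\<close> the subgradient \<open>wh\<close> falls under the control hypothesis,
      so all other parts of the multiplier equation are too short to balance
      \<open>K\<close>.\<close>
    have zc: "z = c u"
    proof (rule ccontr)
      assume ne: "z \<noteq> c u"
      define D where "D = norm (z - c u)"
      have D: "D > 0" using ne by (simp add: D_def)
      have hzfin: "\<bar>h z\<bar> \<noteq> \<infinity>" using b by simp
      have opt: "h z + ereal (\<rho>1 * (norm (z - z0))\<^sup>2 - w \<bullet> z + 1 * (norm (u - y))\<^sup>2 - 0 \<bullet> u + K / (2 * D) * (norm (z - c u))\<^sup>2) \<le>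
         h z' + ereal (\<rho>1 * (norm (z' - z0))\<^sup>2 - w \<bullet> z' + 1 * (norm (u' - y))\<^sup>2 - 0 \<bullet> u' + K / (2 * D) * (norm (z' - c u'))\<^sup>2)"
        if "u' \<in> ball xbar \<rho>" "z' \<in> ball (c xbar) \<rho>'" for u' z'
      proof (rule ereal_add_le_shift[OF mn[of u' z']])
        show "(u', z') \<in> ?S" using that by auto
        let ?N = "norm (z' - c u')"
        \<comment> \<open>AM-GM: the quadratic \<open>K N\<^sup>2 / (2 D) + K D / 2\<close> touches \<open>K N\<close> from above at \<open>N = D\<close>.\<close>
        have "0 \<le> K / (2 * D) * (?N - D)\<^sup>2" using K D by simp
        also have "\<dots> = K / (2 * D) * ?N\<^sup>2 - K * ?N + K * D / 2"
          using D by (simp add: power2_eq_square field_simps)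
        finally have "K * ?N \<le> K / (2 * D) * ?N\<^sup>2 + K * D / 2" by linarith
        moreover have "K / (2 * D) * D\<^sup>2 = K * D / 2" using D by (simp add: power2_eq_square)
        ultimately show "\<rho>1 * (norm (z - z0))\<^sup>2 - w \<bullet> z + 1 * (norm (u - y))\<^sup>2 - 0 \<bullet> u + K / (2 * D) * (norm (z - c u))\<^sup>2
            + q (u', z') \<le> q (u, z) + (\<rho>1 * (norm (z' - z0))\<^sup>2 - w \<bullet> z' + 1 * (norm (u' - y))\<^sup>2 - 0 \<bullet> u' + K / (2 * D) * (norm (z' - c u'))\<^sup>2)"
          unfolding q_def fst_conv snd_conv D_def[symmetric] by linarith
      qed
      have ub: "u \<in> ball xbar \<rho>" and zb: "z \<in> ball (c xbar) \<rho>'" using interior by (auto simp: dist_commute)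
      have K2D: "0 \<le> K / (2 * D)" "0 \<le> \<rho>1" using K D \<rho>1 by auto
      define wh where "wh = w - (2 * \<rho>1) *\<^sub>R (z - z0) - (2 * (K / (2 * D))) *\<^sub>R (z - c u)"
      have sub: "wh \<in> proximal_subdiff h z"
        by (rule penalty_optimality(1)[OF hzfin c_deriv open_ball ub open_ball zb opt K2D(2,1) wh_def])
      have "adjoint (blinfun_apply (Dc u)) ((2 * (K / (2 * D))) *\<^sub>R (z - c u)) = (2 * 1) *\<^sub>R (u - y) - 0"
        by (rule penalty_optimality(2)[OF hzfin c_deriv open_ball ub open_ball zb opt K2D(2,1) wh_def])
      then have "adjoint (blinfun_apply (Dc u)) wh = adjoint (blinfun_apply (Dc u)) wt - (2 * 1) *\<^sub>R (u - y)"
        by (simp add: wh_def wt_def linear_diff[OF linear_adjoint_blinfun])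
      then have "norm (adjoint (blinfun_apply (Dc u)) wh) < \<delta>" using v\<delta> by simp
      then have "norm wh \<le> M"
        using control z\<delta> attz sub proximal_subset_limiting b1[OF u0] unfolding subgradient_control_def by blast
      moreover have "norm ((2 * (K / (2 * D))) *\<^sub>R (z - c u)) = K" using D K by (simp add: D_def)
      moreover have "norm ((2 * \<rho>1) *\<^sub>R (z - z0)) < 1"
      proof -
        have "norm ((2 * \<rho>1) *\<^sub>R (z - z0)) = 2 * \<rho>1 * norm (z - z0)" using \<rho>1 by simp
        also have "\<dots> \<le> 2 * \<rho>1 * (2 * C * \<eta>)" using close Cd \<rho>1 by (intro mult_left_mono) auto
        also have "\<dots> < 1" using \<eta>s(5) m(1,5) by (simp add: mult_ac)
        finally show ?thesis .
      qed
      moreover have "norm ((2 * (K / (2 * D))) *\<^sub>R (z - c u)) \<le> norm w + norm ((2 * \<rho>1) *\<^sub>R (z - z0)) + norm wh"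
      proof -
        have "(2 * (K / (2 * D))) *\<^sub>R (z - c u) = w - (2 * \<rho>1) *\<^sub>R (z - z0) - wh" by (simp add: wh_def)
        then show ?thesis by (metis add_mono norm_triangle_ineq4 norm_triangle_le_diff order_refl)
      qed
      ultimately show False using wM M' by (simp add: K_def)
    qed
    \<comment> \<open>Along the pairs \<open>(u', c u')\<close> the penalty vanishes, so minimality
      becomes an inequality for \<open>h \<circ> c\<close>; \<open>s\<close> and \<open>s'\<close>
      are the coefficients of the two remaining quadratics.\<close>
    have "adjoint (blinfun_apply (Dc u)) wt + - (2 * 1) *\<^sub>R (u - y) \<in> proximal_subdiff (h \<circ> c) u"
    proof (rule proximal_subdiff_pullback[where L = L and B = B and s = \<rho>1 and s' = 1])
      show "\<bar>h (c u)\<bar> \<noteq> \<infinity>" using b zc by simp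
      show "open (ball xbar \<rho>)" "u \<in> ball xbar \<rho>" using interior by (auto simp: dist_commute)
      fix u' assume u': "u' \<in> ball xbar \<rho>"
      then have u'0: "dist u' xbar < \<rho>0" using \<rho> by (simp add: dist_commute)
      show "norm (c u' - c u - blinfun_apply (Dc u) (u' - u)) \<le> L * (norm (u' - u))\<^sup>2"
        "norm (c u' - c u) \<le> B * norm (u' - u)" using b4[OF u0 u'0] b5[OF u0 u'0] by auto
      have "dist (c u') (c xbar) \<le> B * dist u' xbar" using b5[OF xx u'0] by (simp add: dist_norm)
      also have "\<dots> \<le> B * \<rho>" using u' B by (intro mult_left_mono) (auto simp: dist_commute)
      also have "\<dots> \<le> \<rho>'" by (rule \<rho>(3))
      finally have "(u', c u') \<in> ?S" using u' by (auto simp: dist_commute)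
      from mn[OF this] have "h (c u) + ereal (q (u, c u)) \<le> h (c u') + ereal (q (u', c u'))" unfolding zc .
      then have "h (c u) + ereal (wt \<bullet> (c u' - c u) + (- (2 * 1) *\<^sub>R (u - y)) \<bullet> (u' - u)
          - \<rho>1 * (norm (c u' - c u))\<^sup>2 - 1 * (norm (u' - u))\<^sup>2) \<le> h (c u') + ereal 0"
      proof (rule ereal_add_le_shift)
        have "q (u', c u') = \<rho>1 * ((norm (c u - z0))\<^sup>2 + 2 * ((c u - z0) \<bullet> (c u' - c u)) + (norm (c u' - c u))\<^sup>2)
            - w \<bullet> c u' + ((norm (u - y))\<^sup>2 + 2 * ((u - y) \<bullet> (u' - u)) + (norm (u' - u))\<^sup>2)"
          unfolding norm_diff_sq_expand[symmetric] by (simp add: q_def)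
        moreover have "q (u, c u) = \<rho>1 * (norm (c u - z0))\<^sup>2 - w \<bullet> c u + (norm (u - y))\<^sup>2"
          by (simp add: q_def)
        moreover have "wt \<bullet> (c u' - c u) = w \<bullet> c u' - w \<bullet> c u - 2 * \<rho>1 * ((c u - z0) \<bullet> (c u' - c u))"
          by (simp add: wt_def zc inner_diff_left[of w] inner_diff_right[of w])
        moreover have "(- (2 * 1) *\<^sub>R (u - y)) \<bullet> (u' - u) = - 2 * ((u - y) \<bullet> (u' - u))" by simp
        ultimately show "wt \<bullet> (c u' - c u) + (- (2 * 1) *\<^sub>R (u - y)) \<bullet> (u' - u)
          - \<rho>1 * (norm (c u' - c u))\<^sup>2 - 1 * (norm (u' - u))\<^sup>2 + q (u', c u') \<le> q (u, c u) + 0"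
          by (simp add: distrib_left)
      qed
      then show "h (c u) + ereal (wt \<bullet> (c u' - c u) + (- (2 * 1) *\<^sub>R (u - y)) \<bullet> (u' - u)
          - \<rho>1 * (norm (c u' - c u))\<^sup>2 - 1 * (norm (u' - u))\<^sup>2) \<le> h (c u')" by (simp flip: zero_ereal_def)
    qed (use L B \<rho>1 in auto)
    then have "adjoint (blinfun_apply (Dc u)) wt - (2 * 1) *\<^sub>R (u - y) \<in> limiting_subdiff (h \<circ> c) u"
      using proximal_subset_limiting by auto
    moreover have "norm (x - u) \<le> (\<kappa>' + C + 1) * d"
    proof -
      have "0 \<le> \<kappa>' * d" using \<kappa>' d by simp
      then show ?thesis using xu by (simp add: algebra_simps)
    qed
    moreover have "norm (adjoint (blinfun_apply (Dc u)) wt - (2 * 1) *\<^sub>R (u - y)) \<le> (\<kappa>' + C + 1) * d"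
    proof -
      have "0 \<le> C * d" using parts d by simp
      then show ?thesis using vbound d(1) by (simp add: algebra_simps)
    qed
    ultimately show "\<exists>u. \<exists>v \<in> limiting_subdiff (h \<circ> c) u. norm (x - u) \<le> (\<kappa>' + C + 1) * norm (x - y) \<and>
         norm v \<le> (\<kappa>' + C + 1) * norm (x - y) \<and> \<bar>h (c u) - h (c xbar)\<bar> < \<epsilon>"
      using attz zc unfolding d_def[symmetric] by blast
  qed
qed

end

subsection \<open>Error bounds and metric subregularity\<close>

lemma set_edist_le_dist: "s \<in> S \<Longrightarrow> set_edist x S \<le> ereal (dist x s)"
  unfolding set_edist_def by (rule INF_lower)

lemma set_edist_mem: "x \<in> S \<Longrightarrow> k \<ge> 0 \<Longrightarrow> set_edist x S \<le> ereal k"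
  using set_edist_le_dist[of x S x] by (auto intro: order_trans)

lemma set_edist_antimono: "S \<subseteq> S' \<Longrightarrow> set_edist x S' \<le> set_edist x S"
  unfolding set_edist_def by (rule INF_superset_mono) auto

lemma set_edist_triangle:
  assumes "set_edist u S \<le> ereal k"
  shows "set_edist x S \<le> ereal (dist x u + k)"
proof (rule ereal_le_epsilon2)
  fix e :: real assume "e > 0"
  then have "set_edist u S < ereal (k + e)" using assms by (simp add: order_le_less_trans)
  then obtain s where s: "s \<in> S" "dist u s < k + e" unfolding set_edist_def by (auto simp: INF_less_iff)
  have "set_edist x S \<le> ereal (dist x s)" using s(1) by (rule set_edist_le_dist)
  also have "\<dots> \<le> ereal (dist x u + k) + ereal e" using s(2) dist_triangle[of x s u] by simp
  finally show "set_edist x S \<le> ereal (dist x u + k) + ereal e" .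
qed

text \<open>A point of \<open>S\<close> at distance at least \<rho> from \<open>y\<close> is farther
  from \<open>x\<close> than \<open>y\<close> is, so it cannot improve on \<open>y\<close>. Hence
  solution sets need to be compared only near the reference point.\<close>

lemma set_edist_localize:
  assumes "\<And>s. s \<in> S \<Longrightarrow> dist s y < \<rho> \<Longrightarrow> s \<in> S'" "y \<in> S'" "dist x y < \<rho> / 2"
  shows "set_edist x S' \<le> set_edist x S"
  unfolding set_edist_def[of x S]
proof (rule INF_greatest)
  fix s assume "s \<in> S"
  show "set_edist x S' \<le> ereal (dist x s)"
  proof (cases "dist s y < \<rho>")
    case True
    then show ?thesis using assms(1)[OF \<open>s \<in> S\<close>] set_edist_le_dist by blast
  next
    case False
    then have "dist x y \<le> dist x s" using assms(3) dist_triangle[of s y x] by (simp add: dist_commute)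
    then show ?thesis using set_edist_le_dist[OF assms(2), of x] by (meson ereal_less_eq(3) order_trans)
  qed
qed

text \<open>Dividing by \<open>l\<close> moves the bound inside the infimum over \<open>F x\<close>.
  An empty \<open>F x\<close> is at distance \<infinity> and imposes nothing, in agreement with the
  vacuous quantifier.\<close>

lemma metrically_subregular_at_0_iff:
  fixes F :: "'a::euclidean_space \<Rightarrow> 'a set"
  shows "metrically_subregular F xbar 0 \<longleftrightarrow> 0 \<in> F xbar \<and>
    (\<exists>l>0. \<exists>\<eta>>0. \<forall>x w. dist x xbar < \<eta> \<longrightarrow> w \<in> F x \<longrightarrow> set_edist x {z. 0 \<in> F z} \<le> ereal (l * norm w))"
proof -
  have *: "X \<le> ereal l * set_edist 0 S \<longleftrightarrow> (\<forall>w\<in>S. X \<le> ereal (l * norm w))" if "l > 0" for X l and S :: "'a set"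
  proof -
    have "X \<le> ereal l * set_edist 0 S \<longleftrightarrow> X / ereal l \<le> set_edist 0 S"
      using that by (simp add: ereal_divide_le_pos)
    also have "\<dots> \<longleftrightarrow> (\<forall>w\<in>S. X / ereal l \<le> ereal (norm w))"
      by (simp add: set_edist_def le_INF_iff)
    also have "\<dots> \<longleftrightarrow> (\<forall>w\<in>S. X \<le> ereal (l * norm w))" using that by (simp add: ereal_divide_le_pos)
    finally show ?thesis .
  qed
  show ?thesis
  proof
    assume "metrically_subregular F xbar 0"
    then obtain l X where "0 \<in> F xbar" and lX: "l > 0" "open X" "xbar \<in> X"
      "\<And>x. x \<in> X \<Longrightarrow> set_edist x {z. 0 \<in> F z} \<le> ereal l * set_edist 0 (F x)"
      unfolding metrically_subregular_def by blast
    obtain \<eta> where "\<eta> > 0" "ball xbar \<eta> \<subseteq> X" using lX open_contains_ball by blast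
    then have "\<forall>x w. dist x xbar < \<eta> \<longrightarrow> w \<in> F x \<longrightarrow> set_edist x {z. 0 \<in> F z} \<le> ereal (l * norm w)"
      using lX(4) *[OF lX(1)] by (auto simp: dist_commute subset_iff)
    then show "0 \<in> F xbar \<and> (\<exists>l>0. \<exists>\<eta>>0. \<forall>x w. dist x xbar < \<eta> \<longrightarrow> w \<in> F x \<longrightarrow>
        set_edist x {z. 0 \<in> F z} \<le> ereal (l * norm w))"
      using lX(1) \<open>\<eta> > 0\<close> \<open>0 \<in> F xbar\<close> by blast
  next
    assume "0 \<in> F xbar \<and> (\<exists>l>0. \<exists>\<eta>>0. \<forall>x w. dist x xbar < \<eta> \<longrightarrow> w \<in> F x \<longrightarrow>
        set_edist x {z. 0 \<in> F z} \<le> ereal (l * norm w))"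
    then obtain l \<eta> where "0 \<in> F xbar" and l: "l > 0" "\<eta> > 0"
      "\<And>x w. dist x xbar < \<eta> \<Longrightarrow> w \<in> F x \<Longrightarrow> set_edist x {z. 0 \<in> F z} \<le> ereal (l * norm w)" by blast
    show "metrically_subregular F xbar 0"
      unfolding metrically_subregular_def
    proof (intro conjI exI[of _ l] exI[of _ "ball xbar \<eta>"] ballI)
      fix x assume "x \<in> ball xbar \<eta>"
      then show "set_edist x {z. 0 \<in> F z} \<le> ereal l * set_edist 0 (F x)"
        using l *[OF l(1)] by (simp add: dist_commute)
    qed (use l \<open>0 \<in> F xbar\<close> in auto)
  qed
qed

lemma metrically_subregular_at_0I:
  fixes F :: "'a::euclidean_space \<Rightarrow> 'a set"
  assumes "0 \<in> F xbar" "l > 0" "\<eta> > 0"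
    "\<And>x w. dist x xbar < \<eta> \<Longrightarrow> w \<in> F x \<Longrightarrow> set_edist x {z. 0 \<in> F z} \<le> ereal (l * norm w)"
  shows "metrically_subregular F xbar 0"
  using assms unfolding metrically_subregular_at_0_iff by blast

lemma zero_in_scaled_residual_iff: "t > 0 \<Longrightarrow> 0 \<in> scaled_residual t S z \<longleftrightarrow> z \<in> S z"
  unfolding scaled_residual_def by auto

context composite begin

text \<open>In the next two definitions \<open>N\<close> is a set of points at which a localization may be chosen
  freely: the non-attentive points in general, and \<open>{}\<close> for convex \<open>h\<close>.\<close>

definition subdiff_error_bound :: "ereal \<Rightarrow> 'a set \<Rightarrow> bool" where
  "subdiff_error_bound \<epsilon> N \<longleftrightarrow> (\<exists>l>0. \<exists>\<eta>>0. \<forall>x v. dist x xbar < \<eta> \<longrightarrow> v \<in> limiting_subdiff (h \<circ> c) x \<longrightarrow>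
     \<bar>h (c x) - h (c xbar)\<bar> < \<epsilon> \<longrightarrow>
     set_edist x (N \<union> {z. 0 \<in> limiting_subdiff (h \<circ> c) z}) \<le> ereal (l * norm v))"

definition prox_error_bound :: "real \<Rightarrow> ereal \<Rightarrow> 'a set \<Rightarrow> bool" where
  "prox_error_bound t \<epsilon> N \<longleftrightarrow> (\<exists>l>0. \<exists>\<eta>>0. \<forall>x y. dist x xbar < \<eta> \<longrightarrow> dist y xbar < \<eta> \<longrightarrow>
     y \<in> prox_map c Dc h t x \<longrightarrow> \<bar>linearization c Dc h x y - h (c xbar)\<bar> < \<epsilon> \<longrightarrow>
     set_edist x (N \<union> {z. z \<in> prox_map c Dc h t z}) \<le> ereal (l * norm (x - y)))"

definition nonattentive :: "ereal \<Rightarrow> 'a set" where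
  "nonattentive \<epsilon> = {z. \<not> \<bar>h (c z) - h (c xbar)\<bar> < \<epsilon>}"

lemma nonattentive_antimono: "\<epsilon>' \<le> \<epsilon> \<Longrightarrow> nonattentive \<epsilon> \<subseteq> nonattentive \<epsilon>'"
  by (auto simp: nonattentive_def)

lemma subdiff_error_bound_mono:
  assumes "subdiff_error_bound \<epsilon> N" "\<epsilon>' \<le> \<epsilon>" "N \<subseteq> N'"
  shows "subdiff_error_bound \<epsilon>' N'"
proof -
  have "set_edist x (N' \<union> {z. 0 \<in> limiting_subdiff (h \<circ> c) z}) \<le> set_edist x (N \<union> {z. 0 \<in> limiting_subdiff (h \<circ> c) z})" for x
    using assms(3) by (intro set_edist_antimono) auto
  then show ?thesis using assms(1,2) unfolding subdiff_error_bound_def by (meson order_less_le_trans order_trans)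
qed

lemma prox_error_bound_mono:
  assumes "prox_error_bound t \<epsilon> N" "\<epsilon>' \<le> \<epsilon>" "N \<subseteq> N'"
  shows "prox_error_bound t \<epsilon>' N'"
proof -
  have "set_edist x (N' \<union> {z. z \<in> prox_map c Dc h t z}) \<le> set_edist x (N \<union> {z. z \<in> prox_map c Dc h t z})" for x
    using assms(3) by (intro set_edist_antimono) auto
  then show ?thesis using assms(1,2) unfolding prox_error_bound_def by (meson order_less_le_trans order_trans)
qed

lemma linearization_self [simp]: "linearization c Dc h x x = h (c x)"
  by (simp add: linearization_eq)

section \<open>Subregular localizations and error bounds\<close>

lemma subdiff_localization_imp_error_bound:
  assumes W: "subdiff_localization (h \<circ> c) xbar W" "metrically_subregular W xbar 0"
    and 0: "0 \<in> limiting_subdiff (h \<circ> c) xbar"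
  shows "\<exists>e>0. subdiff_error_bound (ereal e) (nonattentive (ereal e))"
proof -
  obtain X V e where X: "open X" "xbar \<in> X" "open V" "0 \<in> V" "e > 0"
    and XW: "\<And>x v. x \<in> X \<Longrightarrow> v \<in> V \<Longrightarrow> \<bar>h (c x) - h (c xbar)\<bar> < ereal e \<Longrightarrow> v \<in> limiting_subdiff (h \<circ> c) x \<longleftrightarrow> v \<in> W x"
    using W(1) unfolding subdiff_localization_def by auto
  obtain \<rho> where \<rho>: "\<rho> > 0" "ball xbar \<rho> \<subseteq> X" using X open_contains_ball by blast
  obtain \<nu> where \<nu>: "\<nu> > 0" "ball 0 \<nu> \<subseteq> V" using X open_contains_ball by blast
  obtain l \<eta> where l: "l > 0" "\<eta> > 0"
    "\<And>x w. dist x xbar < \<eta> \<Longrightarrow> w \<in> W x \<Longrightarrow> set_edist x {z. 0 \<in> W z} \<le> ereal (l * norm w)"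
    using W(2) unfolding metrically_subregular_at_0_iff by blast
  \<comment> \<open>The entry \<open>\<rho> / 2\<close> is for \<open>set_edist_localize\<close>.
    The entry \<open>l * \<nu>\<close> serves subgradients outside the window of the localization:
    their norm is at least \<nu>, so the distance to \<open>xbar\<close> already satisfies the
    bound.\<close>
  define \<theta> where "\<theta> = min (\<rho> / 2) (min \<eta> (l * \<nu>))"
  have \<theta>: "\<theta> > 0" "\<theta> \<le> \<rho> / 2" "\<theta> \<le> \<eta>" "\<theta> \<le> l * \<nu>" using \<rho> \<nu> l by (auto simp: \<theta>_def)
  let ?Z = "nonattentive (ereal e) \<union> {z. 0 \<in> limiting_subdiff (h \<circ> c) z}"
  have "set_edist x ?Z \<le> ereal (l * norm v)"
    if x: "dist x xbar < \<theta>" and v: "v \<in> limiting_subdiff (h \<circ> c) x" and att: "\<bar>h (c x) - h (c xbar)\<bar> < ereal e" for x v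
  proof (cases "norm v < \<nu>")
    case True
    have "x \<in> X" using x \<theta> \<rho> by (auto simp: dist_commute subset_iff)
    then have "v \<in> W x" using XW[of x v] True \<nu> v att by (auto simp: subset_iff)
    then have "set_edist x {z. 0 \<in> W z} \<le> ereal (l * norm v)" using l(3) x \<theta> by auto
    moreover have "set_edist x ?Z \<le> set_edist x {z. 0 \<in> W z}"
    proof (rule set_edist_localize[where \<rho> = \<rho>])
      fix s assume "s \<in> {z. 0 \<in> W z}" "dist s xbar < \<rho>"
      then show "s \<in> ?Z" using XW[of s 0] \<rho>(2) X(4) by (auto simp: nonattentive_def dist_commute subset_iff)
    qed (use 0 x \<theta> in auto)
    ultimately show ?thesis by (rule order_trans[rotated])
  next
    case False
    have "set_edist x ?Z \<le> ereal (dist x xbar)" using 0 by (intro set_edist_le_dist) auto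
    also have "\<dots> \<le> ereal (l * norm v)"
    proof -
      have "l * \<nu> \<le> l * norm v" using False l(1) by (intro mult_left_mono) auto
      then show ?thesis using x \<theta>(4) by simp
    qed
    finally show ?thesis .
  qed
  then show ?thesis using X(5) l(1) \<theta>(1) unfolding subdiff_error_bound_def by blast
qed

lemma error_bound_imp_subdiff_localization:
  assumes e: "e > 0" and eb: "subdiff_error_bound (ereal e) (nonattentive (ereal e))"
    and 0: "0 \<in> limiting_subdiff (h \<circ> c) xbar"
  shows "\<exists>W. subdiff_localization (h \<circ> c) xbar W \<and> metrically_subregular W xbar 0"
proof -
  \<comment> \<open>At nonattentive points the value \<open>{0}\<close> makes the point a zero of
    \<open>W\<close>: the estimate there is trivial, and the zero set is exactly the enlarged
    one.\<close>
  define W where "W x = (if \<bar>h (c x) - h (c xbar)\<bar> < ereal e then limiting_subdiff (h \<circ> c) x else {0})" for x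
  have Z: "{z. 0 \<in> W z} = nonattentive (ereal e) \<union> {z. 0 \<in> limiting_subdiff (h \<circ> c) z}"
    by (auto simp: W_def nonattentive_def)
  obtain l \<eta> where l: "l > 0" "\<eta> > 0"
    "\<And>x v. dist x xbar < \<eta> \<Longrightarrow> v \<in> limiting_subdiff (h \<circ> c) x \<Longrightarrow> \<bar>h (c x) - h (c xbar)\<bar> < ereal e \<Longrightarrow>
       set_edist x {z. 0 \<in> W z} \<le> ereal (l * norm v)"
    using eb unfolding subdiff_error_bound_def Z by blast
  have "subdiff_localization (h \<circ> c) xbar W"
    unfolding subdiff_localization_def
    by (intro exI[of _ UNIV] exI[of _ e]) (use e in \<open>auto simp: W_def\<close>)
  moreover have "metrically_subregular W xbar 0"
  proof (rule metrically_subregular_at_0I[OF _ l(1,2)])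
    show "0 \<in> W xbar" using 0 Z by auto
    fix x w assume x: "dist x xbar < \<eta>" and w: "w \<in> W x"
    show "set_edist x {z. 0 \<in> W z} \<le> ereal (l * norm w)"
    proof (cases "\<bar>h (c x) - h (c xbar)\<bar> < ereal e")
      case True
      then show ?thesis using l(3) x w by (simp add: W_def)
    next
      case False
      then show ?thesis using l(1) by (intro set_edist_mem) (auto simp: W_def)
    qed
  qed
  ultimately show ?thesis by blast
qed

lemma prox_localization_imp_error_bound:
  assumes t: "t > 0"
    and W: "prox_gradient_localization c Dc h t xbar W" "metrically_subregular W xbar 0"
    and fp: "xbar \<in> prox_map c Dc h t xbar"
  shows "\<exists>e>0. prox_error_bound t (ereal e) (nonattentive (ereal e))"
proof -
  obtain W' where W': "prox_map_localization c Dc h t xbar W'" "W = scaled_residual t W'"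
    using W(1) unfolding prox_gradient_localization_def by blast
  obtain X Y e where X: "open X" "xbar \<in> X" "open Y" "xbar \<in> Y" "e > 0"
    and XY: "\<And>x y. x \<in> X \<Longrightarrow> y \<in> Y \<Longrightarrow> \<bar>linearization c Dc h x y - h (c xbar)\<bar> < ereal e \<Longrightarrow>
      y \<in> prox_map c Dc h t x \<longleftrightarrow> y \<in> W' x"
    using W'(1) unfolding prox_map_localization_def by auto
  have "open (X \<inter> Y)" "xbar \<in> X \<inter> Y" using X by auto
  then obtain \<rho> where \<rho>: "\<rho> > 0" "ball xbar \<rho> \<subseteq> X \<inter> Y" using open_contains_ball by blast
  obtain l \<eta> where l: "l > 0" "\<eta> > 0"
    "\<And>x w. dist x xbar < \<eta> \<Longrightarrow> w \<in> W x \<Longrightarrow> set_edist x {z. 0 \<in> W z} \<le> ereal (l * norm w)"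
    using W(2) unfolding metrically_subregular_at_0_iff by blast
  have Z: "{z. 0 \<in> W z} = {z. z \<in> W' z}" using t by (simp add: W'(2) zero_in_scaled_residual_iff)
  let ?Z = "nonattentive (ereal e) \<union> {z. z \<in> prox_map c Dc h t z}"
  define \<theta> where "\<theta> = min (\<rho> / 2) \<eta>"
  have \<theta>: "\<theta> > 0" "\<theta> \<le> \<rho> / 2" "\<theta> \<le> \<eta>" using \<rho> l by (auto simp: \<theta>_def)
  have "set_edist x ?Z \<le> ereal (l * inverse t * norm (x - y))"
    if x: "dist x xbar < \<theta>" and y: "dist y xbar < \<theta>" "y \<in> prox_map c Dc h t x"
      and att: "\<bar>linearization c Dc h x y - h (c xbar)\<bar> < ereal e" for x y
  proof -
    have "x \<in> X" "y \<in> Y" using x y \<theta> \<rho> by (auto simp: dist_commute subset_iff)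
    then have "y \<in> W' x" using XY y att by blast
    then have "inverse t *\<^sub>R (x - y) \<in> W x" unfolding W'(2) scaled_residual_def by blast
    then have "set_edist x {z. z \<in> W' z} \<le> ereal (l * norm (inverse t *\<^sub>R (x - y)))"
      using l(3)[of x "inverse t *\<^sub>R (x - y)"] x \<theta> unfolding Z by linarith
    moreover have "set_edist x ?Z \<le> set_edist x {z. z \<in> W' z}"
    proof (rule set_edist_localize[where \<rho> = \<rho>])
      fix s assume "s \<in> {z. z \<in> W' z}" "dist s xbar < \<rho>"
      \<comment> \<open>On the diagonal the linearization equals \<open>h \<circ> c\<close>, so the
        attentiveness test for pairs becomes the one defining \<open>nonattentive\<close>.\<close>
      then show "s \<in> ?Z" using XY[of s s] \<rho>(2) by (auto simp: nonattentive_def dist_commute subset_iff)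
    qed (use fp x \<theta> in auto)
    ultimately have "set_edist x ?Z \<le> ereal (l * norm (inverse t *\<^sub>R (x - y)))" by (rule order_trans[rotated])
    then show ?thesis using t by (simp add: mult.assoc)
  qed
  moreover have "l * inverse t > 0" using l t by simp
  ultimately show ?thesis using X(5) \<theta>(1) unfolding prox_error_bound_def by blast
qed

text \<open>If \<open>y\<close> is far from \<open>xbar\<close> while \<open>x\<close> is near, the
  step is longer than the distance from \<open>x\<close> to the solution \<open>xbar\<close>, and
  constant 1 suffices. Hence the condition on \<open>y\<close> disappears at the cost of
  \<open>max l 1\<close> and \<open>\<eta> / 2\<close>.\<close>

lemma prox_error_boundE:
  assumes eb: "prox_error_bound t \<epsilon> N" and fp: "xbar \<in> prox_map c Dc h t xbar"
  obtains l \<eta> where "l > 0" "\<eta> > 0"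
    "\<And>x y. dist x xbar < \<eta> \<Longrightarrow> y \<in> prox_map c Dc h t x \<Longrightarrow> \<bar>linearization c Dc h x y - h (c xbar)\<bar> < \<epsilon> \<Longrightarrow>
     set_edist x (N \<union> {z. z \<in> prox_map c Dc h t z}) \<le> ereal (l * norm (x - y))"
proof -
  let ?Z = "N \<union> {z. z \<in> prox_map c Dc h t z}"
  obtain l \<eta> where l: "l > 0" "\<eta> > 0"
    "\<And>x y. dist x xbar < \<eta> \<Longrightarrow> dist y xbar < \<eta> \<Longrightarrow>
     y \<in> prox_map c Dc h t x \<Longrightarrow> \<bar>linearization c Dc h x y - h (c xbar)\<bar> < \<epsilon> \<Longrightarrow>
     set_edist x ?Z \<le> ereal (l * norm (x - y))"
    using eb unfolding prox_error_bound_def by blast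
  show ?thesis
  proof
    show "max l 1 > 0" "\<eta> / 2 > 0" using l by auto
    fix x y assume x: "dist x xbar < \<eta> / 2" and y: "y \<in> prox_map c Dc h t x"
      and att: "\<bar>linearization c Dc h x y - h (c xbar)\<bar> < \<epsilon>"
    show "set_edist x ?Z \<le> ereal (max l 1 * norm (x - y))"
    proof (cases "dist y xbar < \<eta>")
      case True
      then have "set_edist x ?Z \<le> ereal (l * norm (x - y))" using l(2) x y att by (intro l(3)) auto
      also have "\<dots> \<le> ereal (max l 1 * norm (x - y))" by (simp add: mult_right_mono)
      finally show ?thesis .
    next
      case False
      then have "dist x xbar \<le> norm (x - y)" using x dist_triangle[of y xbar x] by (simp add: dist_norm norm_minus_commute)
      also have "\<dots> \<le> max l 1 * norm (x - y)" using mult_right_mono[of 1 "max l 1" "norm (x - y)"] by simp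
      finally have "ereal (dist x xbar) \<le> ereal (max l 1 * norm (x - y))" by simp
      moreover have "set_edist x ?Z \<le> ereal (dist x xbar)" using fp by (intro set_edist_le_dist) auto
      ultimately show ?thesis by (rule order_trans[rotated])
    qed
  qed
qed

lemma error_bound_imp_prox_localization:
  assumes t: "t > 0" and e: "e > 0" and eb: "prox_error_bound t (ereal e) (nonattentive (ereal e))"
    and fp: "xbar \<in> prox_map c Dc h t xbar"
  shows "\<exists>W. prox_gradient_localization c Dc h t xbar W \<and> metrically_subregular W xbar 0"
proof -
  \<comment> \<open>Nonattentive points are made fixed points, giving residual 0; steps with
    nonattentive model value are discarded, since the error bound says nothing about them.\<close>
  define W where "W x = {y \<in> prox_map c Dc h t x. \<bar>linearization c Dc h x y - h (c xbar)\<bar> < ereal e} \<union>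
    (if \<bar>h (c x) - h (c xbar)\<bar> < ereal e then {} else {x})" for x
  have Z: "{z. 0 \<in> scaled_residual t W z} = nonattentive (ereal e) \<union> {z. z \<in> prox_map c Dc h t z}"
    using t by (auto simp: zero_in_scaled_residual_iff W_def nonattentive_def)
  obtain l \<eta> where l: "l > 0" "\<eta> > 0"
    "\<And>x y. dist x xbar < \<eta> \<Longrightarrow> y \<in> prox_map c Dc h t x \<Longrightarrow> \<bar>linearization c Dc h x y - h (c xbar)\<bar> < ereal e \<Longrightarrow>
     set_edist x {z. 0 \<in> scaled_residual t W z} \<le> ereal (l * norm (x - y))"
    using prox_error_boundE[OF eb fp] unfolding Z by metis
  have "prox_map_localization c Dc h t xbar W"
    unfolding prox_map_localization_def
    by (intro exI[of _ UNIV] exI[of _ e]) (use e in \<open>auto simp: W_def\<close>)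
  then have "prox_gradient_localization c Dc h t xbar (scaled_residual t W)"
    unfolding prox_gradient_localization_def by blast
  moreover have "metrically_subregular (scaled_residual t W) xbar 0"
  proof (rule metrically_subregular_at_0I)
    show "0 \<in> scaled_residual t W xbar" using fp Z by auto
    show "0 < l * t" "0 < \<eta>" using l t by auto
    fix x w assume x: "dist x xbar < \<eta>" and "w \<in> scaled_residual t W x"
    then obtain y where y: "y \<in> W x" "w = inverse t *\<^sub>R (x - y)" by (auto simp: scaled_residual_def)
    then have eq: "l * t * norm w = l * norm (x - y)" using t by simp
    show "set_edist x {z. 0 \<in> scaled_residual t W z} \<le> ereal (l * t * norm w)"
    proof (cases "\<bar>h (c x) - h (c xbar)\<bar> < ereal e")
      case True
      then show ?thesis using l(3) x y(1) unfolding eq by (simp add: W_def)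
    next
      case False
      then have "x \<in> {z. 0 \<in> scaled_residual t W z}" unfolding Z nonattentive_def by simp
      then show ?thesis using l(1) unfolding eq by (intro set_edist_mem) auto
    qed
  qed
  ultimately show ?thesis by blast
qed

lemma finite_imp_attentive: "\<bar>h z\<bar> \<noteq> \<infinity> \<Longrightarrow> \<bar>h z - h (c xbar)\<bar> < \<infinity>"
  using fin by (cases "h z"; cases "h (c xbar)") auto

lemma subdiff_subregular_iff_error_bound:
  assumes "0 \<in> limiting_subdiff (h \<circ> c) xbar"
  shows "metrically_subregular (limiting_subdiff (h \<circ> c)) xbar 0 \<longleftrightarrow> subdiff_error_bound \<infinity> {}"
proof -
  have "\<bar>h (c x) - h (c xbar)\<bar> < \<infinity>" if "v \<in> limiting_subdiff (h \<circ> c) x" for x v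
    using that by (intro finite_imp_attentive) (simp add: limiting_subdiff_def)
  then have "(v \<in> limiting_subdiff (h \<circ> c) x \<longrightarrow> \<bar>h (c x) - h (c xbar)\<bar> < \<infinity> \<longrightarrow> P) \<longleftrightarrow>
      (v \<in> limiting_subdiff (h \<circ> c) x \<longrightarrow> P)" for x v P by blast
  then show ?thesis using assms
    by (simp only: metrically_subregular_at_0_iff subdiff_error_bound_def Un_empty_left simp_thms)
qed

lemma prox_gradient_subregular_iff_error_bound:
  assumes t: "t > 0" and fp: "xbar \<in> prox_map c Dc h t xbar"
  shows "metrically_subregular (prox_gradient_map c Dc h t) xbar 0 \<longleftrightarrow> prox_error_bound t \<infinity> {}"
proof -
  have Z: "{z. 0 \<in> prox_gradient_map c Dc h t z} = {z. z \<in> prox_map c Dc h t z}"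
    using t by (simp add: prox_gradient_map_def zero_in_scaled_residual_iff)
  have att: "\<bar>linearization c Dc h x y - h (c xbar)\<bar> < \<infinity>" if "y \<in> prox_map c Dc h t x" for x y
    unfolding linearization_eq o_def
  proof (rule finite_imp_attentive)
    show "\<bar>h (lin_map x y)\<bar> \<noteq> \<infinity>"
      using that by (cases "h (lin_map x y)")
        (auto simp: prox_map_def stationary_def limiting_subdiff_def prox_linearization_def linearization_eq)
  qed
  show ?thesis
  proof
    assume "metrically_subregular (prox_gradient_map c Dc h t) xbar 0"
    then obtain l \<eta> where l: "l > 0" "\<eta> > 0"
      "\<And>x w. dist x xbar < \<eta> \<Longrightarrow> w \<in> prox_gradient_map c Dc h t x \<Longrightarrow>
         set_edist x {z. z \<in> prox_map c Dc h t z} \<le> ereal (l * norm w)"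
      unfolding metrically_subregular_at_0_iff Z by blast
    have "set_edist x {z. z \<in> prox_map c Dc h t z} \<le> ereal (l * inverse t * norm (x - y))"
      if "dist x xbar < \<eta>" "y \<in> prox_map c Dc h t x" for x y
    proof -
      have "inverse t *\<^sub>R (x - y) \<in> prox_gradient_map c Dc h t x"
        using that(2) unfolding prox_gradient_map_def scaled_residual_def by blast
      from l(3)[OF that(1) this] show ?thesis using t by (simp add: mult.assoc)
    qed
    moreover have "l * inverse t > 0" using l t by simp
    ultimately show "prox_error_bound t \<infinity> {}" using l(2) unfolding prox_error_bound_def Un_empty_left by blast
  next
    assume "prox_error_bound t \<infinity> {}"
    then obtain l \<eta> where l': "l > 0" "\<eta> > 0"
      "\<And>x y. dist x xbar < \<eta> \<Longrightarrow> y \<in> prox_map c Dc h t x \<Longrightarrow> \<bar>linearization c Dc h x y - h (c xbar)\<bar> < \<infinity> \<Longrightarrow>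
       set_edist x ({} \<union> {z. z \<in> prox_map c Dc h t z}) \<le> ereal (l * norm (x - y))"
      using fp by (rule prox_error_boundE) blast
    have l: "set_edist x {z. z \<in> prox_map c Dc h t z} \<le> ereal (l * norm (x - y))"
      if "dist x xbar < \<eta>" "y \<in> prox_map c Dc h t x" for x y
      using l' that att by auto
    show "metrically_subregular (prox_gradient_map c Dc h t) xbar 0"
    proof (rule metrically_subregular_at_0I, unfold Z)
      show "0 \<in> prox_gradient_map c Dc h t xbar" using fp Z by blast
      show "0 < l * t" "0 < \<eta>" using l' t by auto
      fix x w assume x: "dist x xbar < \<eta>" and "w \<in> prox_gradient_map c Dc h t x"
      then obtain y where y: "y \<in> prox_map c Dc h t x" "w = inverse t *\<^sub>R (x - y)"
        by (auto simp: scaled_residual_def prox_gradient_map_def)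
      then have "l * t * norm w = l * norm (x - y)" using t by simp
      then show "set_edist x {z. z \<in> prox_map c Dc h t z} \<le> ereal (l * t * norm w)" using l[OF x y(1)] by (simp only:)
    qed
  qed
qed

end

section \<open>Transfer of error bounds between the subdifferential and the prox map\<close>

context controlled_composite begin

lemma xbar_attentive: "\<bar>h (c xbar) - h (c xbar)\<bar> < \<epsilon>"
  using fin \<epsilon> by (cases "h (c xbar)") (auto simp flip: zero_ereal_def)

lemma xbar_fixed_point:
  assumes "t > 0" "0 \<in> limiting_subdiff (h \<circ> c) xbar"
  shows "xbar \<in> prox_map c Dc h t xbar"
proof -
  obtain \<eta> where "\<eta> > 0" "\<And>x. dist x xbar < \<eta> \<Longrightarrow> \<bar>h (c x) - h (c xbar)\<bar> < \<epsilon> \<Longrightarrow>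
      0 \<in> limiting_subdiff (h \<circ> c) x \<longleftrightarrow> x \<in> prox_map c Dc h t x"
    using stationary_iff_fixed_point[OF assms(1)] by blast
  then show ?thesis using assms(2) xbar_attentive by simp
qed

text \<open>The distance from \<open>x\<close> is at most its distance to the nearby point
  \<open>u\<close> plus the error bound at \<open>u\<close>, both \<open>O(|x - y|)\<close>.
  Hypothesis \<open>N\<close> covers both uses: the nonattentive set for finite \<epsilon>, and the
  empty set for \<epsilon> = \<infinity>.\<close>

lemma subdiff_error_bound_imp_prox_error_bound:
  assumes t: "t > 0" and 0: "0 \<in> limiting_subdiff (h \<circ> c) xbar"
    and N: "\<And>z. \<bar>h (c z)\<bar> \<noteq> \<infinity> \<Longrightarrow> \<not> \<bar>h (c z) - h (c xbar)\<bar> < \<epsilon> \<Longrightarrow> z \<in> N"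
    and eb: "subdiff_error_bound \<epsilon> N"
  shows "prox_error_bound t (\<epsilon> / 2) N"
proof -
  let ?Z1 = "N \<union> {z. 0 \<in> limiting_subdiff (h \<circ> c) z}" and ?Z2 = "N \<union> {z. z \<in> prox_map c Dc h t z}"
  obtain \<eta>1 where \<eta>1: "\<eta>1 > 0"
    and stat: "\<And>x. dist x xbar < \<eta>1 \<Longrightarrow> \<bar>h (c x) - h (c xbar)\<bar> < \<epsilon> \<Longrightarrow>
      0 \<in> limiting_subdiff (h \<circ> c) x \<longleftrightarrow> x \<in> prox_map c Dc h t x"
    using stationary_iff_fixed_point[OF t] by blast
  obtain \<eta>2 \<kappa> where \<eta>2: "\<eta>2 > 0" "\<kappa> > 0"
    and near: "\<And>x y. dist x xbar < \<eta>2 \<Longrightarrow> dist y xbar < \<eta>2 \<Longrightarrow> y \<in> prox_map c Dc h t x \<Longrightarrow>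
       \<bar>linearization c Dc h x y - h (c xbar)\<bar> < \<epsilon> / 2 \<Longrightarrow>
       \<exists>u. \<exists>v \<in> limiting_subdiff (h \<circ> c) u. norm (x - u) \<le> \<kappa> * norm (x - y) \<and>
         norm v \<le> \<kappa> * norm (x - y) \<and> \<bar>h (c u) - h (c xbar)\<bar> < \<epsilon>"
    using nearby_subgradient_exists[OF t] by blast
  obtain l \<eta>3 where l: "l > 0" "\<eta>3 > 0"
    and bd: "\<And>x v. dist x xbar < \<eta>3 \<Longrightarrow> v \<in> limiting_subdiff (h \<circ> c) x \<Longrightarrow>
       \<bar>h (c x) - h (c xbar)\<bar> < \<epsilon> \<Longrightarrow> set_edist x ?Z1 \<le> ereal (l * norm v)"
    using eb unfolding subdiff_error_bound_def by blast
  \<comment> \<open>The point \<open>u\<close> may lie \<open>\<kappa> * 2 * \<eta>\<close> away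
    from \<open>x\<close>, and it must still be within \<eta>3 of \<open>xbar\<close>.\<close>
  define \<eta> where "\<eta> = min (\<eta>1 / 2) (min \<eta>2 (\<eta>3 / (1 + 2 * \<kappa>)))"
  have \<eta>: "\<eta> > 0" "\<eta> \<le> \<eta>1 / 2" "\<eta> \<le> \<eta>2" "\<eta> + 2 * \<kappa> * \<eta> \<le> \<eta>3"
  proof -
    show "\<eta> > 0" using \<eta>1 \<eta>2 l by (simp add: \<eta>_def)
    show "\<eta> \<le> \<eta>1 / 2" "\<eta> \<le> \<eta>2" unfolding \<eta>_def by linarith+
    have "\<eta> \<le> \<eta>3 / (1 + 2 * \<kappa>)" by (simp add: \<eta>_def)
    then show "\<eta> + 2 * \<kappa> * \<eta> \<le> \<eta>3" using \<eta>2 by (simp add: field_simps)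
  qed
  have "set_edist x ?Z2 \<le> ereal ((\<kappa> + l * \<kappa>) * norm (x - y))"
    if x: "dist x xbar < \<eta>" and y: "dist y xbar < \<eta>" "y \<in> prox_map c Dc h t x"
      and att: "\<bar>linearization c Dc h x y - h (c xbar)\<bar> < \<epsilon> / 2" for x y
  proof -
    obtain u v where u: "v \<in> limiting_subdiff (h \<circ> c) u" "norm (x - u) \<le> \<kappa> * norm (x - y)"
      "norm v \<le> \<kappa> * norm (x - y)" "\<bar>h (c u) - h (c xbar)\<bar> < \<epsilon>"
      using near[of x y] x y att \<eta> by auto
    have "norm (x - y) \<le> 2 * \<eta>" using dist_triangle2[of x y xbar] x y by (simp add: dist_norm)
    then have "\<kappa> * norm (x - y) \<le> 2 * \<kappa> * \<eta>" using \<eta>2(2) by simp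
    then have "dist u xbar < \<eta>3"
      using u(2) x \<eta>(4) dist_triangle[of u xbar x] by (simp add: dist_norm norm_minus_commute)
    then have "set_edist u ?Z1 \<le> ereal (l * norm v)" using bd u by blast
    then have "set_edist x ?Z1 \<le> ereal (dist x u + l * norm v)" by (rule set_edist_triangle)
    also have "\<dots> \<le> ereal ((\<kappa> + l * \<kappa>) * norm (x - y))"
    proof -
      have "l * norm v \<le> l * (\<kappa> * norm (x - y))" using u(3) l by (intro mult_left_mono) auto
      then show ?thesis using u(2) by (simp add: dist_norm algebra_simps)
    qed
    finally have "set_edist x ?Z1 \<le> ereal ((\<kappa> + l * \<kappa>) * norm (x - y))" .
    moreover have "set_edist x ?Z2 \<le> set_edist x ?Z1"
    proof (rule set_edist_localize[where \<rho> = \<eta>1 and y = xbar])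
      fix s assume s: "s \<in> ?Z1" "dist s xbar < \<eta>1"
      show "s \<in> ?Z2"
      proof (cases "s \<in> N")
        case False
        then have "0 \<in> limiting_subdiff (h \<circ> c) s" using s(1) by simp
        moreover from this have "\<bar>h (c s) - h (c xbar)\<bar> < \<epsilon>"
          using N[of s] False by (auto simp: limiting_subdiff_def)
        ultimately show ?thesis using stat s(2) by simp
      qed simp
    qed (use xbar_fixed_point[OF t 0] x \<eta> in auto)
    ultimately show ?thesis by (rule order_trans[rotated])
  qed
  moreover have "\<kappa> + l * \<kappa> > 0" using \<eta>2 l by (simp add: add_pos_pos)
  ultimately show ?thesis using \<eta>(1) unfolding prox_error_bound_def by blast
qed

lemma prox_error_bound_imp_subdiff_error_bound:
  assumes t: "t > 0" "r * (norm (Dc xbar) + \<delta>)\<^sup>2 < 1 / t" and 0: "0 \<in> limiting_subdiff (h \<circ> c) xbar"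
    and N: "\<And>z. \<bar>h (c z)\<bar> \<noteq> \<infinity> \<Longrightarrow> \<not> \<bar>h (c z) - h (c xbar)\<bar> < \<epsilon> \<Longrightarrow> z \<in> N"
    and eb: "prox_error_bound t \<epsilon> N"
  shows "subdiff_error_bound (\<epsilon> / 2) N"
proof -
  let ?Z1 = "N \<union> {z. 0 \<in> limiting_subdiff (h \<circ> c) z}" and ?Z2 = "N \<union> {z. z \<in> prox_map c Dc h t z}"
  obtain \<eta>1 where \<eta>1: "\<eta>1 > 0"
    and stat: "\<And>x. dist x xbar < \<eta>1 \<Longrightarrow> \<bar>h (c x) - h (c xbar)\<bar> < \<epsilon> \<Longrightarrow>
      0 \<in> limiting_subdiff (h \<circ> c) x \<longleftrightarrow> x \<in> prox_map c Dc h t x"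
    using stationary_iff_fixed_point[OF t(1)] by blast
  obtain \<eta>2 \<kappa> where \<eta>2: "\<eta>2 > 0" "\<kappa> > 0"
    and step: "\<And>x v. dist x xbar < \<eta>2 \<Longrightarrow> v \<in> limiting_subdiff (h \<circ> c) x \<Longrightarrow> norm v < \<eta>2 \<Longrightarrow>
       \<bar>h (c x) - h (c xbar)\<bar> < \<epsilon> / 2 \<Longrightarrow>
       \<exists>y \<in> prox_map c Dc h t x. norm (x - y) \<le> \<kappa> * norm v \<and>
         \<bar>linearization c Dc h x y - h (c xbar)\<bar> < \<epsilon>"
    using prox_step_exists[OF t] by blast
  obtain l \<eta>3 where l: "l > 0" "\<eta>3 > 0"
    and bd: "\<And>x y. dist x xbar < \<eta>3 \<Longrightarrow> y \<in> prox_map c Dc h t x \<Longrightarrow> \<bar>linearization c Dc h x y - h (c xbar)\<bar> < \<epsilon> \<Longrightarrow>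
     set_edist x ?Z2 \<le> ereal (l * norm (x - y))"
    using prox_error_boundE[OF eb xbar_fixed_point[OF t(1) 0]] by metis
  \<comment> \<open>The last entry handles \<open>norm v \<ge> \<eta>2\<close>, where
    \<open>step\<close> does not apply: the distance to \<open>xbar\<close> is then within the
    claimed bound.\<close>
  define \<eta> where "\<eta> = min (\<eta>1 / 2) (min \<eta>2 (min \<eta>3 (l * \<kappa> * \<eta>2)))"
  have \<eta>: "\<eta> > 0" "\<eta> \<le> \<eta>1 / 2" "\<eta> \<le> \<eta>2" "\<eta> \<le> \<eta>3" "\<eta> \<le> l * \<kappa> * \<eta>2"
    using \<eta>1 \<eta>2 l by (auto simp: \<eta>_def)
  have "set_edist x ?Z1 \<le> ereal (l * \<kappa> * norm v)"
    if x: "dist x xbar < \<eta>" and v: "v \<in> limiting_subdiff (h \<circ> c) x"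
      and att: "\<bar>h (c x) - h (c xbar)\<bar> < \<epsilon> / 2" for x v
  proof (cases "norm v < \<eta>2")
    case True
    then obtain y where y: "y \<in> prox_map c Dc h t x" "norm (x - y) \<le> \<kappa> * norm v"
         "\<bar>linearization c Dc h x y - h (c xbar)\<bar> < \<epsilon>"
      using step[of x v] x v att \<eta> by auto
    have "set_edist x ?Z2 \<le> ereal (l * norm (x - y))" using bd y x \<eta>(4) by simp
    also have "\<dots> \<le> ereal (l * \<kappa> * norm v)" using y(2) l by (simp add: mult.assoc)
    finally have "set_edist x ?Z2 \<le> ereal (l * \<kappa> * norm v)" .
    moreover have "set_edist x ?Z1 \<le> set_edist x ?Z2"
    proof (rule set_edist_localize[where \<rho> = \<eta>1 and y = xbar])
      fix s assume s: "s \<in> ?Z2" "dist s xbar < \<eta>1"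
      show "s \<in> ?Z1"
      proof (cases "s \<in> N")
        case False
        then have S: "s \<in> prox_map c Dc h t s" using s(1) by simp
        then have "\<bar>h (c s)\<bar> \<noteq> \<infinity>"
          by (auto simp: prox_map_def stationary_def limiting_subdiff_def prox_linearization_def simp flip: zero_ereal_def)
        then have "\<bar>h (c s) - h (c xbar)\<bar> < \<epsilon>" using N[of s] False by auto
        then show ?thesis using stat s(2) S by simp
      qed simp
    qed (use 0 x \<eta> in auto)
    ultimately show ?thesis by (rule order_trans[rotated])
  next
    case False
    have "set_edist x ?Z1 \<le> ereal (dist x xbar)" using 0 by (intro set_edist_le_dist) auto
    also have "\<dots> \<le> ereal (l * \<kappa> * norm v)"
    proof -
      have "l * \<kappa> * \<eta>2 \<le> l * \<kappa> * norm v" using False l \<eta>2 by (intro mult_left_mono) auto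
      then show ?thesis using x \<eta>(5) by simp
    qed
    finally show ?thesis .
  qed
  moreover have "l * \<kappa> > 0" using \<eta>2 l by simp
  ultimately show ?thesis using \<eta>(1) unfolding subdiff_error_bound_def by blast
qed

end

lemma ereal_half: "ereal e / 2 = ereal (e / 2)"
  by (metis ereal_divide numeral_eq_ereal zero_neq_numeral)

section \<open>The equivalence of the subregularity conditions\<close>

theorem theorem8p11:
  fixes c :: "real ^ 'n \<Rightarrow> real ^ 'm"
    and Dc :: "real ^ 'n \<Rightarrow> (real ^ 'n) \<Rightarrow>\<^sub>L (real ^ 'm)"
    and h :: "real ^ 'm \<Rightarrow> ereal"
    and xbar :: "real ^ 'n"
  assumes c_deriv: "\<And>x. (c has_derivative blinfun_apply (Dc x)) (at x)"
    and c_C1: "continuous_on UNIV Dc"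
    and h_closed: "closed_fun h"
    and transv: "transverse c Dc h xbar"
    and xbar_stat: "0 \<in> limiting_subdiff (h \<circ> c) xbar"
    and Dc_lipschitz: "\<exists>L U. open U \<and> xbar \<in> U \<and> L-lipschitz_on U Dc"
    and h_prox_regular:
      "\<And>w. w \<in> limiting_subdiff h (c xbar) \<Longrightarrow> adjoint (blinfun_apply (Dc xbar)) w = 0 \<Longrightarrow>
        prox_regular h (c xbar) w"
  shows
    "(\<forall>t>0.
        (\<exists>W. subdiff_localization (h \<circ> c) xbar W \<and> metrically_subregular W xbar 0) \<longrightarrow>
        (\<exists>W. prox_gradient_localization c Dc h t xbar W \<and> metrically_subregular W xbar 0)) \<and>
     (\<exists>tbar>0. \<forall>t. 0 < t \<and> t < tbar \<longrightarrow>
        (\<exists>W. prox_gradient_localization c Dc h t xbar W \<and> metrically_subregular W xbar 0) \<longrightarrow>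
        (\<exists>W. subdiff_localization (h \<circ> c) xbar W \<and> metrically_subregular W xbar 0)) \<and>
     (convex_fun h \<longrightarrow>
        (\<forall>t>0.
          metrically_subregular (limiting_subdiff (h \<circ> c)) xbar 0 \<longleftrightarrow>
          metrically_subregular (prox_gradient_map c Dc h t) xbar 0))"
proof -
  have fin: "\<bar>h (c xbar)\<bar> \<noteq> \<infinity>" using transv by (simp add: transverse_def)
  have tr: "w = 0" if "w \<in> horizon_subdiff h (c xbar)" "adjoint (blinfun_apply (Dc xbar)) w = 0" for w
    using transv that unfolding transverse_def by blast
  interpret composite c Dc h xbar
    by unfold_locales (fact c_deriv c_C1 h_closed fin Dc_lipschitz)+
  obtain \<delta> e0 M r where \<delta>: "\<delta> > 0" "e0 > 0" "r > 0" and
    control: "subgradient_control h (c xbar) (Dc xbar) \<delta> (ereal e0) M r"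
    using prox_regular_subgradient_control[where h = h and zb = "c xbar" and Ab = "Dc xbar", OF fin tr h_prox_regular]
    by blast
  have loc: "controlled_composite c Dc h xbar \<delta> (ereal e) M r" if "0 < e" "e \<le> e0" for e
    by unfold_locales (use that \<delta> subgradient_control_mono[OF control] in auto)
  have fp: "xbar \<in> prox_map c Dc h t xbar" if "t > 0" for t
    using controlled_composite.xbar_fixed_point[OF loc[OF \<delta>(2) order_refl] that xbar_stat] .
  have na: "z \<in> nonattentive \<epsilon>" if "\<not> \<bar>h (c z) - h (c xbar)\<bar> < \<epsilon>" for z \<epsilon>
    using that by (simp add: nonattentive_def)
  \<comment> \<open>For \<open>t < tbar\<close> one gets
    \<open>r * (norm (Dc xbar) + \<delta>)\<^sup>2 + 1 < 1 / t\<close>, more than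
    \<open>prox_step_exists\<close> asks; the 1 also keeps the denominator positive.\<close>
  define tbar where "tbar = 1 / (r * (norm (Dc xbar) + \<delta>)\<^sup>2 + 1)"
  have den: "r * (norm (Dc xbar) + \<delta>)\<^sup>2 + 1 > 0" using \<delta> by (intro add_nonneg_pos) auto
  show ?thesis
  proof (intro conjI allI impI exI[of _ tbar])
    fix t :: real assume t: "t > 0"
    assume "\<exists>W. subdiff_localization (h \<circ> c) xbar W \<and> metrically_subregular W xbar 0"
    then obtain e1 where e1: "e1 > 0" "subdiff_error_bound (ereal e1) (nonattentive (ereal e1))"
      using subdiff_localization_imp_error_bound xbar_stat by blast
    define e where "e = min e0 e1"
    have e: "e > 0" "e \<le> e0" "e \<le> e1" using e1 \<delta> by (auto simp: e_def)
    interpret controlled_composite c Dc h xbar \<delta> "ereal e" M r by (rule loc[OF e(1,2)])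
    have "subdiff_error_bound (ereal e) (nonattentive (ereal e))"
      using e(3) by (intro subdiff_error_bound_mono[OF e1(2)] nonattentive_antimono) auto
    then have "prox_error_bound t (ereal (e / 2)) (nonattentive (ereal e))"
      using subdiff_error_bound_imp_prox_error_bound[OF t xbar_stat na] by (simp add: ereal_half)
    \<comment> \<open>A localization uses one tolerance for both roles, so the exempt set is
      enlarged to match the halved one.\<close>
    then have "prox_error_bound t (ereal (e / 2)) (nonattentive (ereal (e / 2)))"
      using e(1) by (elim prox_error_bound_mono) (auto intro!: nonattentive_antimono)
    then show "\<exists>W. prox_gradient_localization c Dc h t xbar W \<and> metrically_subregular W xbar 0"
      using e(1) by (intro error_bound_imp_prox_localization[OF t _ _ fp[OF t], of "e / 2"]) auto
  next
    show "tbar > 0" using den by (simp add: tbar_def)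
    fix t assume t: "0 < t \<and> t < tbar"
    then have t0: "t > 0" by simp
    have small: "r * (norm (Dc xbar) + \<delta>)\<^sup>2 < 1 / t"
    proof -
      have "t * (r * (norm (Dc xbar) + \<delta>)\<^sup>2 + 1) < 1" using t den by (simp add: tbar_def pos_less_divide_eq)
      then show ?thesis using t0 by (simp add: field_simps)
    qed
    assume "\<exists>W. prox_gradient_localization c Dc h t xbar W \<and> metrically_subregular W xbar 0"
    then obtain e1 where e1: "e1 > 0" "prox_error_bound t (ereal e1) (nonattentive (ereal e1))"
      using prox_localization_imp_error_bound[OF t0 _ _ fp[OF t0]] by blast
    define e where "e = min e0 e1"
    have e: "e > 0" "e \<le> e0" "e \<le> e1" using e1 \<delta> by (auto simp: e_def)
    interpret controlled_composite c Dc h xbar \<delta> "ereal e" M r by (rule loc[OF e(1,2)])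
    have "prox_error_bound t (ereal e) (nonattentive (ereal e))"
      using e(3) by (intro prox_error_bound_mono[OF e1(2)] nonattentive_antimono) auto
    then have "subdiff_error_bound (ereal (e / 2)) (nonattentive (ereal e))"
      using prox_error_bound_imp_subdiff_error_bound[OF t0 small xbar_stat na] by (simp add: ereal_half)
    then have "subdiff_error_bound (ereal (e / 2)) (nonattentive (ereal (e / 2)))"
      using e(1) by (elim subdiff_error_bound_mono) (auto intro!: nonattentive_antimono)
    then show "\<exists>W. subdiff_localization (h \<circ> c) xbar W \<and> metrically_subregular W xbar 0"
      using e(1) by (intro error_bound_imp_subdiff_localization[OF _ _ xbar_stat, of "e / 2"]) auto
  next
    assume conv: "convex_fun h"
    fix t :: real assume t: "t > 0"
    \<comment> \<open>The exact chain rule at the stationary point supplies the base subgradient of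
      \<open>h\<close> from which the convex argument builds horizon subgradients.\<close>
    obtain wb where wb: "wb \<in> limiting_subdiff h (c xbar)"
    proof -
      interpret controlled_composite c Dc h xbar \<delta> "ereal e0" M r by (rule loc[OF \<delta>(2) order_refl])
      show thesis
        by (rule multiplier_exists[OF c_deriv isCont_Dc xbar_stat]) (use \<delta> xbar_attentive that in auto)
    qed
    obtain \<delta>' M' where \<delta>': "\<delta>' > 0" "subgradient_control h (c xbar) (Dc xbar) \<delta>' \<infinity> M' 0"
      using convex_subgradient_control[where Ab = "Dc xbar", OF h_closed conv wb tr] by blast
    \<comment> \<open>With tolerance \<infinity> halving changes nothing and the exempt set is
      empty; with \<open>r = 0\<close> the restriction on \<open>t\<close> reads
      \<open>0 < 1 / t\<close>.\<close>
    interpret controlled_composite c Dc h xbar \<delta>' \<infinity> M' 0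
      by unfold_locales (use \<delta>' in auto)
    have N: "z \<in> {}" if "\<bar>h (c z)\<bar> \<noteq> \<infinity>" "\<not> \<bar>h (c z) - h (c xbar)\<bar> < \<infinity>" for z
      using finite_imp_attentive[OF that(1)] that(2) by simp
    have small: "0 * (norm (Dc xbar) + \<delta>')\<^sup>2 < 1 / t" using t by simp
    have "subdiff_error_bound \<infinity> {} \<longleftrightarrow> prox_error_bound t \<infinity> {}"
      using subdiff_error_bound_imp_prox_error_bound[OF t xbar_stat N]
        prox_error_bound_imp_subdiff_error_bound[OF t small xbar_stat N] by auto
    then show "metrically_subregular (limiting_subdiff (h \<circ> c)) xbar 0 \<longleftrightarrow>
          metrically_subregular (prox_gradient_map c Dc h t) xbar 0"
      using subdiff_subregular_iff_error_bound[OF xbar_stat] prox_gradient_subregular_iff_error_bound[OF t fp[OF t]]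
      by simp
  qed
qed

end
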